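(* Let $\sigma=\{\sigma_i \mid i\in I\}$ be a partition of the set $\mathbb{P}$ of all primes and let $G$ be a finite group that is $\sigma$-full. Let $D=G^{\mathfrak{N}_\sigma}$ be the $\sigma$-nilpotent residual of $G$ and let $\mathcal{L}=\mathcal{L}_{\sigma per}(G)$ be the lattice of all $\sigma$-permutable subgroups of $G$. Then the lattice $\mathcal{L}$ is distributive if and only if all of the following conditions hold: (i) Every two members $A,B$ of $\mathcal{L}$ are permutable, i.e. $AB=BA$. (ii) The lattice $\mathcal{L}_n(G)$ of all normal subgroups of $G$ is distributive. (iii) $G/D$ is cyclic and $D$ is a meet-distributive element of $\mathcal{L}$. (iv) In every factor group $\bar G=G/R$ (with $R$ a normal subgroup of $G$), for every $i\in I$, any two $O^{\sigma_i}(\bar G)$-isomorphic sections $\bar H/\bar K$ and $\bar L/\bar K$, where $\bar K,\bar H,\bar L\in\mathcal{L}_{\sigma_i}(\bar G)$, coincide (i.e. $\bar H=\bar L$).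
   Context: All groups are finite. $\sigma=\{\sigma_i\mid i\in I\}$ is a partition of the set $\mathbb{P}$ of all primes, i.e. $\mathbb{P}=\bigcup_{i\in I}\sigma_i$ and $\sigma_i\cap\sigma_j=\emptyset$ for $i\neq j$. $\pi(G)$ denotes the set of primes dividing $|G|$. A set $\mathcal{H}$ of subgroups of $G$ is a complete Hall $\sigma$-set of $G$ if every member $\neq 1$ of $\mathcal{H}$ is a Hall $\sigma_i$-subgroup of $G$ for some $i$, and $\mathcal{H}$ contains exactly one Hall $\sigma_i$-subgroup of $G$ for every $i$ with $\sigma_i\cap\pi(G)\neq\emptyset$. $G$ is $\sigma$-full if it possesses a complete Hall $\sigma$-set. A subgroup $A$ of $G$ is $\sigma$-permutable in $G$ if $G$ is $\sigma$-full and $AH=HA$ for every Hall $\sigma_i$-subgroup $H$ of $G$ and every $i\in I$. For $\sigma$-full $G$, the set $\mathcal{L}_{\sigma per}(G)$ of all $\sigma$-permutable subgroups of $G$, ordered by inclusion, is a lattice (the join of $A,B$ is $\langle A,B\rangle$ and the meet is $A\cap B$). $G$ is $\sigma$-nilpotent if $G=H_1\times\cdots\times H_t$ where $\{H_1,\dots,H_t\}$ is a complete Hall $\sigma$-set of $G$. The $\sigma$-nilpotent residual $G^{\mathfrak{N}_\sigma}$ is the intersection of all normal subgroups $N$ of $G$ with $G/N$ $\sigma$-nilpotent. An element $a$ of a lattice $\mathcal{L}$ is meet-distributive if $a\wedge(b\vee c)=(a\wedge b)\vee(a\wedge c)$ for all $b,c\in\mathcal{L}$. $\mathcal{L}_{\sigma_i}(G)$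 denotes the set of all $\sigma$-permutable $\sigma_i$-subgroups of $G$. $O^{\sigma_i}(G)$ is the smallest normal subgroup $N$ of $G$ such that $G/N$ is a $\sigma_i$-group. It is known that $O^{\sigma_i}(G)$ normalizes every member of $\mathcal{L}_{\sigma_i}(G)$. A section $H/K$ with $K,H\in\mathcal{L}_{\sigma_i}(G)$ means $K\trianglelefteq H$, and $O^{\sigma_i}(G)$ is a group of operators for $H/K$ via $(hK)^a=h^aK$ for $hK\in H/K$, $a\in O^{\sigma_i}(G)$. Two such sections are $O^{\sigma_i}(G)$-isomorphic if there is a group isomorphism between them commuting with the action of $O^{\sigma_i}(G)$. *)

theory Defs
  imports "HOL-Algebra.Algebra"
begin

text \<open>The members \<open>\<sigma> i\<close> of the partition are not required to be nonempty.\<close>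

definition prime_partition :: "'i set \<Rightarrow> ('i \<Rightarrow> nat set) \<Rightarrow> bool" where
  "prime_partition I \<sigma> \<longleftrightarrow> (\<Union>i\<in>I. \<sigma> i) = {p. Factorial_Ring.prime p} \<and> disjoint_family_on \<sigma> I"

definition pi_number :: "nat set \<Rightarrow> nat \<Rightarrow> bool" where
  "pi_number \<pi> n \<longleftrightarrow> (\<forall>p. Factorial_Ring.prime p \<and> p dvd n \<longrightarrow> p \<in> \<pi>)"

definition group_primes :: "('a, 'b) monoid_scheme \<Rightarrow> nat set" where
  "group_primes G = {p. Factorial_Ring.prime p \<and> p dvd order G}"

definition pi_group :: "nat set \<Rightarrow> ('a, 'b) monoid_scheme \<Rightarrow> bool" where
  "pi_group \<pi> G \<longleftrightarrow> pi_number \<pi> (order G)"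

definition hall_subgroup :: "('a, 'b) monoid_scheme \<Rightarrow> nat set \<Rightarrow> 'a set \<Rightarrow> bool" where
  "hall_subgroup G \<pi> H \<longleftrightarrow>
     subgroup H G \<and> pi_number \<pi> (card H) \<and> pi_number (- \<pi>) (card (rcosets\<^bsub>G\<^esub> H))"

definition complete_hall_set ::
  "'i set \<Rightarrow> ('i \<Rightarrow> nat set) \<Rightarrow> ('a, 'b) monoid_scheme \<Rightarrow> 'a set set \<Rightarrow> bool" where
  "complete_hall_set I \<sigma> G \<H> \<longleftrightarrow>
     (\<forall>H\<in>\<H>. subgroup H G) \<and>
     (\<forall>H\<in>\<H>. H \<noteq> {\<one>\<^bsub>G\<^esub>} \<longrightarrow> (\<exists>i\<in>I. hall_subgroup G (\<sigma> i) H)) \<and>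
     (\<forall>i\<in>I. \<sigma> i \<inter> group_primes G \<noteq> {} \<longrightarrow> (\<exists>!H. H \<in> \<H> \<and> hall_subgroup G (\<sigma> i) H))"

definition sigma_full :: "'i set \<Rightarrow> ('i \<Rightarrow> nat set) \<Rightarrow> ('a, 'b) monoid_scheme \<Rightarrow> bool" where
  "sigma_full I \<sigma> G \<longleftrightarrow> (\<exists>\<H>. complete_hall_set I \<sigma> G \<H>)"

definition sigma_permutable ::
  "'i set \<Rightarrow> ('i \<Rightarrow> nat set) \<Rightarrow> ('a, 'b) monoid_scheme \<Rightarrow> 'a set \<Rightarrow> bool" where
  "sigma_permutable I \<sigma> G A \<longleftrightarrow>
     subgroup A G \<and> sigma_full I \<sigma> G \<and>
     (\<forall>i\<in>I. \<forall>H. hall_subgroup G (\<sigma> i) H \<longrightarrow> A <#>\<^bsub>G\<^esub> H = H <#>\<^bsub>G\<^esub> A)"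

definition internal_direct_product :: "('a, 'b) monoid_scheme \<Rightarrow> 'a set set \<Rightarrow> bool" where
  "internal_direct_product G \<H> \<longleftrightarrow>
     (\<forall>H\<in>\<H>. H \<lhd> G) \<and>
     generate G (\<Union>\<H>) = carrier G \<and>
     (\<forall>H\<in>\<H>. H \<inter> generate G (\<Union>(\<H> - {H})) = {\<one>\<^bsub>G\<^esub>})"

definition sigma_nilpotent :: "'i set \<Rightarrow> ('i \<Rightarrow> nat set) \<Rightarrow> ('a, 'b) monoid_scheme \<Rightarrow> bool" where
  "sigma_nilpotent I \<sigma> G \<longleftrightarrow>
     (\<exists>\<H>. complete_hall_set I \<sigma> G \<H> \<and> internal_direct_product G \<H>)"

definition sigma_nilpotent_residual ::
  "'i set \<Rightarrow> ('i \<Rightarrow> nat set) \<Rightarrow> ('a, 'b) monoid_scheme \<Rightarrow> 'a set" where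
  "sigma_nilpotent_residual I \<sigma> G = \<Inter>{N. N \<lhd> G \<and> sigma_nilpotent I \<sigma> (G Mod N)}"

definition inclusion_order :: "'a set set \<Rightarrow> 'a set gorder" where
  "inclusion_order \<S> = \<lparr>carrier = \<S>, eq = (=), le = (\<subseteq>)\<rparr>"

definition sigma_perm_lattice ::
  "'i set \<Rightarrow> ('i \<Rightarrow> nat set) \<Rightarrow> ('a, 'b) monoid_scheme \<Rightarrow> 'a set gorder" where
  "sigma_perm_lattice I \<sigma> G = inclusion_order {A. sigma_permutable I \<sigma> G A}"

definition normal_lattice :: "('a, 'b) monoid_scheme \<Rightarrow> 'a set gorder" where
  "normal_lattice G = inclusion_order {N. N \<lhd> G}"

definition meet_distributive :: "('c, 'd) gorder_scheme \<Rightarrow> 'c \<Rightarrow> bool" where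
  "meet_distributive L a \<longleftrightarrow>
     a \<in> carrier L \<and>
     (\<forall>b\<in>carrier L. \<forall>c\<in>carrier L. a \<sqinter>\<^bsub>L\<^esub> (b \<squnion>\<^bsub>L\<^esub> c) = (a \<sqinter>\<^bsub>L\<^esub> b) \<squnion>\<^bsub>L\<^esub> (a \<sqinter>\<^bsub>L\<^esub> c))"

definition distributive :: "('c, 'd) gorder_scheme \<Rightarrow> bool" where
  "distributive L \<longleftrightarrow> lattice L \<and> (\<forall>a\<in>carrier L. meet_distributive L a)"

definition sigma_perm_pi_subgroups ::
  "'i set \<Rightarrow> ('i \<Rightarrow> nat set) \<Rightarrow> ('a, 'b) monoid_scheme \<Rightarrow> 'i \<Rightarrow> 'a set set" where
  "sigma_perm_pi_subgroups I \<sigma> G i = {A. sigma_permutable I \<sigma> G A \<and> pi_number (\<sigma> i) (card A)}"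

text \<open>The least element is taken with respect to inclusion.\<close>

definition pi_residual :: "('a, 'b) monoid_scheme \<Rightarrow> nat set \<Rightarrow> 'a set" where
  "pi_residual G \<pi> = (LEAST N. N \<lhd> G \<and> pi_group \<pi> (G Mod N))"

definition section_group :: "('a, 'b) monoid_scheme \<Rightarrow> 'a set \<Rightarrow> 'a set \<Rightarrow> 'a set monoid" where
  "section_group G H K = (G\<lparr>carrier := H\<rparr>) Mod K"

text \<open>
  The action \<open>(hK)\<^sup>a = h\<^sup>aK\<close>, where \<open>h\<^sup>a = a\<^sup>-\<^sup>1ha\<close>. If \<open>K\<close> is normal in \<open>H\<close> and \<open>a\<close> normalizes
  both \<open>H\<close> and \<open>K\<close>, then all sets in the union are equal, so that it does not depend on a choice of
  the representative \<open>h\<close> of the coset \<open>C\<close>; and left and right cosets of \<open>K\<close> in \<open>H\<close> agree.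
\<close>

definition section_conj :: "('a, 'b) monoid_scheme \<Rightarrow> 'a set \<Rightarrow> 'a set \<Rightarrow> 'a \<Rightarrow> 'a set" where
  "section_conj G K C a = (\<Union>h\<in>C. K #>\<^bsub>G\<^esub> (inv\<^bsub>G\<^esub> a \<otimes>\<^bsub>G\<^esub> h \<otimes>\<^bsub>G\<^esub> a))"

definition operator_isomorphic_sections ::
  "('a, 'b) monoid_scheme \<Rightarrow> 'a set \<Rightarrow> 'a set \<Rightarrow> 'a set \<Rightarrow> 'a set \<Rightarrow> 'a set \<Rightarrow> bool" where
  "operator_isomorphic_sections G Op H K L M \<longleftrightarrow>
     (\<exists>\<phi>\<in>iso (section_group G H K) (section_group G L M).
        \<forall>C\<in>carrier (section_group G H K). \<forall>a\<in>Op.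
          \<phi> (section_conj G K C a) = section_conj G M (\<phi> C) a)"

definition isomorphic_sections_coincide ::
  "'i set \<Rightarrow> ('i \<Rightarrow> nat set) \<Rightarrow> ('a, 'b) monoid_scheme \<Rightarrow> 'i \<Rightarrow> bool" where
  "isomorphic_sections_coincide I \<sigma> G i \<longleftrightarrow>
     (\<forall>K\<in>sigma_perm_pi_subgroups I \<sigma> G i.
      \<forall>H\<in>sigma_perm_pi_subgroups I \<sigma> G i.
      \<forall>L\<in>sigma_perm_pi_subgroups I \<sigma> G i.
        K \<lhd> G\<lparr>carrier := H\<rparr> \<and> K \<lhd> G\<lparr>carrier := L\<rparr> \<and>
        operator_isomorphic_sections G (pi_residual G (\<sigma> i)) H K L K \<longrightarrow> H = L)"

end

theory Submission
  imports Defs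
begin

text \<open>
  A permutable subgroup \<open>A\<close> satisfies \<open>K \<inter> AH \<subseteq> A\<close> for a Hall \<open>\<sigma>\<^sub>i\<close>-subgroup \<open>H\<close> and a Hall
  \<open>\<sigma>\<^sub>j\<close>-subgroup \<open>K\<close> with \<open>i \<noteq> j\<close>, because \<open>AK \<inter> AH = A\<close> by comparison of indices. So the subgroup
  generated by the intersections of \<open>A\<close> with the Hall \<open>\<sigma>\<^sub>i\<close>-subgroups is normalized by the
  \<open>\<sigma>\<^sub>i\<close>-residual of \<open>G\<close>, and the intersection \<open>D\<close> of these residuals normalizes every permutable
  subgroup.

  If the lattice is distributive, then \<open>G/D\<close> is cyclic by Ore's theorem, since all subgroups above
  \<open>D\<close> are permutable. Commutators \<open>[b, a]\<close> of elements of \<open>B\<close> and \<open>A\<close> lie in \<open>D \<inter> (A \<squnion> B) = (D \<inter>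
  A)(D \<inter> B)\<close>, which gives \<open>AB = BA\<close>. Isomorphic sections coincide, because the graph of the
  isomorphism would yield a diamond.

  Conversely permutability makes the lattice modular, so a failure of distributivity yields a
  diamond \<open>A, B, C\<close> with meet \<open>E\<close> and join \<open>T\<close>. By meet-distributivity of \<open>D\<close> its intersection
  with \<open>D\<close> is again a diamond, and as \<open>G/D\<close> is cyclic it suffices to refute diamonds inside \<open>D\<close>.
  There \<open>T/E\<close> is abelian, and its Hall parts are again diamonds. Translating by a maximal normal
  subgroup \<open>R\<close> with \<open>R \<inter> T \<subseteq> E\<close> turns \<open>T/R\<close> into a \<open>\<sigma>\<^sub>i\<close>-group, and \<open>A/E\<close>, \<open>B/E\<close> become isomorphic
  sections of \<open>G/R\<close>.
\<close>

section \<open>Subgroups of finite groups\<close>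

text \<open>Hall \<open>\<sigma> i\<close>-subgroups need not be conjugate, and those of
  \<open>G/R\<close> need not be images of those of \<open>G\<close>. So the constructions run over
  all Hall subgroups at once, and equalities come from an index that is a number for two disjoint
  sets of primes. Permutability is lifted from \<open>G/R\<close> to \<open>G\<close> directly, but
  it is carried down only for \<open>\<sigma> i\<close>-subgroups, through a description by
  \<open>sigma_core\<close> and \<open>sigma_residual\<close>. A diamond can therefore be read in
  \<open>G/R\<close> once its top is a \<open>\<sigma> i\<close>-group modulo \<open>R\<close>. This
  is the purpose of the maximal \<open>R\<close>: it leaves no normal
  \<open>\<sigma> j\<close>-subgroup in \<open>G/R\<close> for \<open>j \<noteq> i\<close> that
  could keep a part of \<open>E\<close> outside \<open>R\<close>. In the other direction the graph
  of an isomorphism of sections is a subgroup only if \<open>H\<close> and \<open>L\<close> commute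
  modulo \<open>K\<close>. Distributivity gives this in two stages: first for the parts
  \<open>K[H, Y]\<close> and \<open>K[L, Y]\<close>, where \<open>Y\<close> is the group of
  operators, then modulo their common value, on which \<open>Y\<close> acts trivially, so that all
  subgroups in between are invariant and Ore's theorem applies.\<close>

lemma pi_number_mult: "pi_number \<pi> (m * n) \<longleftrightarrow> pi_number \<pi> m \<and> pi_number \<pi> n"
  unfolding pi_number_def by (auto simp: prime_dvd_mult_iff)

lemma pi_number_dvd: "pi_number \<pi> n \<Longrightarrow> m dvd n \<Longrightarrow> pi_number \<pi> m"
  unfolding pi_number_def by (auto intro: dvd_trans)

lemma pi_number_disjoint:
  assumes "pi_number \<pi> n" "pi_number \<rho> n" "\<pi> \<inter> \<rho> = {}"
  shows "n = 1"
proof (rule ccontr)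
  assume "n \<noteq> 1"
  then obtain p where "Factorial_Ring.prime p" "p dvd n" using prime_factor_nat by blast
  then show False using assms unfolding pi_number_def by blast
qed

lemma pi_number_one [simp]: "pi_number \<pi> (Suc 0)"
  unfolding pi_number_def by (metis One_nat_def not_prime_unit)

text \<open>A ratio of cardinalities instead of a number of cosets: \<open>B\<close> may be a
  product set that is not a subgroup, so that \<open>A \<inter> B\<close> in \<open>A\<close> can be
  compared with \<open>B\<close> in \<open>A <#> B\<close>.\<close>

definition pi_index :: "nat set \<Rightarrow> 'a set \<Rightarrow> 'a set \<Rightarrow> bool" where
  "pi_index \<pi> A B \<longleftrightarrow> (\<exists>n. card B = n * card A \<and> pi_number \<pi> n)"

lemma pi_index_refl [simp]: "pi_index \<pi> A A"
  unfolding pi_index_def by (rule exI[of _ 1]) simp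

lemma pi_index_trans: "pi_index \<pi> A B \<Longrightarrow> pi_index \<pi> B C \<Longrightarrow> pi_index \<pi> A C"
  unfolding pi_index_def by (metis mult.assoc pi_number_mult)

definition conjugate :: "('a, 'b) monoid_scheme \<Rightarrow> 'a \<Rightarrow> 'a \<Rightarrow> 'a" where
  "conjugate G x a = inv\<^bsub>G\<^esub> x \<otimes>\<^bsub>G\<^esub> a \<otimes>\<^bsub>G\<^esub> x"

text \<open>\<open>V\<close> may be any set, for example a set of generators, and only an inclusion
  is asked for; inside a finite group it passes to the generated subgroup, inverses included, by
  \<open>normalizes_generate_left\<close>.\<close>

definition normalizes :: "('a, 'b) monoid_scheme \<Rightarrow> 'a set \<Rightarrow> 'a set \<Rightarrow> bool" where
  "normalizes G V A \<longleftrightarrow> (\<forall>x\<in>V. \<forall>a\<in>A. conjugate G x a \<in> A)"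

lemma normalizesD: "normalizes G V A \<Longrightarrow> x \<in> V \<Longrightarrow> a \<in> A \<Longrightarrow> conjugate G x a \<in> A"
  unfolding normalizes_def by blast

lemma normalizes_mono: "normalizes G V A \<Longrightarrow> Z \<subseteq> V \<Longrightarrow> normalizes G Z A"
  unfolding normalizes_def by blast

lemma normalizes_Int: "normalizes G V A \<Longrightarrow> normalizes G V B \<Longrightarrow> normalizes G V (A \<inter> B)"
  unfolding normalizes_def by blast

section \<open>Conjugation, normalization and products of subgroups\<close>

context group
begin

lemma inv_mult_cancel_left [simp]:
  "x \<in> carrier G \<Longrightarrow> y \<in> carrier G \<Longrightarrow> inv x \<otimes> (x \<otimes> y) = y"
  "x \<in> carrier G \<Longrightarrow> y \<in> carrier G \<Longrightarrow> x \<otimes> (inv x \<otimes> y) = y"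
  by (simp_all add: m_assoc[symmetric])

lemma conjugate_closed [simp]: "x \<in> carrier G \<Longrightarrow> a \<in> carrier G \<Longrightarrow> conjugate G x a \<in> carrier G"
  by (simp add: conjugate_def)

lemma conjugate_one [simp]: "x \<in> carrier G \<Longrightarrow> conjugate G x \<one> = \<one>"
    "a \<in> carrier G \<Longrightarrow> conjugate G \<one> a = a"
  by (simp_all add: conjugate_def)

lemma conjugate_mult: "x \<in> carrier G \<Longrightarrow> a \<in> carrier G \<Longrightarrow> b \<in> carrier G \<Longrightarrow>
    conjugate G x (a \<otimes> b) = conjugate G x a \<otimes> conjugate G x b"
  by (simp add: conjugate_def m_assoc)

lemma conjugate_inv: "x \<in> carrier G \<Longrightarrow> a \<in> carrier G \<Longrightarrow> conjugate G x (inv a) = inv (conjugate G x a)"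
  by (simp add: conjugate_def m_assoc inv_mult_group)

lemma conjugate_conjugate: "x \<in> carrier G \<Longrightarrow> y \<in> carrier G \<Longrightarrow> a \<in> carrier G \<Longrightarrow>
    conjugate G y (conjugate G x a) = conjugate G (x \<otimes> y) a"
  by (simp add: conjugate_def m_assoc inv_mult_group)

lemma conjugate_cancel [simp]:
  "x \<in> carrier G \<Longrightarrow> a \<in> carrier G \<Longrightarrow> conjugate G (inv x) (conjugate G x a) = a"
  "x \<in> carrier G \<Longrightarrow> a \<in> carrier G \<Longrightarrow> conjugate G x (conjugate G (inv x) a) = a"
  by (simp_all add: conjugate_conjugate)

lemma conjugate_inj_on: "x \<in> carrier G \<Longrightarrow> A \<subseteq> carrier G \<Longrightarrow> inj_on (conjugate G x) A"
  by (rule inj_onI) (metis conjugate_cancel(1) subsetD)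

lemma mult_conjugate: "x \<in> carrier G \<Longrightarrow> a \<in> carrier G \<Longrightarrow> x \<otimes> conjugate G x a = a \<otimes> x"
  by (simp add: conjugate_def m_assoc)

lemma subgroup_conjugate:
  assumes "x \<in> carrier G" "subgroup A G" shows "subgroup (conjugate G x ` A) G"
proof (rule subgroupI)
  show "conjugate G x ` A \<subseteq> carrier G" using assms subgroup.subset
      by (fastforce intro: conjugate_closed)
  show "conjugate G x ` A \<noteq> {}" using assms subgroup.one_closed by fastforce
next
  fix a assume "a \<in> conjugate G x ` A"
  then obtain b where b: "b \<in> A" "a = conjugate G x b" by auto
  have "b \<in> carrier G" using assms b subgroup.mem_carrier by metis
  then show "inv a \<in> conjugate G x ` A"
    using assms b by (metis conjugate_inv imageI subgroup.m_inv_closed)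
next
  fix a b assume "a \<in> conjugate G x ` A" "b \<in> conjugate G x ` A"
  then obtain a' b' where b: "b' \<in> A" "b = conjugate G x b'" "a' \<in> A" "a = conjugate G x a'" by auto
  have "a' \<in> carrier G" "b' \<in> carrier G" using assms b subgroup.mem_carrier by metis+
  then show "a \<otimes> b \<in> conjugate G x ` A"
    using assms b by (metis conjugate_mult imageI subgroup.m_closed)
qed

lemma conjugate_mem_subgroup:
  assumes "subgroup A G" "x \<in> A" "a \<in> A" shows "conjugate G x a \<in> A"
  using assms by (simp add: conjugate_def subgroup.m_closed subgroup.m_inv_closed)

lemma normalizes_self: "subgroup A G \<Longrightarrow> V \<subseteq> A \<Longrightarrow> normalizes G V A"
  unfolding normalizes_def using conjugate_mem_subgroup by blast

lemma normal_iff_normalizes: "N \<lhd> G \<longleftrightarrow> subgroup N G \<and> normalizes G (carrier G) N"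
proof
  assume "N \<lhd> G" then show "subgroup N G \<and> normalizes G (carrier G) N"
    unfolding normalizes_def conjugate_def by (simp add: normal.inv_op_closed1 normal_imp_subgroup)
next
  assume *: "subgroup N G \<and> normalizes G (carrier G) N"
  show "N \<lhd> G"
  proof (rule normal_invI)
    fix x h assume "x \<in> carrier G" "h \<in> N"
    then have "conjugate G (inv x) h \<in> N" using * unfolding normalizes_def by auto
    then show "x \<otimes> h \<otimes> inv x \<in> N" using \<open>x \<in> carrier G\<close> by (simp add: conjugate_def)
  qed (use * in blast)
qed

lemma normal_normalizes: "N \<lhd> G \<Longrightarrow> V \<subseteq> carrier G \<Longrightarrow> normalizes G V N"
  using normal_iff_normalizes normalizes_mono by blast

lemma set_mult_iff: "z \<in> A <#> B \<longleftrightarrow> (\<exists>a\<in>A. \<exists>b\<in>B. z = a \<otimes> b)"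
  unfolding set_mult_def by blast

lemma set_multI: "a \<in> A \<Longrightarrow> b \<in> B \<Longrightarrow> a \<otimes> b \<in> A <#> B"
  unfolding set_mult_def by blast

lemma set_multE:
  assumes "x \<in> A <#> B" obtains a b where "a \<in> A" "b \<in> B" "x = a \<otimes> b"
  using assms unfolding set_mult_def by blast

lemma set_mult_upper:
  assumes "subgroup A G" "subgroup B G" shows "A \<subseteq> A <#> B" "B \<subseteq> A <#> B"
proof -
  show "A \<subseteq> A <#> B"
  proof
    fix a assume "a \<in> A"
    then have "a \<otimes> \<one> \<in> A <#> B" using assms subgroup.one_closed set_multI by metis
    then show "a \<in> A <#> B" using \<open>a \<in> A\<close> assms by (metis r_one subgroup.mem_carrier)
  qed
  show "B \<subseteq> A <#> B"
  proof
    fix a assume "a \<in> B"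
    then have "\<one> \<otimes> a \<in> A <#> B" using assms subgroup.one_closed set_multI by metis
    then show "a \<in> A <#> B" using \<open>a \<in> B\<close> assms by (metis l_one subgroup.mem_carrier)
  qed
qed

lemma set_mult_least:
  assumes "subgroup C G" "A \<subseteq> C" "B \<subseteq> C" shows "A <#> B \<subseteq> C"
  using assms by (auto elim!: set_multE intro: subgroup.m_closed)

lemma set_mult_subgroup:
  assumes "subgroup A G" "subgroup B G" "B <#> A \<subseteq> A <#> B"
  shows "subgroup (A <#> B) G"
proof (rule subgroupI)
  interpret A: subgroup A G by fact
  interpret B: subgroup B G by fact
  show "A <#> B \<subseteq> carrier G" using set_mult_closed A.subset B.subset by blast
  show "A <#> B \<noteq> {}" using set_mult_upper assms A.one_closed by blast
  fix x assume "x \<in> A <#> B"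
  then obtain a b where x: "a \<in> A" "b \<in> B" "x = a \<otimes> b" by (rule set_multE)
  then have "inv x = inv b \<otimes> inv a" by (simp add: inv_mult_group)
  then show "inv x \<in> A <#> B" using x assms(3) set_multI[of "inv b" B "inv a" A] by auto
  fix y assume "y \<in> A <#> B"
  then obtain c d where y: "c \<in> A" "d \<in> B" "y = c \<otimes> d" by (rule set_multE)
  have "b \<otimes> c \<in> A <#> B" using x y assms(3) set_multI by blast
  then obtain c' b' where z: "c' \<in> A" "b' \<in> B" "b \<otimes> c = c' \<otimes> b'" by (rule set_multE)
  have "x \<otimes> y = a \<otimes> (b \<otimes> c) \<otimes> d" using x y by (simp add: m_assoc)
  also have "\<dots> = (a \<otimes> c') \<otimes> (b' \<otimes> d)" using x y z by (simp add: m_assoc)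
  finally show "x \<otimes> y \<in> A <#> B" using x y z by (auto intro: set_multI)
qed

lemma subgroup_set_mult_commute:
  assumes "subgroup A G" "subgroup B G" "subgroup (A <#> B) G"
  shows "A <#> B = B <#> A"
proof
  interpret A: subgroup A G by fact
  interpret B: subgroup B G by fact
  interpret AB: subgroup "A <#> B" G by fact
  show "B <#> A \<subseteq> A <#> B" using set_mult_upper assms set_mult_least by metis
  show "A <#> B \<subseteq> B <#> A"
  proof
    fix x assume x: "x \<in> A <#> B"
    then have "inv x \<in> A <#> B" by simp
    then obtain a b where i: "a \<in> A" "b \<in> B" "inv x = a \<otimes> b" by (rule set_multE)
    then have "x = inv b \<otimes> inv a" using x
        by (metis A.mem_carrier AB.mem_carrier B.mem_carrier inv_inv inv_mult_group)
    then show "x \<in> B <#> A" using i by (auto intro: set_multI)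
  qed
qed

lemma set_mult_commuteI:
  assumes "subgroup A G" "subgroup B G" "B <#> A \<subseteq> A <#> B"
  shows "A <#> B = B <#> A"
  using assms set_mult_subgroup subgroup_set_mult_commute by blast

lemma normalizes_set_mult_commute:
  assumes "subgroup A G" "subgroup V G" "normalizes G V A"
  shows "A <#> V = V <#> A"
proof -
  interpret A: subgroup A G by fact
  interpret B: subgroup V G by fact
  have "A <#> V \<subseteq> V <#> A"
  proof
    fix z assume "z \<in> A <#> V"
    then obtain a x where z: "a \<in> A" "x \<in> V" "z = a \<otimes> x" by (rule set_multE)
    then have "z = x \<otimes> conjugate G x a" by (simp add: mult_conjugate)
    then show "z \<in> V <#> A" using z normalizesD[OF assms(3)] by (auto intro: set_multI)
  qed
  then show ?thesis using set_mult_commuteI[of V A] assms by simp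
qed

lemma normalizes_set_mult_subgroup:
  assumes "subgroup A G" "subgroup V G" "normalizes G V A"
  shows "subgroup (A <#> V) G" "subgroup (V <#> A) G"
  using set_mult_subgroup[of A V] set_mult_subgroup[of V A] normalizes_set_mult_commute[OF assms]
      assms
  by simp_all

lemma set_mult_eq_generate:
  assumes "subgroup A G" "subgroup B G" "A <#> B = B <#> A"
  shows "generate G (A \<union> B) = A <#> B"
proof (rule sym, rule generateI)
  show "subgroup (A <#> B) G" using assms set_mult_subgroup by blast
  show "A \<union> B \<subseteq> A <#> B" using assms set_mult_upper by blast
qed (use set_mult_least in blast)

lemma set_mult_mono_left: "subgroup A G \<Longrightarrow> subgroup B G \<Longrightarrow> A \<subseteq> B \<Longrightarrow> A <#> B = B"
  by (meson set_mult_least set_mult_upper subset_antisym subset_refl)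

text \<open>If \<open>a \<otimes> b\<close> lies in \<open>C\<close> and
  \<open>a \<in> A \<subseteq> C\<close>, then \<open>b\<close> lies in \<open>C\<close>. For
  permutable subgroups this is the modular law of the lattice.\<close>

lemma dedekind:
  assumes "subgroup A G" "subgroup C G" "A \<subseteq> C" "B \<subseteq> carrier G"
  shows "(A <#> B) \<inter> C = A <#> (B \<inter> C)"
proof
  interpret A: subgroup A G by fact
  interpret C: subgroup C G by fact
  show "A <#> (B \<inter> C) \<subseteq> (A <#> B) \<inter> C"
    using assms by (auto elim!: set_multE intro: set_multI)
  show "(A <#> B) \<inter> C \<subseteq> A <#> (B \<inter> C)"
  proof
    fix z assume zz: "z \<in> (A <#> B) \<inter> C"
    then have "z \<in> A <#> B" by blast
    then obtain a b where z: "a \<in> A" "b \<in> B" "z = a \<otimes> b" by (rule set_multE)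
    then have "b = inv a \<otimes> z" using assms by auto
    moreover have "inv a \<in> C" "z \<in> C" using zz z assms by auto
    ultimately have "b \<in> C" using C.m_closed by simp
    then show "z \<in> A <#> (B \<inter> C)" using z by (auto intro: set_multI)
  qed
qed

lemma normalizes_set_mult:
  assumes "subgroup A G" "subgroup B G" "V \<subseteq> carrier G" "normalizes G V A" "normalizes G V B"
  shows "normalizes G V (A <#> B)"
  unfolding normalizes_def
proof (intro ballI)
  interpret A: subgroup A G by fact
  interpret B: subgroup B G by fact
  fix x z assume x: "x \<in> V" "z \<in> A <#> B"
  obtain a b where z: "a \<in> A" "b \<in> B" "z = a \<otimes> b" using x(2) by (rule set_multE)
  then have "conjugate G x z = conjugate G x a \<otimes> conjugate G x b" using x assms
      by (auto intro: conjugate_mult)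
  then show "conjugate G x z \<in> A <#> B" using z x assms normalizesD set_multI by metis
qed

lemma normalizes_generate_right:
  assumes "V \<subseteq> carrier G" "S \<subseteq> carrier G" "\<And>x s. x \<in> V \<Longrightarrow> s \<in> S \<Longrightarrow> conjugate G x s \<in> generate G S"
  shows "normalizes G V (generate G S)"
  unfolding normalizes_def
proof (intro ballI)
  fix x a assume x: "x \<in> V" and a: "a \<in> generate G S"
  have sub: "subgroup (generate G S) G" using assms generate_is_subgroup by blast
  have xc: "x \<in> carrier G" using x assms by blast
  from a show "conjugate G x a \<in> generate G S"
  proof (induction rule: generate.induct)
    case one then show ?case using xc sub by (simp add: subgroup.one_closed)
  next
    case (incl h) then show ?case using x assms by blast
  next
    case (inv h)
    then have "h \<in> carrier G" using assms by blast
    then show ?case using conjugate_inv[OF xc] inv x assms sub by (simp add: subgroup.m_inv_closed)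
  next
    case (eng h1 h2)
    then have "h1 \<in> carrier G" "h2 \<in> carrier G" using assms generate_in_carrier by auto
    then show ?case using conjugate_mult[OF xc] eng sub by (simp add: subgroup.m_closed)
  qed
qed

lemma generate_Un_upper: "A \<subseteq> generate G (A \<union> B)" "B \<subseteq> generate G (A \<union> B)"
  by (auto intro: generate.incl)

lemma generate_Un_least: "subgroup C G \<Longrightarrow> A \<subseteq> C \<Longrightarrow> B \<subseteq> C \<Longrightarrow> generate G (A \<union> B) \<subseteq> C"
  by (rule generate_subgroup_incl) auto

lemma generate_Un_subgroup: "subgroup A G \<Longrightarrow> subgroup B G \<Longrightarrow> subgroup (generate G (A \<union> B)) G"
  by (rule generate_is_subgroup) (auto dest: subgroup.subset)

lemma subgroup_Int: "subgroup A G \<Longrightarrow> subgroup B G \<Longrightarrow> subgroup (A \<inter> B) G"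
  by (rule subgroups_Inter_pair)

end

section \<open>Indices in finite groups\<close>

locale fin_group = group +
  assumes fin: "finite (carrier G)"
begin

lemma finite_subgroup: "subgroup A G \<Longrightarrow> finite A"
  using fin finite_subset subgroup.subset by metis

lemma card_subgroup_pos: "subgroup A G \<Longrightarrow> 0 < card A"
  using finite_subgroup subgroup.one_closed card_gt_0_iff by fast

lemma card_subgroup_dvd:
  assumes "subgroup A G" "subgroup B G" "A \<subseteq> B" shows "card A dvd card B"
proof -
  interpret B: group "G\<lparr>carrier := B\<rparr>" using assms subgroup_imp_group by blast
  have "subgroup A (G\<lparr>carrier := B\<rparr>)" using assms subgroup_incl by blast
  then have "card (rcosets\<^bsub>G\<lparr>carrier := B\<rparr>\<^esub> A) * card A = order (G\<lparr>carrier := B\<rparr>)"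
    by (rule B.lagrange)
  then have "card (rcosets\<^bsub>G\<lparr>carrier := B\<rparr>\<^esub> A) * card A = card B" by (simp add: order_def)
  then show ?thesis by (metis dvd_triv_right)
qed

text \<open>Counted by the fibres of multiplication on pairs: the pairs with product
  \<open>a \<otimes> b\<close> are \<open>(a \<otimes> c, inv c \<otimes> b)\<close> for
  \<open>c \<in> A \<inter> B\<close>.\<close>

lemma card_set_mult:
  assumes "subgroup A G" "subgroup B G"
  shows "card (A <#> B) * card (A \<inter> B) = card A * card B"
proof -
  interpret A: subgroup A G by fact
  interpret B: subgroup B G by fact
  have fA: "finite A" "finite B" using assms finite_subgroup by auto
  define f where "f = (\<lambda>(a, b). a \<otimes> b)"
  have im: "A <#> B = f ` (A \<times> B)" by (rule Set.set_eqI) (simp add: set_mult_iff f_def image_iff)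
  have "card {p \<in> A \<times> B. f p = z} = card (A \<inter> B)" if "z \<in> A <#> B" for z
  proof -
    obtain a b where z: "a \<in> A" "b \<in> B" "z = a \<otimes> b" using \<open>z \<in> A <#> B\<close> by (rule set_multE)
    have "bij_betw (\<lambda>c. (a \<otimes> c, inv c \<otimes> b)) (A \<inter> B) {p \<in> A \<times> B. f p = z}"
      unfolding bij_betw_def
    proof
      show "inj_on (\<lambda>c. (a \<otimes> c, inv c \<otimes> b)) (A \<inter> B)"
        using z by (auto intro!: inj_onI)
      show "(\<lambda>c. (a \<otimes> c, inv c \<otimes> b)) ` (A \<inter> B) = {p \<in> A \<times> B. f p = z}"
      proof
        show "(\<lambda>c. (a \<otimes> c, inv c \<otimes> b)) ` (A \<inter> B) \<subseteq> {p \<in> A \<times> B. f p = z}"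
          using z by (auto simp: f_def m_assoc)
        show "{p \<in> A \<times> B. f p = z} \<subseteq> (\<lambda>c. (a \<otimes> c, inv c \<otimes> b)) ` (A \<inter> B)"
        proof
          fix q assume q: "q \<in> {p \<in> A \<times> B. f p = z}"
          obtain c d where qq: "q = (c, d)" by (cases q)
          then have cd: "c \<in> A" "d \<in> B" "f (c, d) = z" using q by auto
          define e where "e = inv a \<otimes> c"
          have eq: "c \<otimes> d = a \<otimes> b" using cd z by (simp add: f_def)
          have e2: "e = b \<otimes> inv d"
          proof -
            have "e \<otimes> d = b" unfolding e_def using eq cd z by (simp add: m_assoc)
            moreover have "e \<in> carrier G" using e_def cd z by simp
            ultimately show ?thesis using cd z by (metis B.mem_carrier inv_solve_right)
          qed
          have "e \<in> A" unfolding e_def using cd z by simp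
          moreover have "e \<in> B" unfolding e2 using cd z by simp
          ultimately have "e \<in> A \<inter> B" by simp
          moreover have "c = a \<otimes> e" using e_def cd z by simp
          moreover have "d = inv e \<otimes> b" using e2 cd z by (simp add: inv_mult_group m_assoc)
          ultimately show "q \<in> (\<lambda>c. (a \<otimes> c, inv c \<otimes> b)) ` (A \<inter> B)" using qq by blast
        qed
      qed
    qed
    then show ?thesis by (rule bij_betw_same_card[symmetric])
  qed
  moreover have "card (A \<times> B) = (\<Sum>z\<in>f ` (A \<times> B). card {p \<in> A \<times> B. f p = z})"
    using fA sum.image_gen[of "A \<times> B" "\<lambda>_. 1::nat" f] by simp
  ultimately show ?thesis using im by (simp add: card_cartesian_product)
qed

text \<open>The product formula read as \<open>|A : A \<inter> B| = |AB : B|\<close>. Most index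
  comparisons below are instances of it.\<close>

lemma pi_index_set_mult_iff:
  assumes "subgroup A G" "subgroup B G"
  shows "pi_index \<pi> (A \<inter> B) A \<longleftrightarrow> pi_index \<pi> B (A <#> B)"
proof -
  have "subgroup (A \<inter> B) G" using assms subgroup_Int by blast
  then have pos: "card (A \<inter> B) > 0" "card B > 0" using card_subgroup_pos assms by auto
  have "card A = n * card (A \<inter> B) \<longleftrightarrow> card (A <#> B) = n * card B" for n
  proof -
    have "card A = n * card (A \<inter> B) \<longleftrightarrow> card A * card B = n * card (A \<inter> B) * card B" using pos by simp
    also have "\<dots> \<longleftrightarrow> card (A <#> B) * card (A \<inter> B) = (n * card B) * card (A \<inter> B)"
      using card_set_mult[OF assms] by (simp add: ac_simps)
    finally show ?thesis using pos by simp
  qed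
  then show ?thesis unfolding pi_index_def by blast
qed

lemma pi_index_split:
  assumes "subgroup A G" "subgroup B G" "subgroup C G" "A \<subseteq> B" "B \<subseteq> C" "pi_index \<pi> A C"
  shows "pi_index \<pi> A B" "pi_index \<pi> B C"
proof -
  obtain n where n: "card C = n * card A" "pi_number \<pi> n" using assms(6) pi_index_def by metis
  obtain k where k: "card B = k * card A" using card_subgroup_dvd[OF assms(1,2,4)]
      by (metis dvdE mult.commute)
  obtain m where m: "card C = m * card B" using card_subgroup_dvd[OF assms(2,3,5)]
      by (metis dvdE mult.commute)
  have "n = m * k" using n k m card_subgroup_pos[OF assms(1)]
      by (metis mult.assoc mult_right_cancel neq0_conv)
  then have "pi_number \<pi> m" "pi_number \<pi> k" using n pi_number_mult by auto
  then show "pi_index \<pi> A B" "pi_index \<pi> B C" unfolding pi_index_def using k m by blast+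
qed

lemma pi_index_eq:
  assumes "subgroup A G" "subgroup B G" "A \<subseteq> B" "pi_index \<pi> A B" "pi_index \<rho> A B" "\<pi> \<inter> \<rho> = {}"
  shows "A = B"
proof -
  obtain n where n: "card B = n * card A" "pi_number \<pi> n" using assms pi_index_def by metis
  obtain k where k: "card B = k * card A" "pi_number \<rho> k" using assms pi_index_def by metis
  have "n = k" using n k card_subgroup_pos[OF assms(1)] by simp
  then have "card B = card A" using n k pi_number_disjoint assms by fastforce
  then show ?thesis using assms card_subset_eq finite_subgroup by metis
qed

lemma pi_index_card:
  assumes "subgroup A G" "subgroup B G" "A \<subseteq> B" "pi_number \<pi> (card B)"
  shows "pi_index \<pi> A B"
  unfolding pi_index_def using card_subgroup_dvd[OF assms(1-3)] assms(4)
  by (metis dvdE mult.commute pi_number_mult)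

lemma pi_number_card_sub:
  assumes "subgroup A G" "subgroup B G" "A \<subseteq> B" "pi_number \<pi> (card B)"
  shows "pi_number \<pi> (card A)"
  using card_subgroup_dvd[OF assms(1-3)] assms(4) pi_number_dvd by blast

text \<open>Since \<open>A\<close> and \<open>B\<close> permute, \<open>A <#> B\<close> is a
  subgroup between \<open>B\<close> and \<open>V\<close>, and
  \<open>|A : A \<inter> B| = |AB : B|\<close> divides \<open>|V : B|\<close>.\<close>

lemma pi_index_inter:
  assumes "subgroup A G" "subgroup B G" "subgroup V G" "A \<subseteq> V" "B \<subseteq> V"
    and "A <#> B = B <#> A" "pi_index \<pi> B V"
  shows "pi_index \<pi> (A \<inter> B) A"
proof -
  have "subgroup (A <#> B) G" using assms set_mult_subgroup by blast
  moreover have "A <#> B \<subseteq> V" using assms set_mult_least by blast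
  ultimately have "pi_index \<pi> B (A <#> B)" using pi_index_split(1) assms set_mult_upper by metis
  then show ?thesis using pi_index_set_mult_iff assms by blast
qed

text \<open>The index of \<open>Z \<inter> N\<close> in \<open>Z\<close> is a number for
  \<open>\<pi>\<close> by \<open>pi_index_inter\<close> and for \<open>\<rho>\<close> by Lagrange,
  hence 1. In this way Hall subgroups are found inside subgroups of suitable index.\<close>

lemma pi_subgroup_le:
  assumes "subgroup N G" "subgroup Z G" "subgroup V G" "N \<subseteq> V" "Z \<subseteq> V"
    and "Z <#> N = N <#> Z" "pi_index \<pi> N V" "pi_number \<rho> (card Z)" "\<pi> \<inter> \<rho> = {}"
  shows "Z \<subseteq> N"
proof -
  have s: "subgroup (Z \<inter> N) G" using assms subgroup_Int by blast
  have "pi_index \<pi> (Z \<inter> N) Z" using pi_index_inter assms by blast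
  moreover have "pi_index \<rho> (Z \<inter> N) Z" using pi_index_card s assms by auto
  ultimately have "Z \<inter> N = Z" using pi_index_eq[of "Z \<inter> N" Z \<pi> \<rho>] s assms by auto
  then show ?thesis by blast
qed

text \<open>Write \<open>n = |T : A|\<close>, \<open>k = |T : B|\<close> and
  \<open>a = |A : A \<inter> B|\<close>, \<open>b = |B : A \<inter> B|\<close>. Then
  \<open>n * a = k * b\<close>, so \<open>k\<close> divides \<open>a\<close> by coprimality, and
  \<open>A <#> B\<close>, which has \<open>a * card B\<close> elements, is as large as
  \<open>T\<close>.\<close>

lemma coprime_index_set_mult:
  assumes "subgroup A G" "subgroup B G" "subgroup T G" "A \<subseteq> T" "B \<subseteq> T"
    and "pi_index \<pi> A T" "pi_index \<rho> B T" "\<pi> \<inter> \<rho> = {}"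
  shows "A <#> B = T" "B <#> A = T"
proof -
  have s: "subgroup (A \<inter> B) G" using assms subgroup_Int by blast
  obtain n where n: "card T = n * card A" "pi_number \<pi> n" using assms pi_index_def by metis
  obtain k where k: "card T = k * card B" "pi_number \<rho> k" using assms pi_index_def by metis
  have cop: "coprime n k"
  proof (rule ccontr)
    assume "\<not> coprime n k"
    then obtain p where "Factorial_Ring.prime p" "p dvd n" "p dvd k"
      by (metis coprime_iff_gcd_eq_1 gcd_nat.boundedE prime_factor_nat)
    then show False using n k assms(8) unfolding pi_number_def by blast
  qed
  obtain a where a: "card A = a * card (A \<inter> B)" using card_subgroup_dvd[OF s assms(1)]
      by (metis Int_lower1 dvdE mult.commute)
  obtain b where b: "card B = b * card (A \<inter> B)" using card_subgroup_dvd[OF s assms(2)]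
      by (metis Int_lower2 dvdE mult.commute)
  have pos: "card (A \<inter> B) > 0" "card T > 0" using s card_subgroup_pos assms by auto
  have "n * card A = k * card B" using n k by simp
  then have "(n * a) * card (A \<inter> B) = (k * b) * card (A \<inter> B)"
    by (subst (asm) a, subst (asm) b) (simp add: ac_simps)
  then have "n * a = k * b" using pos by simp
  then have "k dvd a" using cop by (metis coprime_commute coprime_dvd_mult_right_iff dvd_triv_left)
  moreover have "a > 0" using a card_subgroup_pos[OF assms(1)] by (cases a) auto
  ultimately have "k \<le> a" by (simp add: dvd_imp_le)
  have "card T = k * card B" using k by simp
  also have "\<dots> \<le> a * card B" using \<open>k \<le> a\<close> by simp
  also have "a * card B = card (A <#> B)"
  proof -
    have "card (A <#> B) * card (A \<inter> B) = (a * card B) * card (A \<inter> B)"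
      using card_set_mult[OF assms(1,2)] by (subst (asm) a) (simp add: ac_simps)
    then show ?thesis using pos by simp
  qed
  finally have le: "card T \<le> card (A <#> B)" .
  have sub: "A <#> B \<subseteq> T" using assms set_mult_least by blast
  then show eq: "A <#> B = T" using le finite_subgroup[OF assms(3)] by (metis card_seteq)
  then show "B <#> A = T" using subgroup_set_mult_commute[OF assms(1,2)] assms(3) by simp
qed

lemma normalizes_generate_left:
  assumes "V \<subseteq> carrier G" "A \<subseteq> carrier G" "normalizes G V A"
  shows "normalizes G (generate G V) A"
  unfolding normalizes_def
proof (rule ballI)
  fix x assume "x \<in> generate G V"
  then show "\<forall>a\<in>A. conjugate G x a \<in> A"
  proof (induction rule: generate.induct)
    case one then show ?case using assms by auto
  next
    case (incl h) then show ?case using assms normalizesD by metis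
  next
    \<comment> \<open>Conjugation by \<open>h\<close> is injective and maps \<open>A\<close> into
      itself. By finiteness it is onto \<open>A\<close>, so conjugation by \<open>inv h\<close>
      preserves \<open>A\<close> too.\<close>
    case (inv h)
    have hc: "h \<in> carrier G" using inv assms by blast
    have "conjugate G h ` A \<subseteq> A" using inv assms normalizesD by fastforce
    then have im: "conjugate G h ` A = A"
      using conjugate_inj_on[OF hc assms(2)] fin assms(2) by (meson endo_inj_surj finite_subset)
    show ?case
    proof
      fix a assume "a \<in> A"
      then obtain b where b: "b \<in> A" "a = conjugate G h b" using im by blast
      then have "conjugate G (inv h) a = b" using hc assms(2) conjugate_conjugate[of h "inv h" b]
          by auto
      then show "conjugate G (inv h) a \<in> A" using b by simp
    qed
  next
    case (eng h1 h2)
    then have "h1 \<in> carrier G" "h2 \<in> carrier G" using assms generate_in_carrier by auto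
    then show ?case using eng assms(2) by (metis conjugate_conjugate subsetD)
  qed
qed

lemma card_conjugate: "x \<in> carrier G \<Longrightarrow> A \<subseteq> carrier G \<Longrightarrow> card (conjugate G x ` A) = card A"
  by (simp add: card_image conjugate_inj_on)

end

section \<open>Permutable subgroups of a sigma-full group\<close>

context fin_group
begin

lemma hall_subgroup_iff:
  "hall_subgroup G \<pi> H \<longleftrightarrow>
     subgroup H G \<and> pi_number \<pi> (card H) \<and> pi_index (- \<pi>) H (carrier G)"
proof (cases "subgroup H G")
  case True
  then have "card (carrier G) = card (rcosets H) * card H" using lagrange by (simp add: order_def)
  then have "n = card (rcosets H)" if "card (carrier G) = n * card H" for n
    using that card_subgroup_pos[OF True] by simp
  then show ?thesis
    unfolding hall_subgroup_def pi_index_def using \<open>card (carrier G) = _\<close> by metis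
qed (simp add: hall_subgroup_def)

lemma hallD:
  assumes "hall_subgroup G \<pi> H"
  shows "subgroup H G" "pi_number \<pi> (card H)" "pi_index (- \<pi>) H (carrier G)"
  using assms hall_subgroup_iff by auto

lemma hall_index:
  assumes "hall_subgroup G \<pi> H" "subgroup V G" "H \<subseteq> V"
  shows "pi_index (- \<pi>) H V"
  using pi_index_split(1)[OF hallD(1)[OF assms(1)] assms(2) subgroup_self assms(3)]
    hallD[OF assms(1)] subgroup.subset[OF assms(2)] by blast

lemma hall_maximal:
  assumes "hall_subgroup G \<pi> H" "subgroup V G" "H \<subseteq> V" "pi_number \<pi> (card V)"
  shows "V = H"
  using pi_index_eq[OF hallD(1)[OF assms(1)] assms(2,3) hall_index[OF assms(1-3)]]
    pi_index_card[OF hallD(1)[OF assms(1)] assms(2-4)] by blast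

lemma hall_conjugate:
  assumes "hall_subgroup G \<pi> H" "x \<in> carrier G"
  shows "hall_subgroup G \<pi> (conjugate G x ` H)"
proof -
  have "card (conjugate G x ` H) = card H"
    using card_conjugate[OF assms(2)] subgroup.subset hallD(1)[OF assms(1)] by metis
  then show ?thesis
    using assms subgroup_conjugate unfolding hall_subgroup_iff pi_index_def by metis
qed

lemma hall_le_normal:
  assumes "N \<lhd> G" "pi_index \<pi> N (carrier G)" "hall_subgroup G \<rho> K" "\<pi> \<inter> \<rho> = {}"
  shows "K \<subseteq> N"
proof (rule pi_subgroup_le)
  have "subgroup N G" "normalizes G (carrier G) N" using assms(1) normal_iff_normalizes by auto
  then show "K <#> N = N <#> K"
    using normalizes_set_mult_commute[of N K] hallD(1)[OF assms(3)] normalizes_mono subgroup.subset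
        by metis
qed (use assms hallD normal_imp_subgroup subgroup_self subgroup.subset in blast)+

text \<open>If no prime of \<open>\<sigma> i\<close> divides the order, the trivial subgroup is a
  Hall \<open>\<sigma> i\<close>-subgroup. So sigma-fullness amounts to existence for every
  \<open>i \<in> I\<close>, and complete Hall sets can be forgotten.\<close>

lemma sigma_full_iff:
  assumes "prime_partition I \<sigma>"
  shows "sigma_full I \<sigma> G \<longleftrightarrow> (\<forall>i\<in>I. \<exists>H. hall_subgroup G (\<sigma> i) H)"
proof
  assume "sigma_full I \<sigma> G"
  then obtain \<H> where H: "complete_hall_set I \<sigma> G \<H>" unfolding sigma_full_def by blast
  show "\<forall>i\<in>I. \<exists>H. hall_subgroup G (\<sigma> i) H"
  proof
    fix i assume i: "i \<in> I"
    show "\<exists>H. hall_subgroup G (\<sigma> i) H"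
    proof (cases "\<sigma> i \<inter> group_primes G = {}")
      case True
      then have "pi_number (- \<sigma> i) (order G)"
        unfolding pi_number_def group_primes_def by blast
      then have "hall_subgroup G (\<sigma> i) {\<one>}"
        unfolding hall_subgroup_iff pi_index_def using triv_subgroup by (auto simp: order_def)
      then show ?thesis by blast
    next
      case False
      have "\<exists>!H. H \<in> \<H> \<and> hall_subgroup G (\<sigma> i) H"
        using H i False unfolding complete_hall_set_def by simp
      then show ?thesis by blast
    qed
  qed
next
  assume "\<forall>i\<in>I. \<exists>H. hall_subgroup G (\<sigma> i) H"
  then obtain f where f: "\<And>i. i \<in> I \<Longrightarrow> hall_subgroup G (\<sigma> i) (f i)" by metis
  define \<H> where "\<H> = f ` {i \<in> I. \<sigma> i \<inter> group_primes G \<noteq> {}}"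
  have "complete_hall_set I \<sigma> G \<H>"
    unfolding complete_hall_set_def
  proof (intro conjI ballI impI)
    fix H assume "H \<in> \<H>" then show "subgroup H G" "\<exists>i\<in>I. hall_subgroup G (\<sigma> i) H"
      using f hallD(1) \<H>_def by blast+
  next
    fix i assume i: "i \<in> I" "\<sigma> i \<inter> group_primes G \<noteq> {}"
    show "\<exists>!H. H \<in> \<H> \<and> hall_subgroup G (\<sigma> i) H"
    proof
      show "f i \<in> \<H> \<and> hall_subgroup G (\<sigma> i) (f i)" using f i \<H>_def by blast
      fix H assume H: "H \<in> \<H> \<and> hall_subgroup G (\<sigma> i) H"
      then obtain j where j: "j \<in> I" "H = f j" using \<H>_def by blast
      \<comment> \<open>A Hall subgroup for two different classes has order 1; its index is then the
        order of \<open>G\<close>, which is divisible by a prime of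
        \<open>\<sigma> i\<close>.\<close>
      have "i = j"
      proof (rule ccontr)
        assume "i \<noteq> j"
        then have dis: "\<sigma> i \<inter> \<sigma> j = {}"
          using assms i j unfolding prime_partition_def disjoint_family_on_def by blast
        have "card H = 1"
          using pi_number_disjoint[OF _ _ dis] H j f hallD(2) by blast
        moreover obtain p where p: "p \<in> \<sigma> i" "Factorial_Ring.prime p" "p dvd order G"
          using i unfolding group_primes_def by blast
        ultimately have "p dvd card (rcosets H)"
          using lagrange[of H] H hallD(1) by (metis nat_mult_1_right)
        then show False using H p unfolding hall_subgroup_def pi_number_def by blast
      qed
      then show "H = f i" using j by simp
    qed
  qed
  then show "sigma_full I \<sigma> G" unfolding sigma_full_def by blast
qed

lemma normalizes_set_mult_left:
  assumes "subgroup A G" "subgroup B G" "N \<subseteq> carrier G" "normalizes G A N" "normalizes G B N"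
  shows "normalizes G (A <#> B) N"
  unfolding normalizes_def
proof (intro ballI)
  fix z n assume z: "z \<in> A <#> B" "n \<in> N"
  obtain a b where ab: "a \<in> A" "b \<in> B" "z = a \<otimes> b" using z(1) by (rule set_multE)
  have c: "a \<in> carrier G" "b \<in> carrier G" "n \<in> carrier G"
    using ab z assms subgroup.subset by blast+
  have "conjugate G b (conjugate G a n) \<in> N" using normalizesD assms z ab by metis
  then show "conjugate G z n \<in> N" using conjugate_conjugate c ab by simp
qed

end

section \<open>Permutability with all Hall subgroups\<close>

locale sigma_group = fin_group +
  fixes I :: "'i set" and \<sigma> :: "'i \<Rightarrow> nat set"
  assumes partition: "prime_partition I \<sigma>"
    and hall_ex: "\<And>i. i \<in> I \<Longrightarrow> \<exists>H. hall_subgroup G (\<sigma> i) H"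
begin

definition permutable :: "'a set \<Rightarrow> bool" where
  "permutable A \<longleftrightarrow> subgroup A G \<and> (\<forall>i\<in>I. \<forall>H. hall_subgroup G (\<sigma> i) H \<longrightarrow> A <#> H = H <#> A)"

lemma sigma_permutable_iff: "sigma_permutable I \<sigma> G A \<longleftrightarrow> permutable A"
  unfolding sigma_permutable_def permutable_def using sigma_full_iff[OF partition] hall_ex by blast

lemma permutableD: "permutable A \<Longrightarrow> subgroup A G"
  "permutable A \<Longrightarrow> i \<in> I \<Longrightarrow> hall_subgroup G (\<sigma> i) H \<Longrightarrow> A <#> H = H <#> A"
  unfolding permutable_def by auto

lemma sigma_disjoint: "i \<in> I \<Longrightarrow> j \<in> I \<Longrightarrow> i \<noteq> j \<Longrightarrow> \<sigma> i \<inter> \<sigma> j = {}"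
  using partition unfolding prime_partition_def disjoint_family_on_def by blast

lemma prime_in_sigma: "Factorial_Ring.prime p \<Longrightarrow> \<exists>i\<in>I. p \<in> \<sigma> i"
  using partition unfolding prime_partition_def by blast

text \<open>The classes cover all primes: a prime divisor of the index lies in some
  \<open>\<sigma> j\<close>, and the last hypothesis excludes \<open>j \<noteq> i\<close>. Indices
  are thus treated one class at a time.\<close>

lemma pi_index_sigma:
  assumes "subgroup A G" "subgroup B G" "A \<subseteq> B" "i \<in> I"
    and "\<And>j. j \<in> I \<Longrightarrow> j \<noteq> i \<Longrightarrow> pi_index (- \<sigma> j) A B"
  shows "pi_index (\<sigma> i) A B"
proof -
  obtain n where n: "card B = n * card A"
    using card_subgroup_dvd[OF assms(1-3)] by (metis dvdE mult.commute)
  have "pi_number (\<sigma> i) n"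
    unfolding pi_number_def
  proof (intro allI impI)
    fix p assume p: "Factorial_Ring.prime p \<and> p dvd n"
    then obtain j where j: "j \<in> I" "p \<in> \<sigma> j" using prime_in_sigma by blast
    have "j = i"
    proof (rule ccontr)
      assume "j \<noteq> i"
      then obtain m where m: "card B = m * card A" "pi_number (- \<sigma> j) m"
        using assms(5) j unfolding pi_index_def by blast
      then have "m = n" using n card_subgroup_pos[OF assms(1)] by simp
      then show False using m p j unfolding pi_number_def by blast
    qed
    then show "p \<in> \<sigma> i" using j by simp
  qed
  then show ?thesis using n unfolding pi_index_def by blast
qed

lemma pi_index_sigma_eq:
  assumes "subgroup A G" "subgroup B G" "A \<subseteq> B"
    and "\<And>j. j \<in> I \<Longrightarrow> pi_index (- \<sigma> j) A B"
  shows "A = B"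
proof -
  obtain i where i: "i \<in> I" using prime_in_sigma[OF two_is_prime_nat] by blast
  have "pi_index (\<sigma> i) A B" using pi_index_sigma[OF assms(1-3) i] assms(4) by blast
  then show ?thesis using pi_index_eq[OF assms(1-3) _ assms(4)[OF i]] by blast
qed

text \<open>\<open>|A : A \<inter> H| = |AH : H|\<close> divides \<open>|G : H|\<close>. So
  \<open>A \<inter> H\<close> is a Hall \<open>\<sigma> i\<close>-subgroup of
  \<open>A\<close>.\<close>

lemma permutable_inter_hall:
  assumes "permutable A" "i \<in> I" "hall_subgroup G (\<sigma> i) H"
  shows "pi_index (- \<sigma> i) (A \<inter> H) A"
  using pi_index_inter[OF permutableD(1)[OF assms(1)] hallD(1)[OF assms(3)] subgroup_self _ _
      permutableD(2)[OF assms] hallD(3)[OF assms(3)]]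
    subgroup.subset[OF permutableD(1)[OF assms(1)]] subgroup.subset[OF hallD(1)[OF assms(3)]]
        by blast

lemma permutable_hall_mult:
  assumes "permutable A" "i \<in> I" "hall_subgroup G (\<sigma> i) H"
  shows "subgroup (A <#> H) G" "pi_index (\<sigma> i) A (A <#> H)"
proof -
  have sub: "subgroup A G" "subgroup H G" using permutableD(1) assms hallD(1) by auto
  show "subgroup (A <#> H) G" using set_mult_subgroup[OF sub] permutableD(2)[OF assms] by simp
  have "pi_index (\<sigma> i) (H \<inter> A) H"
    using pi_index_card[OF subgroup_Int sub(2)] sub hallD(2)[OF assms(3)] by blast
  then show "pi_index (\<sigma> i) A (A <#> H)"
    using pi_index_set_mult_iff[OF sub(2,1)] permutableD(2)[OF assms] by simp
qed

lemma hall_inter_permutable_mult: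
  assumes "permutable A" "i \<in> I" "j \<in> I" "i \<noteq> j"
    and "hall_subgroup G (\<sigma> i) H" "hall_subgroup G (\<sigma> j) K"
  shows "K \<inter> (A <#> H) \<subseteq> A"
proof -
  let ?Z = "(A <#> K) \<inter> (A <#> H)"
  have sub: "subgroup A G" "subgroup H G" "subgroup K G" using permutableD(1) assms hallD(1) by auto
  note H = permutable_hall_mult[OF assms(1,2,5)] and K = permutable_hall_mult[OF assms(1,3,6)]
  have Z: "subgroup ?Z G" "A \<subseteq> ?Z" using subgroup_Int H(1) K(1) set_mult_upper sub by auto
  have "A = ?Z"
  proof (rule pi_index_eq[OF sub(1) Z])
    show "pi_index (\<sigma> i) A ?Z" using pi_index_split(1)[OF sub(1) Z(1) H(1) Z(2) _ H(2)] by blast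
    show "pi_index (\<sigma> j) A ?Z" using pi_index_split(1)[OF sub(1) Z(1) K(1) Z(2) _ K(2)] by blast
  qed (use sigma_disjoint assms in blast)
  moreover have "K \<inter> (A <#> H) \<subseteq> ?Z" using set_mult_upper(2)[OF sub(1,3)] by blast
  ultimately show ?thesis by blast
qed

text \<open>Since \<open>x\<^sup>h\<close> lies in \<open>AH\<close> and in the Hall subgroup \<open>K\<^sup>h\<close>, it already lies in \<open>A\<close>.\<close>

lemma conjugate_hall_permutable:
  assumes "permutable A" "i \<in> I" "j \<in> I" "i \<noteq> j"
    and "hall_subgroup G (\<sigma> i) H" "hall_subgroup G (\<sigma> j) K"
    and "h \<in> H" "x \<in> K" "x \<in> A"
  shows "conjugate G h x \<in> conjugate G h ` K \<inter> A"
proof -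
  have sub: "subgroup A G" "subgroup H G" using permutableD(1) assms hallD(1) by auto
  then have "h \<in> A <#> H" "x \<in> A <#> H" using set_mult_upper assms by blast+
  then have "conjugate G h x \<in> A <#> H" using conjugate_mem_subgroup permutable_hall_mult(1) assms
      by metis
  moreover have "h \<in> carrier G" using assms sub subgroup.subset by blast
  then have "hall_subgroup G (\<sigma> j) (conjugate G h ` K)" using hall_conjugate assms by blast
  ultimately show ?thesis using hall_inter_permutable_mult[OF assms(1-5)] assms(8) by blast
qed

section \<open>Joins of the Hall parts of a subgroup\<close>

definition hall_parts :: "'i \<Rightarrow> 'a set \<Rightarrow> 'a set" where
  "hall_parts j A = (\<Union>K\<in>{K. hall_subgroup G (\<sigma> j) K}. K \<inter> A)"

text \<open>All Hall \<open>\<sigma> j\<close>-subgroups contribute, so that conjugation carries one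
  intersection to another. The price is that the join need not be a \<open>\<sigma> j\<close>-group;
  for permutable \<open>A\<close> it still has index prime to \<open>\<sigma> j\<close> in
  \<open>A\<close>.\<close>

definition hall_join :: "'i \<Rightarrow> 'a set \<Rightarrow> 'a set" where
  "hall_join j A = generate G (hall_parts j A)"

lemma hall_parts_subset: "hall_parts j A \<subseteq> A" "hall_parts j A \<subseteq> carrier G"
  unfolding hall_parts_def using hallD(1) subgroup.subset by blast+

lemma hall_join_subgroup: "subgroup (hall_join j A) G"
  unfolding hall_join_def using generate_is_subgroup hall_parts_subset by blast

lemma hall_join_subset: "subgroup A G \<Longrightarrow> hall_join j A \<subseteq> A"
  unfolding hall_join_def using generate_subgroup_incl hall_parts_subset by blast

lemma hall_join_hall: "hall_subgroup G (\<sigma> j) K \<Longrightarrow> K \<inter> A \<subseteq> hall_join j A"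
  unfolding hall_join_def hall_parts_def by (blast intro: generate.incl)

lemma hall_join_normalizes_self:
  assumes "subgroup A G" shows "normalizes G A (hall_join j A)"
  unfolding hall_join_def
proof (rule normalizes_generate_right)
  fix x s assume x: "x \<in> A" and "s \<in> hall_parts j A"
  then obtain K where K: "hall_subgroup G (\<sigma> j) K" "s \<in> K" "s \<in> A" unfolding hall_parts_def by blast
  have "x \<in> carrier G" using x assms subgroup.subset by blast
  then have "hall_subgroup G (\<sigma> j) (conjugate G x ` K)" "conjugate G x s \<in> conjugate G x ` K"
    using hall_conjugate K by auto
  moreover have "conjugate G x s \<in> A" using conjugate_mem_subgroup assms x K by blast
  ultimately show "conjugate G x s \<in> generate G (hall_parts j A)"
    unfolding hall_parts_def by (blast intro: generate.incl)
qed (use subgroup.subset[OF assms] hall_parts_subset in auto)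

lemma hall_join_normalizes_hall:
  assumes "permutable A" "i \<in> I" "j \<in> I" "i \<noteq> j" "hall_subgroup G (\<sigma> i) H"
  shows "normalizes G H (hall_join j A)"
  unfolding hall_join_def
proof (rule normalizes_generate_right)
  fix h s assume h: "h \<in> H" and "s \<in> hall_parts j A"
  then obtain K where K: "hall_subgroup G (\<sigma> j) K" "s \<in> K" "s \<in> A" unfolding hall_parts_def by blast
  have "h \<in> carrier G" using h assms hallD(1) subgroup.subset by blast
  then have "hall_subgroup G (\<sigma> j) (conjugate G h ` K)" using hall_conjugate K by auto
  then show "conjugate G h s \<in> generate G (hall_parts j A)"
    using conjugate_hall_permutable[OF assms(1-5) K(1) h K(2,3)] unfolding hall_parts_def
        by (blast intro: generate.incl)
qed (use hall_parts_subset subgroup.subset[OF hallD(1)[OF assms(5)]] in auto)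

lemma hall_join_index:
  assumes "permutable A" "j \<in> I" shows "pi_index (- \<sigma> j) (hall_join j A) A"
proof -
  obtain K where K: "hall_subgroup G (\<sigma> j) K" using hall_ex assms by blast
  have s: "subgroup A G" "subgroup (A \<inter> K) G" using permutableD(1) hallD(1)[OF K] assms subgroup_Int
      by auto
  show ?thesis
    using pi_index_split(2)[OF s(2) hall_join_subgroup s(1) _ hall_join_subset[OF s(1)]
        permutable_inter_hall[OF assms K]]
      hall_join_hall[OF K] by blast
qed

text \<open>Each \<open>hall_join j A\<close> has index prime to \<open>\<sigma> j\<close> in
  \<open>A\<close>, so no prime divides the index of the subgroup generated by all of them.\<close>

lemma generate_hall_join:
  assumes "permutable A" shows "generate G (\<Union>j\<in>I. hall_join j A) = A"
proof -
  have s: "subgroup A G" using permutableD(1) assms .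
  have c: "(\<Union>j\<in>I. hall_join j A) \<subseteq> carrier G" using hall_join_subset[OF s] subgroup.subset[OF s]
      by blast
  have sg: "subgroup (generate G (\<Union>j\<in>I. hall_join j A)) G" using generate_is_subgroup[OF c] .
  have le: "generate G (\<Union>j\<in>I. hall_join j A) \<subseteq> A"
    by (rule generate_subgroup_incl[OF _ s]) (use hall_join_subset[OF s] in auto)
  show ?thesis
  proof (rule pi_index_sigma_eq[OF sg s le])
    fix j assume j: "j \<in> I"
    then have "hall_join j A \<subseteq> generate G (\<Union>j\<in>I. hall_join j A)" by (blast intro: generate.incl)
    then show "pi_index (- \<sigma> j) (generate G (\<Union>j\<in>I. hall_join j A)) A"
      using pi_index_split(2)[OF hall_join_subgroup sg s _ le hall_join_index[OF assms j]] by blast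
  qed
qed

text \<open>This is the residual \<open>O^{\<sigma> j}(G)\<close>, see
  \<open>pi_residual_eq\<close>. It is given by generators because the action of the Hall subgroups
  on \<open>hall_join j A\<close> is known.\<close>

definition sigma_residual :: "'i \<Rightarrow> 'a set" where
  "sigma_residual j = generate G (\<Union>i\<in>I - {j}. \<Union>{H. hall_subgroup G (\<sigma> i) H})"

lemma sigma_residual_gens: "(\<Union>i\<in>I - {j}. \<Union>{H. hall_subgroup G (\<sigma> i) H}) \<subseteq> carrier G"
  using hallD(1) subgroup.subset by blast

lemma hall_le_sigma_residual: "i \<in> I \<Longrightarrow> i \<noteq> j \<Longrightarrow> hall_subgroup G (\<sigma> i) H \<Longrightarrow> H \<subseteq> sigma_residual j"
  unfolding sigma_residual_def by (blast intro: generate.incl)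

lemma sigma_residual_normal: "sigma_residual j \<lhd> G"
  unfolding normal_iff_normalizes
proof
  show "subgroup (sigma_residual j) G" unfolding sigma_residual_def
      using generate_is_subgroup sigma_residual_gens by blast
  show "normalizes G (carrier G) (sigma_residual j)"
    unfolding sigma_residual_def
  proof (rule normalizes_generate_right)
    fix x s assume x: "x \<in> carrier G" and "s \<in> (\<Union>i\<in>I - {j}. \<Union>{H. hall_subgroup G (\<sigma> i) H})"
    then obtain i H where i: "i \<in> I - {j}" "hall_subgroup G (\<sigma> i) H" "s \<in> H" by blast
    have "hall_subgroup G (\<sigma> i) (conjugate G x ` H)" using hall_conjugate i x by blast
    then show "conjugate G x s \<in> generate G (\<Union>i\<in>I - {j}. \<Union>{H. hall_subgroup G (\<sigma> i) H})"
      using i by (blast intro: generate.incl)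
  qed (use sigma_residual_gens in blast)+
qed

lemma sigma_residual_subgroup: "subgroup (sigma_residual j) G" "sigma_residual j \<subseteq> carrier G"
  using sigma_residual_normal normal_imp_subgroup subgroup.subset by blast+

lemma sigma_residual_index: assumes "j \<in> I" shows "pi_index (\<sigma> j) (sigma_residual j) (carrier G)"
proof (rule pi_index_sigma[OF sigma_residual_subgroup(1) subgroup_self sigma_residual_subgroup(2)
    assms])
  fix i assume i: "i \<in> I" "i \<noteq> j"
  obtain H where H: "hall_subgroup G (\<sigma> i) H" using hall_ex i by blast
  show "pi_index (- \<sigma> i) (sigma_residual j) (carrier G)"
    using pi_index_split(2)[OF hallD(1)[OF H] sigma_residual_subgroup(1) subgroup_self
        hall_le_sigma_residual[OF i H]
        sigma_residual_subgroup(2) hallD(3)[OF H]] .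
qed

text \<open>A normal subgroup of \<open>\<sigma> j\<close>-index contains the Hall subgroups for all
  other classes by \<open>hall_le_normal\<close>.\<close>

lemma sigma_residual_least:
  assumes "N \<lhd> G" "pi_index (\<sigma> j) N (carrier G)" "j \<in> I"
  shows "sigma_residual j \<subseteq> N"
  unfolding sigma_residual_def
proof (rule generate_subgroup_incl[OF _ normal_imp_subgroup[OF assms(1)]])
  show "(\<Union>i\<in>I - {j}. \<Union>{H. hall_subgroup G (\<sigma> i) H}) \<subseteq> N"
    using hall_le_normal[OF assms(1,2)] sigma_disjoint assms(3) by blast
qed

lemma sigma_residual_normalizes_hall_join: assumes "permutable A" "j \<in> I"
    shows "normalizes G (sigma_residual j) (hall_join j A)"
  unfolding sigma_residual_def
proof (rule normalizes_generate_left[OF sigma_residual_gens])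
  show "hall_join j A \<subseteq> carrier G" using hall_join_subgroup subgroup.subset by blast
  show "normalizes G (\<Union>i\<in>I - {j}. \<Union>{H. hall_subgroup G (\<sigma> i) H}) (hall_join j A)"
    using hall_join_normalizes_hall[OF assms(1) _ assms(2)] unfolding normalizes_def by blast
qed

text \<open>The sigma-nilpotent residual in the form that is used, see
  \<open>sigma_nilpotent_residual_eq\<close>: an intersection of the \<open>sigma_residual j\<close>
  acts on every \<open>hall_join j A\<close> at once.\<close>

definition nilp_residual :: "'a set" where "nilp_residual = carrier G \<inter> (\<Inter>j\<in>I. sigma_residual j)"

lemma nilp_residual_subset: "j \<in> I \<Longrightarrow> nilp_residual \<subseteq> sigma_residual j" "nilp_residual \<subseteq> carrier G"
  unfolding nilp_residual_def by blast+

lemma nilp_residual_normal: "nilp_residual \<lhd> G"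
  unfolding normal_iff_normalizes
proof
  have eq: "nilp_residual = \<Inter>(insert (carrier G) (sigma_residual ` I))" unfolding nilp_residual_def
      by simp
  have "subgroup K G" if "K \<in> insert (carrier G) (sigma_residual ` I)" for K
    using that sigma_residual_subgroup(1) subgroup_self by blast
  then show "subgroup nilp_residual G" unfolding eq by (rule subgroups_Inter) auto
  show "normalizes G (carrier G) nilp_residual"
    unfolding normalizes_def
  proof (intro ballI)
    fix x a assume "x \<in> carrier G" "a \<in> nilp_residual"
    then have "conjugate G x a \<in> sigma_residual j" if "j \<in> I" for j
      using sigma_residual_normal[of j] that nilp_residual_subset(1)[OF that]
          unfolding normal_iff_normalizes normalizes_def by blast
    then show "conjugate G x a \<in> nilp_residual"
      using \<open>x \<in> carrier G\<close> \<open>a \<in> nilp_residual\<close> unfolding nilp_residual_def by simp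
  qed
qed

lemma nilp_residual_normalizes: assumes "permutable A" shows "normalizes G nilp_residual A"
proof -
  have c: "(\<Union>j\<in>I. hall_join j A) \<subseteq> carrier G" using hall_join_subgroup subgroup.subset by blast
  have "normalizes G nilp_residual (generate G (\<Union>j\<in>I. hall_join j A))"
  proof (rule normalizes_generate_right[OF nilp_residual_subset(2) c])
    fix x s assume x: "x \<in> nilp_residual" "s \<in> (\<Union>j\<in>I. hall_join j A)"
    then obtain j where "j \<in> I" "s \<in> hall_join j A" by blast
    then have "conjugate G x s \<in> hall_join j A"
        using normalizesD[OF sigma_residual_normalizes_hall_join[OF assms \<open>j \<in> I\<close>]] x(1)
        nilp_residual_subset(1)[OF \<open>j \<in> I\<close>] by (meson subsetD)
    then have "conjugate G x s \<in> (\<Union>j\<in>I. hall_join j A)" using \<open>j \<in> I\<close> by blast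
    then show "conjugate G x s \<in> generate G (\<Union>j\<in>I. hall_join j A)" by (rule generate.incl)
  qed
  then show ?thesis using generate_hall_join[OF assms] by simp
qed

section \<open>Joins and intersections of permutable subgroups\<close>

lemma normal_permutable: assumes "N \<lhd> G" shows "permutable N"
  unfolding permutable_def
proof (intro conjI ballI allI impI)
  show s: "subgroup N G" using assms normal_imp_subgroup by blast
  fix i H assume "hall_subgroup G (\<sigma> i) H"
  then have H: "subgroup H G" using hallD(1) by blast
  then show "N <#> H = H <#> N"
    using normalizes_set_mult_commute[OF s] normal_normalizes[OF assms] subgroup.subset by blast
qed

text \<open>A word in elements of \<open>A\<close> and \<open>B\<close> is moved past
  \<open>h \<in> H\<close> letter by letter. Each move replaces \<open>h\<close> by another element
  of \<open>H\<close>, hence the induction keeps \<open>h\<close> arbitrary.\<close>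

lemma permutable_generate:
  assumes "permutable A" "permutable B" shows "permutable (generate G (A \<union> B))"
  unfolding permutable_def
proof (intro conjI ballI allI impI)
  let ?J = "generate G (A \<union> B)"
  have s: "subgroup A G" "subgroup B G" using assms permutableD(1) by auto
  show J: "subgroup ?J G" using generate_Un_subgroup s by blast
  have cAB: "A \<union> B \<subseteq> carrier G" using s subgroup.subset by blast
  fix i H assume i: "i \<in> I" "hall_subgroup G (\<sigma> i) H"
  then have H: "subgroup H G" using hallD(1) by blast
  have base: "z \<otimes> h \<in> H <#> ?J" if "z \<in> A \<union> B" "h \<in> H" for z h
  proof -
    have "z \<otimes> h \<in> A <#> H \<or> z \<otimes> h \<in> B <#> H" using that set_multI by blast
    then have "z \<otimes> h \<in> H <#> A \<or> z \<otimes> h \<in> H <#> B"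
      using permutableD(2)[OF assms(1) i] permutableD(2)[OF assms(2) i] by simp
    then show ?thesis using mono_set_mult[OF subset_refl generate_Un_upper(1)]
        mono_set_mult[OF subset_refl generate_Un_upper(2)] by blast
  qed
  have gen: "x \<otimes> h \<in> H <#> ?J" if "x \<in> ?J" "h \<in> H" for x h
    using that
  proof (induction arbitrary: h rule: generate.induct)
    case one
    then show ?case using set_mult_upper(1)[OF H J] subgroup.mem_carrier[OF H] by auto
  next
    case (incl z)
    then show ?case using base by blast
  next
    case (inv z)
    then have "inv z \<in> A \<union> B"
      using subgroup.m_inv_closed[OF s(1), of z] subgroup.m_inv_closed[OF s(2), of z] by auto
    then show ?case using base inv.prems by blast
  next
    case (eng y z)
    have c: "y \<in> carrier G" "z \<in> carrier G" "h \<in> carrier G"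
      using eng generate_in_carrier[OF cAB] subgroup.mem_carrier[OF H] by auto
    obtain h1 j1 where 1: "h1 \<in> H" "j1 \<in> ?J" "z \<otimes> h = h1 \<otimes> j1"
      using eng.IH(2)[OF eng.prems] by (rule set_multE)
    obtain h2 j2 where 2: "h2 \<in> H" "j2 \<in> ?J" "y \<otimes> h1 = h2 \<otimes> j2"
      using eng.IH(1)[OF 1(1)] by (rule set_multE)
    have c2: "h1 \<in> carrier G" "h2 \<in> carrier G" "j1 \<in> carrier G" "j2 \<in> carrier G"
      using 1 2 subgroup.mem_carrier[OF H] subgroup.mem_carrier[OF J] by auto
    have "y \<otimes> z \<otimes> h = y \<otimes> (h1 \<otimes> j1)" using 1 c by (simp add: m_assoc)
    also have "\<dots> = (y \<otimes> h1) \<otimes> j1" using c c2 by (simp add: m_assoc)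
    also have "\<dots> = h2 \<otimes> (j2 \<otimes> j1)" using 2 c2 by (simp add: m_assoc)
    finally show ?case using 1 2 subgroup.m_closed[OF J] set_multI by metis
  qed
  have "?J <#> H \<subseteq> H <#> ?J"
  proof
    fix w assume "w \<in> ?J <#> H"
    then obtain x h where "x \<in> ?J" "h \<in> H" "w = x \<otimes> h" by (rule set_multE)
    then show "w \<in> H <#> ?J" using gen by blast
  qed
  then show "?J <#> H = H <#> ?J" using set_mult_commuteI[OF H J] by simp
qed

text \<open>For permutable \<open>A\<close> a subgroup of \<open>\<sigma> i\<close>-index that is
  normalized by \<open>A\<close> and by every Hall \<open>\<sigma> i\<close>-subgroup, because the
  class \<open>i\<close> itself is left out of the generators.\<close>

definition hall_join_compl :: "'i \<Rightarrow> 'a set \<Rightarrow> 'a set" where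
  "hall_join_compl i A = generate G (\<Union>j\<in>I - {i}. hall_join j A)"

lemma hall_join_compl_subgroup: "subgroup (hall_join_compl i A) G" "hall_join_compl i A \<subseteq> carrier G"
proof -
  have "(\<Union>j\<in>I - {i}. hall_join j A) \<subseteq> carrier G" using hall_join_subgroup subgroup.subset by blast
  then show "subgroup (hall_join_compl i A) G" unfolding hall_join_compl_def
      using generate_is_subgroup by blast
  then show "hall_join_compl i A \<subseteq> carrier G" using subgroup.subset by blast
qed

lemma hall_join_compl_subset: "subgroup A G \<Longrightarrow> hall_join_compl i A \<subseteq> A"
  unfolding hall_join_compl_def by (rule generate_subgroup_incl) (use hall_join_subset in auto)

lemma hall_join_le_hall_join_compl: "j \<in> I \<Longrightarrow> j \<noteq> i \<Longrightarrow> hall_join j A \<subseteq> hall_join_compl i A"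
  unfolding hall_join_compl_def by (blast intro: generate.incl)

lemma hall_join_compl_normalizes:
  assumes "V \<subseteq> carrier G" "\<And>j. j \<in> I \<Longrightarrow> j \<noteq> i \<Longrightarrow> normalizes G V (hall_join j A)"
  shows "normalizes G V (hall_join_compl i A)"
  unfolding hall_join_compl_def
proof (rule normalizes_generate_right[OF assms(1)])
  show "(\<Union>j\<in>I - {i}. hall_join j A) \<subseteq> carrier G" using hall_join_subgroup subgroup.subset by blast
  fix x s assume x: "x \<in> V" "s \<in> (\<Union>j\<in>I - {i}. hall_join j A)"
  then obtain j where j: "j \<in> I" "j \<noteq> i" "s \<in> hall_join j A" by blast
  then have "conjugate G x s \<in> (\<Union>j\<in>I - {i}. hall_join j A)"
      using normalizesD[OF assms(2)[OF j(1,2)] x(1) j(3)] by blast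
  then show "conjugate G x s \<in> generate G (\<Union>j\<in>I - {i}. hall_join j A)" by (rule generate.incl)
qed

lemma hall_join_compl_index:
  assumes "permutable A" "i \<in> I" shows "pi_index (\<sigma> i) (hall_join_compl i A) A"
proof -
  have s: "subgroup A G" using assms permutableD(1) by blast
  show ?thesis
  proof (rule pi_index_sigma[OF hall_join_compl_subgroup(1) s hall_join_compl_subset[OF s]
      assms(2)])
    fix j assume j: "j \<in> I" "j \<noteq> i"
    show "pi_index (- \<sigma> j) (hall_join_compl i A) A"
      using pi_index_split(2)[OF hall_join_subgroup hall_join_compl_subgroup(1) s
          hall_join_le_hall_join_compl[OF j] hall_join_compl_subset[OF s]
          hall_join_index[OF assms(1) j(1)]] .
  qed
qed

lemma hall_join_compl_normalizes_hall:
  assumes "permutable A" "i \<in> I" "hall_subgroup G (\<sigma> i) H"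
  shows "normalizes G (A <#> H) (hall_join_compl i A)"
proof (rule normalizes_set_mult_left)
  show s: "subgroup A G" "subgroup H G" using assms permutableD(1) hallD(1) by auto
  show "normalizes G A (hall_join_compl i A)"
      using hall_join_compl_normalizes hall_join_normalizes_self s subgroup.subset by metis
  show "normalizes G H (hall_join_compl i A)"
      using hall_join_compl_normalizes hall_join_normalizes_hall assms s subgroup.subset by metis
qed (rule hall_join_compl_subgroup)

text \<open>\<open>A\<close> and \<open>B\<close> need not permute with each other, so the index of
  their intersection is controlled by normal subgroups of \<open>T = AH \<inter> BH\<close>:
  \<open>?P\<close> and \<open>?Q\<close> have \<open>\<sigma> i\<close>-index there, hence so have
  \<open>?P \<inter> ?Q\<close> and the larger \<open>A \<inter> B\<close>. As \<open>H\<close> has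
  index prime to \<open>\<sigma> i\<close> in \<open>T\<close>, coprime indices give
  \<open>(A \<inter> B)H = T = H(A \<inter> B)\<close>.\<close>

lemma permutable_Int:
  assumes "permutable A" "permutable B" shows "permutable (A \<inter> B)"
  unfolding permutable_def
proof (intro conjI ballI allI impI)
  have s: "subgroup A G" "subgroup B G" using assms permutableD(1) by auto
  show sI: "subgroup (A \<inter> B) G" using subgroup_Int s by blast
  fix i H assume i: "i \<in> I" "hall_subgroup G (\<sigma> i) H"
  then have H: "subgroup H G" using hallD(1) by blast
  define T where "T = (A <#> H) \<inter> (B <#> H)"
  note A = permutable_hall_mult[OF assms(1) i] and B = permutable_hall_mult[OF assms(2) i]
  have T: "subgroup T G" unfolding T_def using subgroup_Int A(1) B(1) by blast
  have step: "subgroup (T \<inter> hall_join_compl i C) G \<and> normalizes G T (T \<inter> hall_join_compl i C) \<and>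
      pi_index (\<sigma> i) (T \<inter> hall_join_compl i C) T"
    if C: "permutable C" "T \<subseteq> C <#> H" for C
  proof -
    have sC: "subgroup C G" using C permutableD(1) by blast
    note CH = permutable_hall_mult[OF C(1) i]
    have n: "normalizes G T (hall_join_compl i C)"
        using hall_join_compl_normalizes_hall[OF C(1) i] C(2) normalizes_mono by blast
    have le: "hall_join_compl i C \<subseteq> C <#> H"
        using hall_join_compl_subset[OF sC] set_mult_upper(1)[OF sC H] by blast
    have "pi_index (\<sigma> i) (hall_join_compl i C) (C <#> H)"
      using pi_index_trans[OF hall_join_compl_index[OF C(1) i(1)] CH(2)] .
    then have "pi_index (\<sigma> i) (T \<inter> hall_join_compl i C) T"
      using pi_index_inter[OF T hall_join_compl_subgroup(1) CH(1) C(2) le]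
        normalizes_set_mult_commute[OF hall_join_compl_subgroup(1) T n] by simp
    then show ?thesis
        using subgroup_Int[OF T hall_join_compl_subgroup(1)] normalizes_Int[OF normalizes_self[OF T]
        n] by blast
  qed
  let ?P = "T \<inter> hall_join_compl i A" and ?Q = "T \<inter> hall_join_compl i B"
  have P: "subgroup ?P G" "normalizes G T ?P" "pi_index (\<sigma> i) ?P T"
    and Q: "subgroup ?Q G" "normalizes G T ?Q" "pi_index (\<sigma> i) ?Q T"
    using step assms unfolding T_def by blast+
  have "normalizes G ?P ?Q" using Q(2) normalizes_mono by blast
  then have "pi_index (\<sigma> i) (?P \<inter> ?Q) ?P"
    using pi_index_inter[OF P(1) Q(1) T _ _ _ Q(3)] normalizes_set_mult_commute[OF Q(1) P(1)]
        by auto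
  then have PQ: "pi_index (\<sigma> i) (?P \<inter> ?Q) T" using pi_index_trans P(3) by blast
  have le: "A \<inter> B \<subseteq> T" unfolding T_def using set_mult_upper(1) s H by blast
  have "pi_index (\<sigma> i) (A \<inter> B) T"
    by (rule pi_index_split(2)[OF subgroup_Int[OF P(1) Q(1)] sI T _ le PQ])
      (use hall_join_compl_subset s in blast)
  moreover have HT: "H \<subseteq> T" unfolding T_def using set_mult_upper(2) s H by blast
  moreover have "pi_index (- \<sigma> i) H T" using hall_index[OF i(2) T HT] .
  ultimately show "(A \<inter> B) <#> H = H <#> (A \<inter> B)"
    using coprime_index_set_mult[OF sI H T le HT] by simp
qed

end

section \<open>Distributive lattices of subgroups\<close>

text \<open>One interface for the permutable subgroups, the normal subgroups and the subgroups in an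
  interval: in each of them the meet is the intersection, and only the join varies.\<close>

locale set_lattice =
  fixes S :: "'a set set" and jn :: "'a set \<Rightarrow> 'a set \<Rightarrow> 'a set"
  assumes inter_closed: "A \<in> S \<Longrightarrow> B \<in> S \<Longrightarrow> A \<inter> B \<in> S"
    and jn_closed: "A \<in> S \<Longrightarrow> B \<in> S \<Longrightarrow> jn A B \<in> S"
    and jn_upper: "A \<in> S \<Longrightarrow> B \<in> S \<Longrightarrow> A \<subseteq> jn A B" "A \<in> S \<Longrightarrow> B \<in> S \<Longrightarrow> B \<subseteq> jn A B"
    and jn_least: "A \<in> S \<Longrightarrow> B \<in> S \<Longrightarrow> C \<in> S \<Longrightarrow> A \<subseteq> C \<Longrightarrow> B \<subseteq> C \<Longrightarrow> jn A B \<subseteq> C"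
begin

abbreviation LS where "LS \<equiv> inclusion_order S"

lemma LS_simps: "carrier LS = S" "le LS = (\<subseteq>)" "eq LS = (=)"
  unfolding inclusion_order_def by simp_all

lemma LS_lub: "A \<in> S \<Longrightarrow> B \<in> S \<Longrightarrow> is_lub LS (jn A B) {A, B}"
  unfolding least_def Upper_def LS_simps using jn_closed jn_upper jn_least by auto

lemma LS_glb: "A \<in> S \<Longrightarrow> B \<in> S \<Longrightarrow> is_glb LS (A \<inter> B) {A, B}"
  unfolding greatest_def Lower_def LS_simps using inter_closed by auto

lemma LS_lattice: "lattice LS"
proof -
  have "partial_order LS" by unfold_locales (auto simp: LS_simps)
  then interpret partial_order LS .
  show ?thesis
  proof unfold_locales
    fix A B assume "A \<in> carrier LS" "B \<in> carrier LS"
    then show "\<exists>s. is_lub LS s {A, B}" "\<exists>s. is_glb LS s {A, B}"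
      using LS_lub LS_glb unfolding LS_simps by blast+
  qed
qed

lemma LS_join: assumes "A \<in> S" "B \<in> S" shows "A \<squnion>\<^bsub>LS\<^esub> B = jn A B"
proof -
  have "is_lub LS (A \<squnion>\<^bsub>LS\<^esub> B) {A, B}"
    unfolding Lattice.join_def Lattice.sup_def using LS_lub[OF assms] by (rule someI)
  then show ?thesis using LS_lub[OF assms] unfolding least_def LS_simps by (meson subset_antisym)
qed

lemma LS_meet: assumes "A \<in> S" "B \<in> S" shows "A \<sqinter>\<^bsub>LS\<^esub> B = A \<inter> B"
proof -
  have "is_glb LS (A \<sqinter>\<^bsub>LS\<^esub> B) {A, B}"
    unfolding Lattice.meet_def Lattice.inf_def using LS_glb[OF assms] by (rule someI)
  then show ?thesis using LS_glb[OF assms] unfolding greatest_def LS_simps by (meson subset_antisym)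
qed

lemma LS_meet_distributive:
  "meet_distributive LS A \<longleftrightarrow> A \<in> S \<and> (\<forall>B\<in>S. \<forall>C\<in>S. A \<inter> jn B C = jn (A \<inter> B) (A \<inter> C))"
  unfolding meet_distributive_def LS_simps
      by (simp add: LS_join LS_meet inter_closed jn_closed cong: conj_cong)

lemma LS_distributive:
  "distributive LS \<longleftrightarrow> (\<forall>A\<in>S. \<forall>B\<in>S. \<forall>C\<in>S. A \<inter> jn B C = jn (A \<inter> B) (A \<inter> C))"
  unfolding distributive_def using LS_lattice LS_meet_distributive by (auto simp: LS_simps)

lemma jn_eqI:
  assumes "A \<in> S" "B \<in> S" "C \<in> S" "A \<subseteq> C" "B \<subseteq> C" "\<And>D. D \<in> S \<Longrightarrow> A \<subseteq> D \<Longrightarrow> B \<subseteq> D \<Longrightarrow> C \<subseteq> D"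
  shows "jn A B = C"
  by (rule subset_antisym) (use assms jn_closed jn_upper jn_least in simp_all)

lemma jn_comm: assumes "A \<in> S" "B \<in> S" shows "jn A B = jn B A"
  by (rule jn_eqI) (use assms jn_closed jn_upper jn_least in auto)

lemma jn_dual_distrib:
  assumes "\<And>A B C. A \<in> S \<Longrightarrow> B \<in> S \<Longrightarrow> C \<in> S \<Longrightarrow> A \<inter> jn B C = jn (A \<inter> B) (A \<inter> C)"
    and "A \<in> S" "B \<in> S" "C \<in> S"
  shows "jn A (B \<inter> C) = jn A B \<inter> jn A C"
proof
  have BC: "B \<inter> C \<in> S" using assms inter_closed by simp
  have "A \<subseteq> jn A B \<inter> jn A C" "B \<inter> C \<subseteq> jn A B \<inter> jn A C"
    using jn_upper[OF assms(2,3)] jn_upper[OF assms(2,4)] by auto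
  then show "jn A (B \<inter> C) \<subseteq> jn A B \<inter> jn A C"
    by (rule jn_least[OF assms(2) BC inter_closed[OF jn_closed[OF assms(2,3)] jn_closed[OF
        assms(2,4)]]])
  have J: "jn A (B \<inter> C) \<in> S" using assms jn_closed inter_closed by simp
  have "jn A B \<inter> jn A C = jn (jn A B \<inter> A) (jn A B \<inter> C)"
    using assms jn_closed by simp
  also have "\<dots> \<subseteq> jn A (B \<inter> C)"
  proof (rule jn_least)
    have "C \<inter> jn A B = jn (C \<inter> A) (C \<inter> B)" by (rule assms(1)[OF assms(4,2,3)])
    also have "\<dots> \<subseteq> jn A (B \<inter> C)"
    proof (rule jn_least[OF inter_closed[OF assms(4,2)] inter_closed[OF assms(4,3)] J])
      show "C \<inter> A \<subseteq> jn A (B \<inter> C)" "C \<inter> B \<subseteq> jn A (B \<inter> C)"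
        using jn_upper[OF assms(2) BC] by auto
    qed
    finally show "jn A B \<inter> C \<subseteq> jn A (B \<inter> C)" by (simp add: Int_commute)
    show "jn A B \<inter> A \<subseteq> jn A (B \<inter> C)" using jn_upper(1)[OF assms(2) BC] by auto
    show "jn A B \<inter> A \<in> S" "jn A B \<inter> C \<in> S"
      using inter_closed[OF jn_closed[OF assms(2,3)]] assms by auto
  qed (rule J)
  finally show "jn A B \<inter> jn A C \<subseteq> jn A (B \<inter> C)" .
qed

context
  assumes modular: "\<And>A B C. A \<in> S \<Longrightarrow> B \<in> S \<Longrightarrow> C \<in> S \<Longrightarrow> A \<subseteq> C \<Longrightarrow> jn A B \<inter> C = jn A (B \<inter> C)"
begin

text \<open>The modular law is applied twice, above \<open>a \<inter> c\<close> and above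
  \<open>b \<inter> c\<close>. The right side is the lower median of the three elements.\<close>

lemma modular_median:
  assumes "a \<in> S" "b \<in> S" "c \<in> S"
  shows "jn a (b \<inter> c) \<inter> jn b (a \<inter> c) = jn (a \<inter> c) (jn (b \<inter> c) (a \<inter> b))"
proof -
  let ?A = "jn a (b \<inter> c)"
  have m: "a \<inter> b \<in> S" "a \<inter> c \<in> S" "b \<inter> c \<in> S" using assms inter_closed by auto
  have A: "?A \<in> S" "a \<subseteq> ?A" using jn_closed jn_upper assms m by auto
  have "?A \<inter> jn b (a \<inter> c) = jn (a \<inter> c) b \<inter> ?A" using jn_comm assms m by blast
  also have "\<dots> = jn (a \<inter> c) (b \<inter> ?A)" by (rule modular) (use assms m A in auto)
  also have "b \<inter> ?A = jn (b \<inter> c) a \<inter> b" using jn_comm assms m by blast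
  also have "\<dots> = jn (b \<inter> c) (a \<inter> b)" by (rule modular) (use assms m in auto)
  finally show ?thesis .
qed

text \<open>The classical construction of a diamond in a modular lattice, in two rounds: the triple
  is first shrunk until any two members have the same join, then enlarged until any two have the
  same meet.\<close>

lemma diamond_exists:
  assumes "a \<in> S" "b \<in> S" "c \<in> S" "a \<inter> jn b c \<noteq> jn (a \<inter> b) (a \<inter> c)"
  obtains A B C E where "A \<in> S" "B \<in> S" "C \<in> S" "A \<inter> B = E" "A \<inter> C = E" "B \<inter> C = E"
    "jn A B = jn B C" "jn A C = jn B C" "A \<noteq> E"
proof -
  \<comment> \<open>Each element is cut by the join of the other two, always with the elements that
    are already cut; this makes the pairwise joins of \<open>x\<close>, \<open>y\<close>,
    \<open>z\<close> equal.\<close>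
  define x where "x = a \<inter> jn b c"
  define y where "y = b \<inter> jn x c"
  define z where "z = c \<inter> jn x y"
  have S1: "x \<in> S" using x_def assms inter_closed jn_closed by simp
  have S2: "y \<in> S" using y_def S1 assms inter_closed jn_closed by simp
  have S3: "z \<in> S" using z_def S1 S2 assms inter_closed jn_closed by simp
  note S = S1 S2 S3
  have m: "x \<inter> y \<in> S" "x \<inter> z \<in> S" "y \<inter> z \<in> S" using S inter_closed by auto
  have ab: "a \<inter> b \<in> S" "a \<inter> c \<in> S" using assms inter_closed by auto
  have nle: "\<not> x \<subseteq> jn (a \<inter> b) (a \<inter> c)"
  proof -
    have "jn (a \<inter> b) (a \<inter> c) \<subseteq> x" unfolding x_def
      by (rule jn_least) (use ab assms S x_def jn_upper[of b c] in auto)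
    then show ?thesis using assms(4) x_def by blast
  qed
  have xbc: "x \<subseteq> jn b c" using x_def by blast
  have yc: "jn c y = jn c b \<inter> jn x c"
    using modular[of c b "jn x c"] S assms jn_upper jn_closed y_def by simp
  have xyc: "x \<subseteq> jn y c"
  proof -
    have "x \<subseteq> jn x c" using jn_upper S assms by blast
    then show ?thesis using yc xbc jn_comm[of c b] jn_comm[of c y] S assms by blast
  qed
  have yz: "jn y z = jn y c \<inter> jn x y"
    using modular[of y c "jn x y"] S assms jn_upper jn_closed z_def by simp
  have xz: "jn x z = jn x c \<inter> jn x y"
    using modular[of x c "jn x y"] S assms jn_upper jn_closed z_def by simp
  have x1: "x \<subseteq> jn y z" using yz xyc jn_upper(1)[OF S(1,2)] by blast
  have y1: "y \<subseteq> jn x z" using xz y_def jn_upper(2)[OF S(1,2)] by blast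
  have z1: "z \<subseteq> jn x y" using z_def by blast
  have T1: "jn x y = jn y z"
  proof
    show "jn x y \<subseteq> jn y z"
        by (rule jn_least[OF S(1,2) jn_closed[OF S(2,3)] x1 jn_upper(1)[OF S(2,3)]])
    show "jn y z \<subseteq> jn x y"
        by (rule jn_least[OF S(2,3) jn_closed[OF S(1,2)] jn_upper(2)[OF S(1,2)] z1])
  qed
  have T2: "jn x z = jn y z"
  proof
    show "jn x z \<subseteq> jn y z"
        by (rule jn_least[OF S(1,3) jn_closed[OF S(2,3)] x1 jn_upper(2)[OF S(2,3)]])
    show "jn y z \<subseteq> jn x z"
        by (rule jn_least[OF S(2,3) jn_closed[OF S(1,3)] y1 jn_upper(2)[OF S(1,3)]])
  qed
  let ?Q = "jn (x \<inter> y) (x \<inter> z)"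
  have Q: "?Q \<in> S" "?Q \<subseteq> x" using m S jn_closed jn_least by auto
  \<comment> \<open>The failure of distributivity survives the cutting, since
    \<open>x \<inter> y \<subseteq> a \<inter> b\<close> and
    \<open>x \<inter> z \<subseteq> a \<inter> c\<close>.\<close>
  have nle2: "\<not> x \<subseteq> ?Q"
  proof -
    have "?Q \<subseteq> jn (a \<inter> b) (a \<inter> c)"
    proof (rule jn_least[OF m(1,2) jn_closed[OF ab]])
      show "x \<inter> y \<subseteq> jn (a \<inter> b) (a \<inter> c)" using jn_upper(1)[OF ab] x_def y_def by blast
      show "x \<inter> z \<subseteq> jn (a \<inter> b) (a \<inter> c)" using jn_upper(2)[OF ab] x_def z_def by blast
    qed
    then show ?thesis using nle by blast
  qed
  \<comment> \<open>Adding to each element the meet of the other two keeps the common join and turns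
    all pairwise meets into the lower median \<open>E\<close>.\<close>
  define E where "E = jn ?Q (y \<inter> z)"
  define A where "A = jn x (y \<inter> z)"
  define B where "B = jn y (x \<inter> z)"
  define C where "C = jn z (x \<inter> y)"
  have ABC: "A \<in> S" "B \<in> S" "C \<in> S" "E \<in> S" unfolding A_def B_def C_def E_def
    using S m Q jn_closed by auto
  have EU: "x \<inter> y \<subseteq> E" "x \<inter> z \<subseteq> E" "y \<inter> z \<subseteq> E"
    using jn_upper[OF m(1,2)] jn_upper[OF Q(1) m(3)] unfolding E_def by auto
  have EL: "E \<subseteq> D" if "D \<in> S" "x \<inter> y \<subseteq> D" "x \<inter> z \<subseteq> D" "y \<inter> z \<subseteq> D" for D
    unfolding E_def by (rule jn_least[OF Q(1) m(3) that(1) jn_least[OF m(1,2) that(1,2,3)] that(4)])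
  have Eeq: "jn u (jn v w) = E"
    if uvw: "u \<in> S" "v \<in> S" "w \<in> S" and le: "u \<subseteq> E" "v \<subseteq> E" "w \<subseteq> E"
      and ge: "\<And>D. u \<subseteq> D \<Longrightarrow> v \<subseteq> D \<Longrightarrow> w \<subseteq> D \<Longrightarrow> x \<inter> y \<subseteq> D \<and> x \<inter> z \<subseteq> D \<and> y \<inter> z \<subseteq> D" for u v w
  proof
    have vw: "jn v w \<in> S" using jn_closed uvw by simp
    show "jn u (jn v w) \<subseteq> E"
      by (rule jn_least[OF uvw(1) vw ABC(4) le(1) jn_least[OF uvw(2,3) ABC(4) le(2,3)]])
    have "u \<subseteq> jn u (jn v w)" "v \<subseteq> jn u (jn v w)" "w \<subseteq> jn u (jn v w)"
      using jn_upper[OF uvw(1) vw] jn_upper[OF uvw(2,3)] by auto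
    then show "E \<subseteq> jn u (jn v w)" using EL[OF jn_closed[OF uvw(1) vw]] ge by simp
  qed
  have E1: "jn (x \<inter> z) (jn (y \<inter> z) (x \<inter> y)) = E"
    by (rule Eeq[OF m(2,3,1) EU(2,3,1)]) simp
  have E2: "jn (x \<inter> y) (jn (y \<inter> z) (x \<inter> z)) = E"
    by (rule Eeq[OF m(1,3,2) EU(1,3,2)]) simp
  have E3: "jn (x \<inter> y) (jn (x \<inter> z) (y \<inter> z)) = E"
    by (rule Eeq[OF m(1,2,3) EU(1,2,3)]) simp
  have AB: "A \<inter> B = E"
    using modular_median[OF S(1,2,3)] E1 unfolding A_def B_def by simp
  have AC: "A \<inter> C = E"
    using modular_median[OF S(1,3,2)] E2 unfolding A_def C_def Int_commute[of z y] by simp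
  have BC: "B \<inter> C = E"
    using modular_median[OF S(2,3,1)] E3
    unfolding B_def C_def Int_commute[of y x] Int_commute[of z x] by simp
  have up: "x \<subseteq> A" "y \<subseteq> B" "z \<subseteq> C" unfolding A_def B_def C_def using jn_upper S m by auto
  have lo: "A \<subseteq> jn y z" "B \<subseteq> jn y z" "C \<subseteq> jn y z"
    unfolding A_def B_def C_def
    by (rule jn_least; use S m x1 jn_upper[OF S(2,3)] jn_closed in auto)+
  have jT: "jn y z \<in> S" using S jn_closed by simp
  have "jn A B = jn y z"
  proof (rule jn_eqI)
    fix D assume "D \<in> S" "A \<subseteq> D" "B \<subseteq> D"
    then have "jn x y \<subseteq> D" using up jn_least[OF S(1,2)] by blast
    then show "jn y z \<subseteq> D" using T1 by simp
  qed (use ABC jT lo in auto)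
  moreover have "jn A C = jn y z"
  proof (rule jn_eqI)
    fix D assume "D \<in> S" "A \<subseteq> D" "C \<subseteq> D"
    then have "jn x z \<subseteq> D" using up jn_least[OF S(1,3)] by blast
    then show "jn y z \<subseteq> D" using T2 by simp
  qed (use ABC jT lo in auto)
  moreover have "jn B C = jn y z"
  proof (rule jn_eqI)
    fix D assume "D \<in> S" "B \<subseteq> D" "C \<subseteq> D"
    then show "jn y z \<subseteq> D" using up jn_least[OF S(2,3)] by blast
  qed (use ABC jT lo in auto)
  moreover have "A \<noteq> E"
  proof
    assume "A = E"
    then have "x = jn ?Q (y \<inter> z) \<inter> x" using up E_def by blast
    also have "\<dots> = jn ?Q (y \<inter> z \<inter> x)" by (rule modular) (use Q m S in auto)
    also have "\<dots> \<subseteq> ?Q"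
      by (rule jn_least) (use Q m S inter_closed jn_upper(1)[OF m(1,2)] in auto)
    finally show False using nle2 by blast
  qed
  ultimately show ?thesis using that[of A B C E] ABC AB AC BC by simp
qed

end

end

section \<open>Commutators\<close>

context group
begin

definition commutator :: "'a \<Rightarrow> 'a \<Rightarrow> 'a" where "commutator x y = inv x \<otimes> inv y \<otimes> x \<otimes> y"

lemma commutator_closed [simp]: "x \<in> carrier G \<Longrightarrow> y \<in> carrier G \<Longrightarrow> commutator x y \<in> carrier G"
  by (simp add: commutator_def)

lemma commutator_eq: "x \<in> carrier G \<Longrightarrow> y \<in> carrier G \<Longrightarrow> commutator x y = inv x \<otimes> conjugate G y x"
  by (simp add: commutator_def conjugate_def m_assoc)

lemma conjugate_eq_commutator:
    "x \<in> carrier G \<Longrightarrow> y \<in> carrier G \<Longrightarrow> conjugate G y x = x \<otimes> commutator x y"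
  by (simp add: commutator_def conjugate_def m_assoc)

lemma commutator_inv: "x \<in> carrier G \<Longrightarrow> y \<in> carrier G \<Longrightarrow> inv (commutator x y) = commutator y x"
  by (simp add: commutator_def m_assoc inv_mult_group)

lemma mult_commutator: "x \<in> carrier G \<Longrightarrow> y \<in> carrier G \<Longrightarrow> x \<otimes> y = y \<otimes> x \<otimes> commutator x y"
  by (simp add: commutator_def m_assoc)

lemma commutator_mem:
  assumes "subgroup A G" "x \<in> A" "y \<in> carrier G" "conjugate G y x \<in> A"
  shows "commutator x y \<in> A" "commutator y x \<in> A"
proof -
  have x: "x \<in> carrier G" using assms subgroup.mem_carrier by metis
  show "commutator x y \<in> A" using commutator_eq[OF x assms(3)] assms
      by (simp add: subgroup.m_closed subgroup.m_inv_closed)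
  then show "commutator y x \<in> A"
      using commutator_inv[OF x assms(3)] subgroup.m_inv_closed[OF assms(1)] by metis
qed

lemma commutator_normalizes:
  assumes "subgroup A G" "V \<subseteq> carrier G" "normalizes G V A" "x \<in> A" "y \<in> V"
  shows "commutator x y \<in> A" "commutator y x \<in> A"
  using commutator_mem[OF assms(1,4)] normalizesD[OF assms(3,5,4)] assms(2,5) by auto

lemma commutator_one: "x \<in> carrier G \<Longrightarrow> commutator x \<one> = \<one>" "x \<in> carrier G \<Longrightarrow> commutator x x = \<one>"
  by (simp_all add: commutator_def m_assoc)

lemma commutator_mult_right:
  "x \<in> carrier G \<Longrightarrow> y \<in> carrier G \<Longrightarrow> z \<in> carrier G \<Longrightarrow>
    commutator x (y \<otimes> z) = commutator x z \<otimes> conjugate G z (commutator x y)"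
  by (simp add: commutator_def conjugate_def m_assoc inv_mult_group)

lemma commutator_inv_right:
  "x \<in> carrier G \<Longrightarrow> y \<in> carrier G \<Longrightarrow> commutator x (inv y) = conjugate G (inv y) (inv (commutator x
      y))"
  by (simp add: commutator_def conjugate_def m_assoc inv_mult_group)

text \<open>The identities \<open>[x, yz] = [x, z] [x, y]^z\<close> and its analogue for inverses
  reduce the claim to generators, since conjugation by \<open>generate G Q\<close> preserves
  \<open>E\<close>.\<close>

lemma commutator_generate:
  assumes "subgroup E G" "Q \<subseteq> carrier G" "normalizes G (generate G Q) E" "x \<in> carrier G"
    and "\<And>q. q \<in> Q \<Longrightarrow> commutator x q \<in> E"
  shows "y \<in> generate G Q \<Longrightarrow> commutator x y \<in> E"
proof (induction rule: generate.induct)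
  case one
  then show ?case using commutator_one assms(1,4) by (simp add: subgroup.one_closed)
next
  case (incl h)
  then show ?case using assms by simp
next
  case (inv h)
  have "h \<in> carrier G" using inv assms by blast
  moreover have "inv h \<in> generate G Q" by (rule generate.inv[OF inv])
  ultimately show ?case
    using commutator_inv_right[OF assms(4)] assms(5)[OF inv] normalizesD[OF assms(3)]
      subgroup.m_inv_closed[OF assms(1)] by simp
next
  case (eng h1 h2)
  have "h1 \<in> carrier G" "h2 \<in> carrier G" using eng generate_in_carrier[OF assms(2)] by auto
  then show ?case
    using commutator_mult_right[OF assms(4)] eng normalizesD[OF assms(3)] subgroup.m_closed[OF
        assms(1)] by simp
qed

lemma commutator_all_generate:
  assumes "subgroup E G" "Q \<subseteq> carrier G" "normalizes G (generate G Q) E"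
    and "\<And>q r. q \<in> Q \<Longrightarrow> r \<in> Q \<Longrightarrow> commutator q r \<in> E"
    and "x \<in> generate G Q" "y \<in> generate G Q"
  shows "commutator x y \<in> E"
proof -
  have c: "x \<in> carrier G" using assms generate_in_carrier by blast
  have "commutator x q \<in> E" if q: "q \<in> Q" for q
  proof -
    have qc: "q \<in> carrier G" using q assms by blast
    have "commutator q x \<in> E" using commutator_generate[OF assms(1-3) qc _ assms(5)] assms(4)[OF q]
        by blast
    then show ?thesis using commutator_inv[OF qc c] subgroup.m_inv_closed[OF assms(1)] by metis
  qed
  then show ?thesis using commutator_generate[OF assms(1-3) c _ assms(6)] by blast
qed

lemma commutator_normalizes_between:
  assumes "subgroup V G" "W \<subseteq> carrier G" "E \<subseteq> V" "V \<subseteq> W"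
    and "\<And>x y. x \<in> W \<Longrightarrow> y \<in> W \<Longrightarrow> commutator x y \<in> E"
  shows "normalizes G W V"
  unfolding normalizes_def
proof (intro ballI)
  fix x a assume x: "x \<in> W" "a \<in> V"
  then have "conjugate G x a = a \<otimes> commutator a x" using assms
      by (auto intro!: conjugate_eq_commutator)
  moreover have "commutator a x \<in> V" using assms x by blast
  ultimately show "conjugate G x a \<in> V" using x subgroup.m_closed[OF assms(1)] by simp
qed

text \<open>For \<open>a \<in> A\<close>, \<open>b \<in> B\<close> the commutator lies in \<open>(N \<inter> A)(N \<inter> B)\<close>, and its factor in \<open>N \<inter> A\<close> can
  be moved past \<open>b\<close>, since \<open>N\<close> normalizes \<open>B\<close>.\<close>

lemma set_mult_commute_of_distrib:
  assumes "subgroup A G" "subgroup B G" "subgroup N G" "normalizes G N B"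
    and "\<And>a b. a \<in> A \<Longrightarrow> b \<in> B \<Longrightarrow> commutator b a \<in> N"
    and "N \<inter> generate G (A \<union> B) = generate G ((N \<inter> A) \<union> (N \<inter> B))"
  shows "A <#> B = B <#> A"
proof (rule set_mult_commuteI[OF assms(1,2)])
  show "B <#> A \<subseteq> A <#> B"
  proof
    fix z assume "z \<in> B <#> A"
    then obtain b a where z: "b \<in> B" "a \<in> A" "z = b \<otimes> a" by (rule set_multE)
    have c: "a \<in> carrier G" "b \<in> carrier G" using z assms subgroup.mem_carrier by metis+
    have J: "subgroup (generate G (A \<union> B)) G" using generate_Un_subgroup assms by blast
    have "commutator b a \<in> generate G (A \<union> B)"
      unfolding commutator_def using z generate_Un_upper
      by (intro subgroup.m_closed[OF J] subgroup.m_inv_closed[OF J]) blast+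
    then have w: "commutator b a \<in> generate G ((N \<inter> A) \<union> (N \<inter> B))" using assms(5,6) z by blast
    have sA: "subgroup (N \<inter> A) G" and sB: "subgroup (N \<inter> B) G" using assms subgroup_Int by auto
    have "normalizes G (N \<inter> A) (N \<inter> B)"
      using normalizes_Int[OF normalizes_self[OF assms(3)] assms(4)] normalizes_mono by blast
    then have "(N \<inter> A) <#> (N \<inter> B) = (N \<inter> B) <#> (N \<inter> A)"
      using normalizes_set_mult_commute[OF sB sA] by simp
    then have "commutator b a \<in> (N \<inter> A) <#> (N \<inter> B)" using w set_mult_eq_generate[OF sA sB] by simp
    then obtain u v where u: "u \<in> N \<inter> A" "v \<in> N \<inter> B" "commutator b a = u \<otimes> v" by (rule set_multE)
    have cu: "u \<in> carrier G" "v \<in> carrier G" using u sA sB subgroup.mem_carrier by metis+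
    have "z = a \<otimes> b \<otimes> (u \<otimes> v)" using mult_commutator[OF c(2,1)] z u by simp
    also have "\<dots> = (a \<otimes> u) \<otimes> (conjugate G u b \<otimes> v)" using c cu by (simp add: m_assoc conjugate_def)
    finally have "z = (a \<otimes> u) \<otimes> (conjugate G u b \<otimes> v)" .
    moreover have "a \<otimes> u \<in> A" using u z subgroup.m_closed[OF assms(1)] by blast
    moreover have "conjugate G u b \<otimes> v \<in> B"
        using u z normalizesD[OF assms(4)] subgroup.m_closed[OF assms(2)] by blast
    ultimately show "z \<in> A <#> B" using set_multI by blast
  qed
qed

end

section \<open>Ore's theorem for intervals of subgroups\<close>

context fin_group
begin

text \<open>Ore's theorem, with \<open>cy a\<close> in the role of a cyclic subgroup. The inductive
  claim is that the join of some \<open>cy a\<close> with any member \<open>M\<close> of the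
  interval is again some \<open>cy c\<close>; the case \<open>a = \<one>\<close>,
  \<open>M = T\<close> finishes the proof.\<close>

lemma distributive_interval_cyclic:
  assumes "subgroup K G" "subgroup T G" "K \<subseteq> T"
    and distr: "\<And>U V W. subgroup U G \<Longrightarrow> subgroup V G \<Longrightarrow> subgroup W G \<Longrightarrow> K \<subseteq> U \<Longrightarrow> K \<subseteq> V \<Longrightarrow>
      K \<subseteq> W \<Longrightarrow> U \<subseteq> T \<Longrightarrow> V \<subseteq> T \<Longrightarrow> W \<subseteq> T \<Longrightarrow>
      U \<inter> generate G (V \<union> W) = generate G ((U \<inter> V) \<union> (U \<inter> W))"
  shows "\<exists>t\<in>T. generate G (K \<union> {t}) = T"
proof -
  define F where "F = {U. subgroup U G \<and> K \<subseteq> U \<and> U \<subseteq> T}"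
  let ?J = "\<lambda>U V. generate G (U \<union> V)"
  interpret F: set_lattice F ?J
  proof
    fix A B assume AB: "A \<in> F" "B \<in> F"
    then show "A \<inter> B \<in> F" using subgroup_Int F_def by auto
    show up: "A \<subseteq> ?J A B" "B \<subseteq> ?J A B" using generate_Un_upper by auto
    show "?J A B \<in> F" using AB up generate_Un_subgroup generate_Un_least[OF assms(2)] F_def by auto
    fix C assume "C \<in> F" "A \<subseteq> C" "B \<subseteq> C"
    then show "?J A B \<subseteq> C" using generate_Un_least F_def by auto
  qed
  have dist: "A \<inter> ?J B C = ?J (A \<inter> B) (A \<inter> C)" if "A \<in> F" "B \<in> F" "C \<in> F" for A B C
    using distr that F_def by simp
  define cy where "cy a = generate G (K \<union> {a})" for a
  have sub: "K \<union> {a} \<subseteq> carrier G" if "a \<in> T" for a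
    using subgroup.subset[OF assms(2)] assms(3) that by blast
  have cyF: "cy a \<in> F" "a \<in> cy a" if "a \<in> T" for a
  proof -
    have "subgroup (cy a) G" unfolding cy_def using generate_is_subgroup[OF sub[OF that]] .
    moreover have "cy a \<subseteq> T" unfolding cy_def
        by (rule generate_subgroup_incl[OF _ assms(2)]) (use assms(3) that in auto)
    moreover show "a \<in> cy a" unfolding cy_def by (simp add: generate.incl)
    ultimately show "cy a \<in> F" using F_def cy_def generate_Un_upper(1)[of K "{a}"] by auto
  qed
  have cyle: "cy a \<subseteq> U" if "U \<in> F" "a \<in> U" for a U
    unfolding cy_def by (rule generate_subgroup_incl) (use that F_def in auto)
  have Fsub: "subgroup U G" if "U \<in> F" for U using that F_def by simp
  have fin: "finite U" if "U \<in> F" for U using that F_def finite_subgroup by auto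
  have main: "\<exists>c\<in>T. ?J (cy a) M = cy c" if "M \<in> F" "a \<in> T" for M a
    using that
  proof (induction "card M" arbitrary: M a rule: less_induct)
    case less
    note P = less.prems
    show ?case
    proof (cases "\<exists>b\<in>M. cy b = M")
      case True
      then obtain b where b: "b \<in> M" "cy b = M" by blast
      have bT: "b \<in> T" using b P F_def by auto
      show ?thesis
      proof (cases "M \<subseteq> cy a")
        case True
        then have "?J (cy a) M = cy a"
          by (intro F.jn_eqI) (use cyF P in auto)
        then show ?thesis using P by blast
      next
        case False
        \<comment> \<open>The join of \<open>cy (a \<otimes> b)\<close> with \<open>cy a\<close>,
          and likewise with \<open>M = cy b\<close>, is the join of \<open>cy a\<close> and
          \<open>M\<close>. By dual distributivity this is the join of
          \<open>cy (a \<otimes> b)\<close> with \<open>M \<inter> cy a\<close>, which is smaller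
          than \<open>M\<close>, so that the induction applies to
          \<open>a \<otimes> b\<close>.\<close>
        have ab: "a \<otimes> b \<in> T" using P bT subgroup.m_closed[OF assms(2)] by blast
        have M': "M \<inter> cy a \<in> F" using F.inter_closed P cyF by blast
        have "card (M \<inter> cy a) < card M"
          using False fin[OF P(1)] by (intro psubset_card_mono) auto
        then obtain c where c: "c \<in> T" "?J (cy (a \<otimes> b)) (M \<inter> cy a) = cy c"
          using less(1) M' ab by blast
        have cc: "a \<in> carrier G" "b \<in> carrier G" using sub P bT by auto
        have 1: "?J (cy (a \<otimes> b)) M = ?J (cy a) M"
        proof (rule F.jn_eqI)
          have J: "?J (cy a) M \<in> F" using F.jn_closed cyF P by blast
          have "a \<in> ?J (cy a) M" "b \<in> ?J (cy a) M" using generate_Un_upper cyF P b by blast+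
          then have "a \<otimes> b \<in> ?J (cy a) M" using subgroup.m_closed[OF Fsub[OF J]] by blast
          then show "cy (a \<otimes> b) \<subseteq> ?J (cy a) M" using cyle J by blast
          fix D assume D: "D \<in> F" "cy (a \<otimes> b) \<subseteq> D" "M \<subseteq> D"
          have sD: "subgroup D G" using D F_def by blast
          have "a \<otimes> b \<in> D" "b \<in> D" using D cyF ab b by blast+
          then have "(a \<otimes> b) \<otimes> inv b \<in> D"
              using subgroup.m_closed[OF sD] subgroup.m_inv_closed[OF sD] by blast
          then have "a \<in> D" using cc by (simp add: m_assoc)
          then show "?J (cy a) M \<subseteq> D" using cyle D P cyF F.jn_least by simp
        qed (use cyF ab P F.jn_closed generate_Un_upper in auto)
        have 2: "?J (cy (a \<otimes> b)) (cy a) = ?J (cy a) M"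
        proof (rule F.jn_eqI)
          have J: "?J (cy a) M \<in> F" using F.jn_closed cyF P by blast
          have "a \<in> ?J (cy a) M" "b \<in> ?J (cy a) M" using generate_Un_upper cyF P b by blast+
          then have "a \<otimes> b \<in> ?J (cy a) M" using subgroup.m_closed[OF Fsub[OF J]] by blast
          then show "cy (a \<otimes> b) \<subseteq> ?J (cy a) M" using cyle J by blast
          fix D assume D: "D \<in> F" "cy (a \<otimes> b) \<subseteq> D" "cy a \<subseteq> D"
          have sD: "subgroup D G" using D F_def by blast
          have "a \<otimes> b \<in> D" "a \<in> D" using D cyF ab P by blast+
          then have "inv a \<otimes> (a \<otimes> b) \<in> D"
              using subgroup.m_closed[OF sD] subgroup.m_inv_closed[OF sD] by blast
          then have "b \<in> D" using cc by simp
          then have "M \<subseteq> D" using cyle D b by blast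
          then show "?J (cy a) M \<subseteq> D" using D P cyF F.jn_least by simp
        qed (use cyF ab P F.jn_closed generate_Un_upper in auto)
        have "?J (cy (a \<otimes> b)) (M \<inter> cy a) = ?J (cy (a \<otimes> b)) M \<inter> ?J (cy (a \<otimes> b)) (cy a)"
          by (rule F.jn_dual_distrib[OF dist]) (use cyF ab P in auto)
        then have "?J (cy a) M = cy c" using 1 2 c by simp
        then show ?thesis using c by blast
      qed
    next
      case False
      \<comment> \<open>Now no element generates \<open>M\<close> over \<open>K\<close>. Among the
        \<open>cy c\<close> with \<open>cy a \<subseteq> cy c \<subseteq> J\<close> one of greatest
        order is taken. For \<open>b \<in> M\<close> the subgroup \<open>cy b\<close> is smaller
        than \<open>M\<close>, so by induction the join of \<open>cy c\<close> and
        \<open>cy b\<close> is in the same family, and maximality gives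
        \<open>b \<in> cy c\<close>.\<close>
      define J where "J = ?J (cy a) M"
      have J: "J \<in> F" "cy a \<subseteq> J" "M \<subseteq> J" unfolding J_def using F.jn_closed cyF P generate_Un_upper
          by auto
      define Cs where "Cs = {c \<in> J. cy a \<subseteq> cy c}"
      have "finite Cs" "a \<in> Cs" unfolding Cs_def using fin[OF J(1)] J cyF P by auto
      then have "Max ((\<lambda>d. card (cy d)) ` Cs) \<in> (\<lambda>d. card (cy d)) ` Cs" by (intro Max_in) auto
      then obtain c where c: "c \<in> Cs" "Max ((\<lambda>d. card (cy d)) ` Cs) = card (cy c)" by auto
      have cmax: "card (cy d) \<le> card (cy c)" if "d \<in> Cs" for d
        unfolding c(2)[symmetric] using \<open>finite Cs\<close> that by (intro Max_ge) auto
      have cT: "c \<in> T" and cJ: "c \<in> J" using c Cs_def J F_def by auto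
      have "b \<in> cy c" if b: "b \<in> M" for b
      proof -
        have bT: "b \<in> T" using b P F_def by auto
        have "cy b \<subset> M" using False b cyle P by blast
        then have "card (cy b) < card M" using fin P by (intro psubset_card_mono) auto
        then obtain d where d: "d \<in> T" "?J (cy c) (cy b) = cy d" using less(1) cyF bT cT by blast
        have up: "cy c \<subseteq> cy d" "cy b \<subseteq> cy d" using d generate_Un_upper by metis+
        have "cy d \<subseteq> J" unfolding d(2)[symmetric]
          by (rule F.jn_least[OF cyF(1)[OF cT] cyF(1)[OF bT] J(1) cyle[OF J(1) cJ] cyle[OF J(1)]])
            (use J(3) b in blast)
        then have "d \<in> Cs" using Cs_def up c cyF d by blast
        then have "cy c = cy d" using card_seteq[OF fin[OF cyF(1)[OF d(1)]] up(1)] cmax by blast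
        then show ?thesis using up cyF bT by blast
      qed
      then have Mle: "M \<subseteq> cy c" by blast
      have "J = cy c"
      proof
        show "cy c \<subseteq> J" by (rule cyle[OF J(1) cJ])
        show "J \<subseteq> cy c" unfolding J_def
          by (rule F.jn_least[OF cyF(1)[OF P(2)] P(1) cyF(1)[OF cT] _ Mle]) (use c(1) Cs_def in
              blast)
      qed
      then show ?thesis using cT J_def by blast
    qed
  qed
  have T: "T \<in> F" "\<one> \<in> T" using F_def assms subgroup.one_closed by auto
  then obtain c where c: "c \<in> T" "?J (cy \<one>) T = cy c" using main by blast
  have "?J (cy \<one>) T = T" by (rule F.jn_eqI) (use T cyF F_def in auto)
  then show ?thesis using c cy_def by auto
qed

text \<open>\<open>K\<close> is normal in \<open>T\<close>, and \<open>T\<close> is generated by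
  \<open>K\<close> and one element; so \<open>T/K\<close> is cyclic and in particular
  abelian.\<close>

lemma distributive_interval_commutator:
  assumes "subgroup K G" "subgroup T G" "K \<subseteq> T" "normalizes G T K"
    and "\<And>U V W. subgroup U G \<Longrightarrow> subgroup V G \<Longrightarrow> subgroup W G \<Longrightarrow> K \<subseteq> U \<Longrightarrow> K \<subseteq> V \<Longrightarrow>
      K \<subseteq> W \<Longrightarrow> U \<subseteq> T \<Longrightarrow> V \<subseteq> T \<Longrightarrow> W \<subseteq> T \<Longrightarrow>
      U \<inter> generate G (V \<union> W) = generate G ((U \<inter> V) \<union> (U \<inter> W))"
    and "x \<in> T" "y \<in> T"
  shows "commutator x y \<in> K"
proof -
  obtain t where t: "t \<in> T" "generate G (K \<union> {t}) = T"
    using distributive_interval_cyclic[OF assms(1-3,5)] by blast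
  have Tc: "T \<subseteq> carrier G" using subgroup.subset[OF assms(2)] .
  then have tc: "t \<in> carrier G" using t by blast
  show ?thesis
  proof (rule commutator_all_generate[OF assms(1)])
    show "K \<union> {t} \<subseteq> carrier G" using assms(3) t Tc by blast
    fix q r assume q: "q \<in> K \<union> {t}" "r \<in> K \<union> {t}"
    then have T: "q \<in> T" "r \<in> T" using assms(3) t by auto
    consider "q \<in> K" | "r \<in> K" | "q = t" "r = t" using q by blast
    then show "commutator q r \<in> K"
    proof cases
      case 1 then show ?thesis using commutator_normalizes(1)[OF assms(1) Tc assms(4)] T by blast
    next
      case 2 then show ?thesis using commutator_normalizes(2)[OF assms(1) Tc assms(4)] T by blast
    next
      case 3 then show ?thesis using commutator_one(2)[OF tc] subgroup.one_closed[OF assms(1)]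
          by simp
    qed
  qed (use t assms(4,6,7) in auto)
qed

end

section \<open>Sections and factor groups\<close>

context group
begin

lemma normalizes_set_mult_subset:
  assumes "subgroup A G" "subgroup B G" "normalizes G A B"
  shows "subgroup (A <#> B) G" "A <#> B = B <#> A"
  using normalizes_set_mult_subgroup[OF assms(2,1,3)] normalizes_set_mult_commute[OF assms(2,1,3)]
      by auto

lemma normal_set_mult_normal:
  assumes "N \<lhd> G" "M \<lhd> G" shows "(N <#> M) \<lhd> G"
proof -
  have s: "subgroup N G" "subgroup M G" "normalizes G (carrier G) N" "normalizes G (carrier G) M"
    using assms normal_iff_normalizes by auto
  have "normalizes G N M" using s(4) subgroup.subset[OF s(1)] normalizes_mono by blast
  then have "subgroup (N <#> M) G" using normalizes_set_mult_subset s by blast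
  moreover have "normalizes G (carrier G) (N <#> M)"
      using normalizes_set_mult[OF s(1,2) subset_refl s(3,4)] .
  ultimately show ?thesis using normal_iff_normalizes by blast
qed

lemma normal_commute:
  assumes "N \<lhd> G" "subgroup A G"
  shows "N <#> A = A <#> N" "subgroup (N <#> A) G" "subgroup (A <#> N) G"
proof -
  have "normalizes G A N" using normal_normalizes[OF assms(1) subgroup.subset[OF assms(2)]] .
  then show "N <#> A = A <#> N" "subgroup (N <#> A) G" "subgroup (A <#> N) G"
    using normalizes_set_mult_commute[OF normal_imp_subgroup[OF assms(1)] assms(2)]
      normalizes_set_mult_subgroup[OF normal_imp_subgroup[OF assms(1)] assms(2)] by auto
qed

definition normal_core :: "'a set \<Rightarrow> 'a set" where
  "normal_core A = {a \<in> carrier G. \<forall>g\<in>carrier G. conjugate G g a \<in> A}"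

lemma normal_core_subset: "normal_core A \<subseteq> A"
proof
  fix a assume "a \<in> normal_core A"
  then have "a \<in> carrier G" "conjugate G \<one> a \<in> A" unfolding normal_core_def using one_closed
      by blast+
  then show "a \<in> A" by simp
qed

lemma normal_core_normal:
  assumes "subgroup A G" shows "normal_core A \<lhd> G"
  unfolding normal_iff_normalizes
proof
  interpret A: subgroup A G by fact
  show "subgroup (normal_core A) G"
    by (rule subgroupI) (auto simp: normal_core_def conjugate_inv conjugate_mult intro!: exI[of _
        \<one>])
  show "normalizes G (carrier G) (normal_core A)"
    unfolding normalizes_def normal_core_def by (auto simp: conjugate_conjugate)
qed

lemma normal_restrict_iff:
  assumes "subgroup A G" "subgroup E G" "E \<subseteq> A"
  shows "E \<lhd> G\<lparr>carrier := A\<rparr> \<longleftrightarrow> normalizes G A E"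
proof -
  interpret A: group "G\<lparr>carrier := A\<rparr>" using subgroup_imp_group assms by blast
  have "subgroup E (G\<lparr>carrier := A\<rparr>)" using subgroup_incl assms by blast
  moreover have "conjugate (G\<lparr>carrier := A\<rparr>) x e = conjugate G x e" if "x \<in> A" for x e
    using m_inv_consistent[OF assms(1) that] by (simp add: conjugate_def)
  ultimately show ?thesis unfolding A.normal_iff_normalizes normalizes_def by simp
qed

lemma section_carrier: "carrier (section_group G A E) = (\<lambda>a. E #> a) ` A"
  unfolding section_group_def carrier_FactGroup by simp

lemma section_mult:
  assumes "subgroup A G" "subgroup E G" "E \<subseteq> A" "normalizes G A E" "a \<in> A" "b \<in> A"
  shows "(E #> a) \<otimes>\<^bsub>section_group G A E\<^esub> (E #> b) = E #> (a \<otimes> b)"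
proof -
  have "E \<lhd> G\<lparr>carrier := A\<rparr>" using normal_restrict_iff assms by blast
  then have "(E #>\<^bsub>G\<lparr>carrier := A\<rparr>\<^esub> a) <#>\<^bsub>G\<lparr>carrier := A\<rparr>\<^esub> (E #>\<^bsub>G\<lparr>carrier := A\<rparr>\<^esub> b)
      = E #>\<^bsub>G\<lparr>carrier := A\<rparr>\<^esub> (a \<otimes>\<^bsub>G\<lparr>carrier := A\<rparr>\<^esub> b)"
    by (rule normal.rcos_sum) (use assms in auto)
  then show ?thesis unfolding section_group_def by simp
qed

lemma rcos_eq_iff:
  assumes "subgroup E G" "x \<in> carrier G" "y \<in> carrier G"
  shows "E #> x = E #> y \<longleftrightarrow> x \<otimes> inv y \<in> E"
proof -
  have "E #> x = E #> y \<longleftrightarrow> x \<in> E #> y"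
    using repr_independence[of x E y] rcos_self assms by metis
  then show ?thesis using subgroup.rcos_module[OF assms(1) is_group assms(3,2)] by simp
qed

lemma section_conj_rcos:
  assumes "subgroup E G" "a \<in> carrier G" "x \<in> carrier G" "normalizes G {x} E"
  shows "section_conj G E (E #> a) x = E #> conjugate G x a"
proof -
  have *: "E #> conjugate G x h = E #> conjugate G x a" if "h \<in> E #> a" for h
  proof -
    obtain e where e: "e \<in> E" "h = e \<otimes> a" using \<open>h \<in> E #> a\<close> unfolding r_coset_def by blast
    have c: "e \<in> carrier G" using e subgroup.mem_carrier[OF assms(1)] by blast
    then have "conjugate G x h \<otimes> inv (conjugate G x a) = conjugate G x e"
      using e assms by (simp add: conjugate_mult m_assoc)
    moreover have "conjugate G x e \<in> E" using normalizesD[OF assms(4)] e by simp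
    ultimately show ?thesis using rcos_eq_iff[OF assms(1)] c e assms by simp
  qed
  have "a \<in> E #> a" using rcos_self assms by blast
  then show ?thesis unfolding section_conj_def conjugate_def[symmetric] using * by blast
qed

text \<open>The isomorphism sends \<open>Ea\<close> to the coset \<open>Eb\<close> with \<open>Ca = Cb\<close>.\<close>

lemma diamond_sections_isomorphic:
  assumes "subgroup A G" "subgroup B G" "subgroup C G" "subgroup E G"
    and "A \<inter> C = E" "B \<inter> C = E" "A \<subseteq> C <#> B" "B \<subseteq> C <#> A"
    and "normalizes G A E" "normalizes G B E" "normalizes G A C"
    and "Op \<subseteq> carrier G" "normalizes G Op A" "normalizes G Op B" "normalizes G Op C"
  shows "operator_isomorphic_sections G Op A E B E"
proof -
  interpret A: subgroup A G by fact
  interpret B: subgroup B G by fact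
  interpret C: subgroup C G by fact
  interpret E: subgroup E G by fact
  have EA: "E \<subseteq> A" and EB: "E \<subseteq> B" and EC: "E \<subseteq> C" using assms(5,6) by auto
  \<comment> \<open>This form needs no choice of representatives: on \<open>E #> a\<close> it gives
    the elements of \<open>B\<close> in the coset of \<open>C\<close> containing \<open>a\<close>,
    and these form one coset of \<open>B \<inter> C = E\<close>.\<close>
  define \<phi> where "\<phi> V = (C <#> V) \<inter> B" for V
  have \<phi>: "\<phi> (E #> a) = E #> b" if "a \<in> A" "b \<in> B" "b \<otimes> inv a \<in> C" for a b
  proof
    show "\<phi> (E #> a) \<subseteq> E #> b"
    proof
      fix z assume z: "z \<in> \<phi> (E #> a)"
      then have "z \<in> C <#> (E #> a)" and zB: "z \<in> B" unfolding \<phi>_def by auto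
      from this(1) obtain c w where c: "c \<in> C" "w \<in> E #> a" "z = c \<otimes> w" by (rule set_multE)
      then obtain e where e: "e \<in> E" "w = e \<otimes> a" unfolding r_coset_def by blast
      have "z \<otimes> inv b = (c \<otimes> e) \<otimes> inv (b \<otimes> inv a)"
        using c e that by (simp add: m_assoc inv_mult_group)
      moreover have "c \<otimes> e \<in> C" using c(1) e(1) EC C.m_closed by blast
      ultimately have "z \<otimes> inv b \<in> C" using that(3) by simp
      moreover have "z \<otimes> inv b \<in> B" using zB that(2) by simp
      ultimately have "z \<otimes> inv b \<in> E" using assms(6) by blast
      then show "z \<in> E #> b" using E.rcos_module[OF is_group] zB that by simp
    qed
    show "E #> b \<subseteq> \<phi> (E #> a)"
    proof
      fix z assume "z \<in> E #> b"
      then obtain e where e: "e \<in> E" "z = e \<otimes> b" unfolding r_coset_def by blast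
      have "z = (e \<otimes> (b \<otimes> inv a)) \<otimes> a" using e that by (simp add: m_assoc)
      moreover have "e \<otimes> (b \<otimes> inv a) \<in> C" using e(1) EC that(3) C.m_closed by blast
      moreover have "a \<in> E #> a" using rcos_self that assms(4) by simp
      ultimately have "z \<in> C <#> (E #> a)" using set_multI by blast
      moreover have "z \<in> B" using e(1) e(2) EB that(2) B.m_closed by blast
      ultimately show "z \<in> \<phi> (E #> a)" unfolding \<phi>_def by blast
    qed
  qed
  have exb: "\<exists>b\<in>B. b \<otimes> inv a \<in> C" if "a \<in> A" for a
  proof -
    have "a \<in> C <#> B" using that assms(7) by blast
    then obtain c b where c: "c \<in> C" "b \<in> B" "a = c \<otimes> b" by (rule set_multE)
    then have "b \<otimes> inv a = inv c" by (simp add: inv_mult_group)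
    then show ?thesis using c C.m_inv_closed by metis
  qed
  have exa: "\<exists>a\<in>A. b \<otimes> inv a \<in> C" if "b \<in> B" for b
  proof -
    have "b \<in> C <#> A" using that assms(8) by blast
    then obtain c a where c: "c \<in> C" "a \<in> A" "b = c \<otimes> a" by (rule set_multE)
    then have "b \<otimes> inv a = c" by (simp add: m_assoc)
    then show ?thesis using c by metis
  qed
  have iso: "\<phi> \<in> iso (section_group G A E) (section_group G B E)"
    unfolding iso_def
  proof (intro CollectI conjI)
    show "\<phi> \<in> hom (section_group G A E) (section_group G B E)"
    proof (rule homI)
      fix V assume "V \<in> carrier (section_group G A E)"
      then obtain a where a: "a \<in> A" "V = E #> a" unfolding section_carrier by blast
      then show "\<phi> V \<in> carrier (section_group G B E)"
        using exb[OF a(1)] \<phi> unfolding section_carrier by blast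
      fix W assume "W \<in> carrier (section_group G A E)"
      then obtain a' where a': "a' \<in> A" "W = E #> a'" unfolding section_carrier by blast
      obtain b where b: "b \<in> B" "b \<otimes> inv a \<in> C" using exb a by blast
      obtain b' where b': "b' \<in> B" "b' \<otimes> inv a' \<in> C" using exb a' by blast
      \<comment> \<open>Multiplicativity is where \<open>A\<close> has to normalize
        \<open>C\<close>.\<close>
      have "(b \<otimes> b') \<otimes> inv (a \<otimes> a') = (b \<otimes> inv a) \<otimes> conjugate G (inv a) (b' \<otimes> inv a')"
        using a a' b b' by (simp add: m_assoc inv_mult_group conjugate_def)
      moreover have "conjugate G (inv a) (b' \<otimes> inv a') \<in> C"
        using normalizesD[OF assms(11) A.m_inv_closed[OF a(1)] b'(2)] .
      ultimately have "(b \<otimes> b') \<otimes> inv (a \<otimes> a') \<in> C" using b(2) C.m_closed by simp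
      then have "\<phi> (E #> (a \<otimes> a')) = E #> (b \<otimes> b')" using \<phi> a a' b b' by simp
      then show "\<phi> (V \<otimes>\<^bsub>section_group G A E\<^esub> W) = \<phi> V \<otimes>\<^bsub>section_group G B E\<^esub> \<phi> W"
        using section_mult[OF assms(1,4) EA assms(9) a(1) a'(1)]
          section_mult[OF assms(2,4) EB assms(10) b(1) b'(1)]
          \<phi>[OF a(1) b] \<phi>[OF a'(1) b'] a a' by simp
    qed
    show "bij_betw \<phi> (carrier (section_group G A E)) (carrier (section_group G B E))"
      unfolding bij_betw_def
    proof
      show "inj_on \<phi> (carrier (section_group G A E))"
      proof (rule inj_onI)
        fix V W assume VW: "V \<in> carrier (section_group G A E)" "W \<in> carrier (section_group G A E)"
          "\<phi> V = \<phi> W"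
        obtain a where a: "a \<in> A" "V = E #> a" using VW(1) unfolding section_carrier by blast
        obtain a' where a': "a' \<in> A" "W = E #> a'" using VW(2) unfolding section_carrier by blast
        obtain b where b: "b \<in> B" "b \<otimes> inv a \<in> C" using exb a by blast
        obtain b' where b': "b' \<in> B" "b' \<otimes> inv a' \<in> C" using exb a' by blast
        have "E #> b = E #> b'" using VW(3) \<phi>[OF a(1) b] \<phi>[OF a'(1) b'] a a' by simp
        then have "b \<otimes> inv b' \<in> E" using rcos_eq_iff[OF assms(4)] b b' by simp
        then have bb: "b \<otimes> inv b' \<in> C" using EC by blast
        have "a \<otimes> inv a' = inv (b \<otimes> inv a) \<otimes> (b \<otimes> inv b') \<otimes> (b' \<otimes> inv a')"
          using a a' b b' by (simp add: m_assoc inv_mult_group)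
        then have "a \<otimes> inv a' \<in> C" using bb b(2) b'(2) by simp
        moreover have "a \<otimes> inv a' \<in> A" using a a' by simp
        ultimately have "a \<otimes> inv a' \<in> E" using assms(5) by blast
        then show "V = W" using rcos_eq_iff[OF assms(4)] a a' by simp
      qed
      show "\<phi> ` carrier (section_group G A E) = carrier (section_group G B E)"
      proof
        show "\<phi> ` carrier (section_group G A E) \<subseteq> carrier (section_group G B E)"
        proof clarify
          fix V assume "V \<in> carrier (section_group G A E)"
          then obtain a where a: "a \<in> A" "V = E #> a" unfolding section_carrier by blast
          then show "\<phi> V \<in> carrier (section_group G B E)"
            using exb[OF a(1)] \<phi> unfolding section_carrier by blast
        qed
        show "carrier (section_group G B E) \<subseteq> \<phi> ` carrier (section_group G A E)"
        proof
          fix W assume "W \<in> carrier (section_group G B E)"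
          then obtain b where b: "b \<in> B" "W = E #> b" unfolding section_carrier by blast
          obtain a where a: "a \<in> A" "b \<otimes> inv a \<in> C" using exa b by blast
          then have "W = \<phi> (E #> a)" using \<phi>[OF a(1) b(1) a(2)] b by simp
          then show "W \<in> \<phi> ` carrier (section_group G A E)" using a unfolding section_carrier
              by blast
        qed
      qed
    qed
  qed
  have "\<phi> (section_conj G E V x) = section_conj G E (\<phi> V) x"
    if V: "V \<in> carrier (section_group G A E)" and x: "x \<in> Op" for V x
  proof -
    obtain a where a: "a \<in> A" "V = E #> a" using V unfolding section_carrier by blast
    obtain b where b: "b \<in> B" "b \<otimes> inv a \<in> C" using exb a by blast
    have xc: "x \<in> carrier G" using x assms(12) by blast
    have "normalizes G Op E" using normalizes_Int[OF assms(13,15)] assms(5) by simp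
    then have nE: "normalizes G {x} E" using x normalizes_mono by blast
    have xa: "conjugate G x a \<in> A" "conjugate G x b \<in> B"
        using normalizesD[OF assms(13) x a(1)] normalizesD[OF assms(14) x b(1)] by auto
    have "conjugate G x b \<otimes> inv (conjugate G x a) = conjugate G x (b \<otimes> inv a)"
      using a b xc by (simp add: conjugate_mult conjugate_inv)
    then have "conjugate G x b \<otimes> inv (conjugate G x a) \<in> C" using normalizesD[OF assms(15) x b(2)]
        by simp
    then have "\<phi> (E #> conjugate G x a) = E #> conjugate G x b" using \<phi> xa by blast
    then show ?thesis
      using section_conj_rcos[OF assms(4) _ xc nE] \<phi>[OF a(1) b] a b by simp
  qed
  then show ?thesis unfolding operator_isomorphic_sections_def using iso by blast
qed

end

section \<open>Factor groups\<close>

locale fin_quot = fin_group +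
  fixes R assumes R: "R \<lhd> G"
begin

definition quot :: "'a \<Rightarrow> 'a set" where "quot x = R #> x"

abbreviation Q where "Q \<equiv> G Mod R"

lemma R_sub: "subgroup R G" "R \<subseteq> carrier G"
  using R normal_imp_subgroup subgroup.subset by blast+

lemma Q_group: "group Q" using normal.factorgroup_is_group[OF R] .

lemma quot_hom: "group_hom G Q quot"
proof -
  have "quot \<in> hom G Q" unfolding quot_def using normal.r_coset_hom_Mod[OF R] .
  then show ?thesis using Q_group group_hom.intro[OF is_group Q_group] group_hom_axioms_def by blast
qed

lemma Q_carrier: "carrier Q = quot ` carrier G"
  unfolding quot_def carrier_FactGroup ..

lemma Q_fin: "fin_group Q"
  using Q_group Q_carrier fin by (simp add: fin_group_def fin_group_axioms_def)

lemma quot_eq_iff: "x \<in> carrier G \<Longrightarrow> y \<in> carrier G \<Longrightarrow> quot x = quot y \<longleftrightarrow> x \<otimes> inv y \<in> R"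
  unfolding quot_def using rcos_eq_iff R_sub by blast

lemma quot_mem_iff:
  assumes "subgroup A G" "R \<subseteq> A" "x \<in> carrier G"
  shows "quot x \<in> quot ` A \<longleftrightarrow> x \<in> A"
proof
  assume "quot x \<in> quot ` A"
  then obtain a where a: "a \<in> A" "quot x = quot a" by blast
  have ac: "a \<in> carrier G" using a subgroup.mem_carrier[OF assms(1)] by blast
  then have "x \<otimes> inv a \<in> A" using quot_eq_iff assms a by auto
  then have "x \<otimes> inv a \<otimes> a \<in> A" using a subgroup.m_closed[OF assms(1)] by blast
  then show "x \<in> A" using ac assms by (simp add: m_assoc)
qed simp

lemma quot_image_subset_iff:
  assumes "subgroup A G" "R \<subseteq> A" "B \<subseteq> carrier G"
  shows "quot ` B \<subseteq> quot ` A \<longleftrightarrow> B \<subseteq> A"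
  using quot_mem_iff[OF assms(1,2)] assms(3) by blast

lemma quot_image_eq_iff:
  assumes "subgroup A G" "R \<subseteq> A" "subgroup B G" "R \<subseteq> B"
  shows "quot ` A = quot ` B \<longleftrightarrow> A = B"
  using quot_image_subset_iff[OF assms(1,2) subgroup.subset[OF assms(3)]]
    quot_image_subset_iff[OF assms(3,4) subgroup.subset[OF assms(1)]] by blast

lemma quot_image_Int:
  assumes "subgroup A G" "R \<subseteq> A" "subgroup B G" "R \<subseteq> B"
  shows "quot ` (A \<inter> B) = quot ` A \<inter> quot ` B"
proof
  show "quot ` A \<inter> quot ` B \<subseteq> quot ` (A \<inter> B)"
  proof
    fix v assume "v \<in> quot ` A \<inter> quot ` B"
    then obtain a where a: "a \<in> A" "v = quot a" "quot a \<in> quot ` B" by blast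
    then have "a \<in> B" using quot_mem_iff[OF assms(3,4)] subgroup.mem_carrier[OF assms(1)] by blast
    then show "v \<in> quot ` (A \<inter> B)" using a by blast
  qed
qed blast

lemma quot_subgroup: "subgroup A G \<Longrightarrow> subgroup (quot ` A) Q"
  using group_hom.subgroup_img_is_subgroup[OF quot_hom] .

lemma quot_conjugate: "x \<in> carrier G \<Longrightarrow> a \<in> carrier G \<Longrightarrow> conjugate Q (quot x) (quot a) = quot
    (conjugate G x a)"
  unfolding conjugate_def using group_hom.hom_inv[OF quot_hom] group_hom.hom_mult[OF quot_hom]
      by simp

lemma quot_normalizes:
  assumes "V \<subseteq> carrier G" "A \<subseteq> carrier G" "normalizes G V A"
  shows "normalizes Q (quot ` V) (quot ` A)"
  unfolding normalizes_def
proof (intro ballI)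
  fix x a assume "x \<in> quot ` V" "a \<in> quot ` A"
  then obtain y b where y: "y \<in> V" "x = quot y" "b \<in> A" "a = quot b" by blast
  then have "conjugate Q x a = quot (conjugate G y b)" using quot_conjugate assms by blast
  then show "conjugate Q x a \<in> quot ` A" using normalizesD[OF assms(3) y(1,3)] by simp
qed

lemma quot_normal: "N \<lhd> G \<Longrightarrow> quot ` N \<lhd> Q"
  unfolding normal_iff_normalizes group.normal_iff_normalizes[OF Q_group] Q_carrier
  using quot_subgroup quot_normalizes[OF subset_refl subgroup.subset] by blast

lemma quot_set_mult: "A \<subseteq> carrier G \<Longrightarrow> B \<subseteq> carrier G \<Longrightarrow> quot ` (A <#> B) = quot ` A <#>\<^bsub>Q\<^esub> quot ` B"
  using set_mult_hom[OF group_hom.homh[OF quot_hom]] .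

lemma quot_generate: "S \<subseteq> carrier G \<Longrightarrow> quot ` generate G S = generate Q (quot ` S)"
  using group_hom.generate_img[OF quot_hom] by simp

lemma card_quot:
  assumes "subgroup A G" "R \<subseteq> A" shows "card (quot ` A) * card R = card A"
proof -
  interpret A: group "G\<lparr>carrier := A\<rparr>" using subgroup_imp_group assms by blast
  have "subgroup R (G\<lparr>carrier := A\<rparr>)" using subgroup_incl[OF R_sub(1) assms] .
  then have "card (rcosets\<^bsub>G\<lparr>carrier := A\<rparr>\<^esub> R) * card R = order (G\<lparr>carrier := A\<rparr>)"
    by (rule A.lagrange)
  moreover have "rcosets\<^bsub>G\<lparr>carrier := A\<rparr>\<^esub> R = quot ` A"
    unfolding RCOSETS_def quot_def by auto
  ultimately show ?thesis by (simp add: order_def)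
qed

lemma pi_index_quot:
  assumes "subgroup A G" "R \<subseteq> A" "subgroup B G" "R \<subseteq> B"
  shows "pi_index \<pi> (quot ` A) (quot ` B) \<longleftrightarrow> pi_index \<pi> A B"
proof -
  have "card (quot ` B) = n * card (quot ` A) \<longleftrightarrow> card B = n * card A" for n
    unfolding card_quot[OF assms(1,2), symmetric] card_quot[OF assms(3,4), symmetric]
    using card_subgroup_pos[OF R_sub(1)] by simp
  then show ?thesis unfolding pi_index_def by simp
qed

lemma quot_R: "quot ` R = {\<one>\<^bsub>Q\<^esub>}"
proof -
  have "quot r = R" if "r \<in> R" for r
    unfolding quot_def using coset_join2[OF _ R_sub(1) that] that R_sub(2) by blast
  then show ?thesis using subgroup.one_closed[OF R_sub(1)] by auto
qed

lemma pi_number_quot: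
  assumes "subgroup A G" "R \<subseteq> A"
  shows "pi_number \<pi> (card (quot ` A)) \<longleftrightarrow> pi_index \<pi> R A"
proof -
  have "pi_index \<pi> R A \<longleftrightarrow> pi_index \<pi> (quot ` R) (quot ` A)"
    using pi_index_quot[OF R_sub(1) subset_refl assms] by simp
  also have "\<dots> \<longleftrightarrow> pi_number \<pi> (card (quot ` A))" unfolding quot_R pi_index_def by simp
  finally show ?thesis by simp
qed

lemma quot_image_mult_R:
  assumes "subgroup A G" shows "quot ` (A <#> R) = quot ` A"
proof
  have "R \<subseteq> carrier G" "A \<subseteq> carrier G" using R_sub subgroup.subset[OF assms] by auto
  show "quot ` A \<subseteq> quot ` (A <#> R)" using set_mult_upper(1)[OF assms R_sub(1)] by blast
  show "quot ` (A <#> R) \<subseteq> quot ` A"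
  proof clarify
    fix z assume "z \<in> A <#> R"
    then obtain a r where z: "a \<in> A" "r \<in> R" "z = a \<otimes> r" by (rule set_multE)
    have c: "a \<in> carrier G" "r \<in> carrier G" using z \<open>R \<subseteq> _\<close> \<open>A \<subseteq> _\<close> by auto
    have "z \<otimes> inv a \<in> R" using z c normal.inv_op_closed2[OF R] by simp
    then have "quot z = quot a" using quot_eq_iff z c by simp
    then show "quot z \<in> quot ` A" using z by blast
  qed
qed

lemma hall_quot:
  assumes "hall_subgroup G \<pi> H" shows "hall_subgroup Q \<pi> (quot ` H)"
proof -
  interpret Q: fin_group Q using Q_fin .
  have H: "subgroup H G" using hallD(1) assms .
  have HR: "subgroup (H <#> R) G" "R \<subseteq> H <#> R" "H \<subseteq> H <#> R"
    using normal_commute(3)[OF R H] set_mult_upper[OF H R_sub(1)] by auto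
  have "pi_index \<pi> (H \<inter> R) H"
    using pi_index_card[OF subgroup_Int[OF H R_sub(1)] H _ hallD(2)[OF assms]] by blast
  then have "pi_index \<pi> R (H <#> R)" using pi_index_set_mult_iff[OF H R_sub(1)] by simp
  then have 1: "pi_number \<pi> (card (quot ` H))"
    using pi_number_quot[OF HR(1,2)] quot_image_mult_R[OF H] by simp
  have "pi_index (- \<pi>) (H <#> R) (carrier G)"
    using pi_index_split(2)[OF H HR(1) subgroup_self HR(3) subgroup.subset[OF HR(1)] hallD(3)[OF
        assms]] .
  then have "pi_index (- \<pi>) (quot ` (H <#> R)) (quot ` carrier G)"
    using pi_index_quot[OF HR(1,2) subgroup_self R_sub(2)] by simp
  then show ?thesis
    unfolding Q.hall_subgroup_iff Q_carrier using 1 quot_subgroup[OF H] quot_image_mult_R[OF H]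
        by simp
qed

definition preimage :: "'a set set \<Rightarrow> 'a set" where "preimage V = {x \<in> carrier G. quot x \<in> V}"

lemma preimage_subgroup: "subgroup V Q \<Longrightarrow> subgroup (preimage V) G"
proof -
  assume V: "subgroup V Q"
  interpret p: group_hom G Q quot using quot_hom .
  interpret V: subgroup V Q by fact
  show "subgroup (preimage V) G"
    by (rule subgroupI)
      (auto simp: preimage_def p.hom_inv p.hom_mult V.one_closed[simplified] V.m_closed[simplified]
        intro!: exI[of _ \<one>])
qed

lemma R_le_preimage: assumes "subgroup V Q" shows "R \<subseteq> preimage V"
proof
  fix r assume r: "r \<in> R"
  then have "quot r = \<one>\<^bsub>Q\<^esub>" using quot_R by blast
  then show "r \<in> preimage V" unfolding preimage_def using subgroup.one_closed[OF assms] r R_sub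
      by auto
qed

lemma quot_preimage: assumes "V \<subseteq> carrier Q" shows "quot ` preimage V = V"
  using assms unfolding preimage_def Q_carrier by blast

lemma preimage_quot: assumes "subgroup A G" "R \<subseteq> A" shows "preimage (quot ` A) = A"
  unfolding preimage_def using quot_mem_iff[OF assms] subgroup.subset[OF assms(1)] by blast

lemma preimage_Int: "preimage (V \<inter> W) = preimage V \<inter> preimage W"
  unfolding preimage_def by blast

lemma preimage_generate:
  assumes "subgroup V Q" "subgroup W Q"
  shows "preimage (generate Q (V \<union> W)) = generate G (preimage V \<union> preimage W)"
proof -
  have s: "subgroup (preimage V) G" "subgroup (preimage W) G" using preimage_subgroup assms by auto
  have c: "preimage V \<union> preimage W \<subseteq> carrier G" unfolding preimage_def by blast
  have "quot ` generate G (preimage V \<union> preimage W) = generate Q (V \<union> W)"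
    using quot_generate[OF c] quot_preimage subgroup.subset assms by (metis image_Un)
  moreover have "R \<subseteq> generate G (preimage V \<union> preimage W)"
    using R_le_preimage[OF assms(1)] generate_Un_upper(1) by blast
  ultimately show ?thesis using preimage_quot[OF generate_Un_subgroup[OF s]] by simp
qed

end

locale sigma_quot = sigma_group + fin_quot
begin

sublocale Qs: sigma_group "G Mod R" I \<sigma>
proof -
  interpret Q: fin_group "G Mod R" using Q_fin .
  show "sigma_group (G Mod R) I \<sigma>"
    by unfold_locales (use partition hall_ex hall_quot in blast)+
qed

text \<open>Hall subgroups of \<open>G\<close> have Hall images in \<open>G/R\<close>, so the
  equality of products holds there. It lifts because the preimage contains \<open>R\<close> and
  absorbs the ambiguity.\<close>

lemma preimage_permutable: assumes "Qs.permutable V" shows "permutable (preimage V)"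
  unfolding permutable_def
proof (intro conjI ballI allI impI)
  have V: "subgroup V Q" using Qs.permutableD(1) assms .
  show s: "subgroup (preimage V) G" using preimage_subgroup V .
  fix i H assume H: "i \<in> I" "hall_subgroup G (\<sigma> i) H"
  have sH: "subgroup H G" using hallD(1) H by blast
  have c: "preimage V \<subseteq> carrier G" "H \<subseteq> carrier G" using subgroup.subset s sH by auto
  have eq: "V <#>\<^bsub>Q\<^esub> quot ` H = quot ` H <#>\<^bsub>Q\<^esub> V"
      using Qs.permutableD(2)[OF assms H(1) hall_quot[OF H(2)]] .
  have VQ: "quot ` preimage V = V" using quot_preimage subgroup.subset[OF V] by blast
  have "H <#> preimage V \<subseteq> preimage V <#> H"
  proof
    fix z assume z: "z \<in> H <#> preimage V"
    then have zc: "z \<in> carrier G" using set_mult_closed[OF c(2,1)] by blast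
    have "quot z \<in> quot ` (H <#> preimage V)" using z by blast
    then have "quot z \<in> quot ` (preimage V <#> H)"
      using quot_set_mult[OF c] quot_set_mult[OF c(2,1)] eq VQ by simp
    then obtain w where w: "w \<in> preimage V <#> H" "quot z = quot w" by blast
    then obtain v h where v: "v \<in> preimage V" "h \<in> H" "w = v \<otimes> h" by (blast elim: set_multE)
    have cc: "v \<in> carrier G" "h \<in> carrier G" using v c by auto
    have r: "z \<otimes> inv w \<in> R" using quot_eq_iff zc w v cc by simp
    then have "z \<otimes> inv w \<otimes> v \<in> preimage V"
      using R_le_preimage[OF V] v subgroup.m_closed[OF s] by blast
    moreover have "z = (z \<otimes> inv w \<otimes> v) \<otimes> h" using zc v cc by (simp add: m_assoc inv_mult_group)
    ultimately show "z \<in> preimage V <#> H" using v set_multI by metis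
  qed
  then show "preimage V <#> H = H <#> preimage V" using set_mult_commuteI[OF s sH] by simp
qed

end

section \<open>Diamonds of permutable subgroups\<close>

lemma (in group) set_mult_commute_eq:
  assumes "subgroup A G" "subgroup B G" "A <#> B = T" "subgroup T G" shows "B <#> A = T"
  using subgroup_set_mult_commute[OF assms(1,2)] assms(3,4) by metis

context sigma_group
begin

text \<open>The set \<open>Z\<close> of the elements in question is invariant under the Hall subgroups for \<open>k \<noteq> j\<close>,
  which generate \<open>sigma_residual j\<close>, while a Hall subgroup \<open>K\<close> for \<open>j\<close> conjugates it into \<open>A\<close>; and
  \<open>G = sigma_residual j K\<close>.\<close>

lemma hall_parts_hall_join_normal_core:
  assumes "permutable A" "j \<in> I" "k \<in> I" "k \<noteq> j"
  shows "hall_parts k (hall_join j A) \<subseteq> normal_core A"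
proof
  fix z0 assume z0: "z0 \<in> hall_parts k (hall_join j A)"
  define Z where "Z = (\<Union>k\<in>I - {j}. hall_parts k (hall_join j A))"
  have sA: "subgroup A G" using permutableD(1) assms(1) .
  have Zc: "Z \<subseteq> carrier G" unfolding Z_def using hall_parts_subset(2) by blast
  have "normalizes G (\<Union>i\<in>I - {j}. \<Union>{H. hall_subgroup G (\<sigma> i) H}) Z"
    unfolding normalizes_def
  proof (intro ballI)
    fix y z assume y: "y \<in> (\<Union>i\<in>I - {j}. \<Union>{H. hall_subgroup G (\<sigma> i) H})" and z: "z \<in> Z"
    obtain m H where H: "m \<in> I" "m \<noteq> j" "hall_subgroup G (\<sigma> m) H" "y \<in> H" using y by blast
    obtain l P where P: "l \<in> I" "l \<noteq> j" "hall_subgroup G (\<sigma> l) P" "z \<in> P" "z \<in> hall_join j A"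
      using z unfolding Z_def hall_parts_def by blast
    have "y \<in> carrier G" using y sigma_residual_gens by blast
    then have "hall_subgroup G (\<sigma> l) (conjugate G y ` P)" using hall_conjugate P by blast
    moreover have "conjugate G y z \<in> hall_join j A"
      using normalizesD[OF hall_join_normalizes_hall[OF assms(1) H(1) assms(2) H(2,3)] H(4) P(5)] .
    ultimately show "conjugate G y z \<in> Z" unfolding Z_def hall_parts_def using P by blast
  qed
  then have nY: "normalizes G (sigma_residual j) Z" unfolding sigma_residual_def
      by (rule normalizes_generate_left[OF sigma_residual_gens Zc])
  obtain K where K: "hall_subgroup G (\<sigma> j) K" using hall_ex assms by blast
  have sK: "subgroup K G" using hallD(1) K .
  have YK: "sigma_residual j <#> K = carrier G"
    using coprime_index_set_mult(1)[OF sigma_residual_subgroup(1) sK subgroup_self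
        sigma_residual_subgroup(2)
        subgroup.subset[OF sK] sigma_residual_index[OF assms(2)] hallD(3)[OF K]] by blast
  have "conjugate G g z \<in> A" if z: "z \<in> Z" and g: "g \<in> carrier G" for g z
  proof -
    have "g \<in> sigma_residual j <#> K" using g YK by simp
    then obtain y x where yx: "y \<in> sigma_residual j" "x \<in> K" "g = y \<otimes> x" by (rule set_multE)
    have c: "y \<in> carrier G" "x \<in> carrier G" "z \<in> carrier G"
      using yx sigma_residual_subgroup(2) subgroup.subset[OF sK] z Zc by blast+
    have "conjugate G y z \<in> Z" using normalizesD[OF nY yx(1) z] .
    then obtain l P where P: "l \<in> I" "l \<noteq> j" "hall_subgroup G (\<sigma> l) P" "conjugate G y z \<in> P"
        "conjugate G y z \<in> hall_join j A"
      unfolding Z_def hall_parts_def by blast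
    have "conjugate G y z \<in> A" using P hall_join_subset[OF sA] by blast
    then have "conjugate G x (conjugate G y z) \<in> A"
      using conjugate_hall_permutable[OF assms(1,2) P(1) P(2)[symmetric] K P(3) yx(2) P(4)] by blast
    then show ?thesis using conjugate_conjugate[OF c] yx by simp
  qed
  moreover have "z0 \<in> Z" unfolding Z_def using z0 assms by blast
  ultimately show "z0 \<in> normal_core A" unfolding normal_core_def using Zc by blast
qed

text \<open>For normal \<open>R\<close> and \<open>j \<in> I\<close> the factor group
  \<open>hall_core j R / R\<close> is \<open>O_{\<sigma> j}(G/R)\<close>, the largest normal
  \<open>\<sigma> j\<close>-subgroup, written with Hall subgroups of \<open>G\<close> alone.\<close>

definition hall_core :: "'i \<Rightarrow> 'a set \<Rightarrow> 'a set" where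
  "hall_core j R = carrier G \<inter> (\<Inter>K\<in>{K. hall_subgroup G (\<sigma> j) K}. K <#> R)"

lemma hall_core_normal:
  assumes "R \<lhd> G" shows "hall_core j R \<lhd> G"
  unfolding normal_iff_normalizes
proof
  have eq: "hall_core j R = \<Inter>(insert (carrier G) ((\<lambda>K. K <#> R) ` {K. hall_subgroup G (\<sigma> j) K}))"
    unfolding hall_core_def by simp
  have "subgroup W G"
      if "W \<in> insert (carrier G) ((\<lambda>K. K <#> R) ` {K. hall_subgroup G (\<sigma> j) K})" for W
    using that normal_commute(3)[OF assms hallD(1)] subgroup_self by blast
  then show "subgroup (hall_core j R) G" unfolding eq by (rule subgroups_Inter) auto
  show "normalizes G (carrier G) (hall_core j R)"
    unfolding normalizes_def
  proof (intro ballI)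
    fix x m assume x: "x \<in> carrier G" and m: "m \<in> hall_core j R"
    have "conjugate G x m \<in> K <#> R" if K: "hall_subgroup G (\<sigma> j) K" for K
    proof -
      have "hall_subgroup G (\<sigma> j) (conjugate G (inv x) ` K)" using hall_conjugate K x by blast
      then have "m \<in> (conjugate G (inv x) ` K) <#> R" using m unfolding hall_core_def by blast
      then obtain u r where u: "u \<in> conjugate G (inv x) ` K" "r \<in> R" "m = u \<otimes> r" by (rule set_multE)
      then obtain k where k: "k \<in> K" "u = conjugate G (inv x) k" by blast
      have c: "k \<in> carrier G" "r \<in> carrier G"
        using k u subgroup.subset[OF hallD(1)[OF K]] subgroup.subset[OF normal_imp_subgroup[OF
            assms]] by blast+
      have "conjugate G x m = k \<otimes> conjugate G x r" using u(3) k(2) c x by (simp add: conjugate_mult)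
      moreover have "conjugate G x r \<in> R"
        using normal_iff_normalizes[of R] assms normalizesD[of G "carrier G" R x r] x u by blast
      ultimately show ?thesis using k set_multI by metis
    qed
    then show "conjugate G x m \<in> hall_core j R"
      unfolding hall_core_def using x m by (simp add: hall_core_def)
  qed
qed

lemma hall_core_index:
  assumes "R \<lhd> G" "j \<in> I"
  shows "R \<subseteq> hall_core j R" "pi_index (\<sigma> j) R (hall_core j R)"
proof -
  have R: "subgroup R G" using assms normal_imp_subgroup by blast
  show le: "R \<subseteq> hall_core j R"
    unfolding hall_core_def using set_mult_upper(2)[OF hallD(1) R] subgroup.subset[OF R] by blast
  obtain K where K: "hall_subgroup G (\<sigma> j) K" using hall_ex assms by blast
  have sK: "subgroup K G" using hallD(1) K .
  have "pi_index (\<sigma> j) (K \<inter> R) K"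
    using pi_index_card[OF subgroup_Int[OF sK R] sK _ hallD(2)[OF K]] by blast
  then have "pi_index (\<sigma> j) R (K <#> R)" using pi_index_set_mult_iff[OF sK R] by simp
  moreover have "hall_core j R \<subseteq> K <#> R" unfolding hall_core_def using K by blast
  ultimately show "pi_index (\<sigma> j) R (hall_core j R)"
    using pi_index_split(1)[OF R normal_imp_subgroup[OF hall_core_normal[OF assms(1)]]
        normal_commute(3)[OF assms(1) sK] le] by blast
qed

section \<open>Diamonds, their Hall parts and their translates\<close>

lemma permutable_normal_mult:
  assumes "R \<lhd> G" "permutable A" shows "permutable (R <#> A)"
proof -
  have s: "subgroup R G" "subgroup A G" using assms normal_imp_subgroup permutableD(1) by auto
  show ?thesis
    using permutable_generate[OF normal_permutable[OF assms(1)] assms(2)]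
      set_mult_eq_generate[OF s normal_commute(1)[OF assms(1) s(2)]] by simp
qed

definition diamond :: "'a set \<Rightarrow> 'a set \<Rightarrow> 'a set \<Rightarrow> 'a set \<Rightarrow> 'a set \<Rightarrow> bool" where
  "diamond A B C E T \<longleftrightarrow> permutable A \<and> permutable B \<and> permutable C \<and> permutable E \<and>
     A \<inter> B = E \<and> A \<inter> C = E \<and> B \<inter> C = E \<and> A <#> B = T \<and> A <#> C = T \<and> B <#> C = T \<and>
     normalizes G T A \<and> normalizes G T B \<and> normalizes G T C"

lemma diamondD:
  assumes "diamond A B C E T"
  shows "permutable A" "permutable B" "permutable C" "permutable E"
    "subgroup A G" "subgroup B G" "subgroup C G" "subgroup E G" "subgroup T G"
    "A \<inter> B = E" "A \<inter> C = E" "B \<inter> C = E" "A <#> B = T" "A <#> C = T" "B <#> C = T"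
    "normalizes G T A" "normalizes G T B" "normalizes G T C" "normalizes G T E"
    "E \<subseteq> A" "E \<subseteq> B" "E \<subseteq> C" "A \<subseteq> T" "B \<subseteq> T" "C \<subseteq> T" "permutable T"
proof -
  show d: "permutable A" "permutable B" "permutable C" "permutable E"
    "A \<inter> B = E" "A \<inter> C = E" "B \<inter> C = E" "A <#> B = T" "A <#> C = T" "B <#> C = T"
    "normalizes G T A" "normalizes G T B" "normalizes G T C"
    using assms unfolding diamond_def by auto
  show s: "subgroup A G" "subgroup B G" "subgroup C G" "subgroup E G" using d permutableD(1) by auto
  show "normalizes G T E" using normalizes_Int[OF d(11,12)] d(5) by simp
  show "E \<subseteq> A" "E \<subseteq> B" "E \<subseteq> C" using d by auto
  show le: "A \<subseteq> T" "B \<subseteq> T" "C \<subseteq> T" using set_mult_upper s d by metis+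
  have "normalizes G B A" using d(11) le(2) normalizes_mono by blast
  then have c: "A <#> B = B <#> A" "subgroup (A <#> B) G"
    using normalizes_set_mult_commute normalizes_set_mult_subgroup(1) s by auto
  then show "subgroup T G" using d by simp
  show "permutable T" using permutable_generate[OF d(1,2)] set_mult_eq_generate[OF s(1,2) c(1)] d
      by simp
qed

text \<open>Two sides normalize each other, so their commutators lie in the intersection
  \<open>E\<close>. Each side therefore commutes modulo \<open>E\<close> with the other two, and
  these generate \<open>T\<close>.\<close>

lemma diamond_commutator:
  assumes "diamond A B C E T" "x \<in> T" "y \<in> T"
  shows "commutator x y \<in> E"
proof -
  note d = diamondD[OF assms(1)]
  have Tc: "T \<subseteq> carrier G" using subgroup.subset[OF d(9)] .
  have cm: "commutator u v \<in> U \<inter> V" if "U \<in> {A, B, C}" "V \<in> {A, B, C}" "u \<in> U" "v \<in> V" for U V u v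
  proof -
    have UV: "subgroup U G" "subgroup V G" "normalizes G T U" "normalizes G T V" "U \<subseteq> T"
        "V \<subseteq> T" using that d by auto
    have "u \<in> T" "v \<in> T" using that UV by auto
    then show ?thesis
        using commutator_normalizes(1)[OF UV(1) Tc UV(3)] commutator_normalizes(2)[OF UV(2) Tc
        UV(4)] that by blast
  qed
  have gen: "generate G (U \<union> V) = T" if "(U, V) \<in> {(A, B), (A, C), (B, C)}" for U V
  proof -
    have UV: "subgroup U G" "subgroup V G" "U <#> V = T" using that d by auto
    have "U <#> V = V <#> U" using set_mult_commute_eq[OF UV d(9)] UV(3) by simp
    then show ?thesis using set_mult_eq_generate[OF UV(1,2)] UV(3) by simp
  qed
  have 1: "commutator u v \<in> E" if "u \<in> A" "v \<in> T" for u v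
  proof (rule commutator_generate[OF d(8)])
    show "B \<union> C \<subseteq> carrier G" using d Tc by blast
    show "normalizes G (generate G (B \<union> C)) E" "v \<in> generate G (B \<union> C)" using gen d that by auto
    show "u \<in> carrier G" using that d Tc by blast
    show "commutator u q \<in> E" if "q \<in> B \<union> C" for q
      using cm[of A B u q] cm[of A C u q] that \<open>u \<in> A\<close> d(10,11) by blast
  qed
  have 2: "commutator u v \<in> E" if "u \<in> B" "v \<in> T" for u v
  proof (rule commutator_generate[OF d(8)])
    show "A \<union> C \<subseteq> carrier G" using d Tc by blast
    show "normalizes G (generate G (A \<union> C)) E" "v \<in> generate G (A \<union> C)" using gen d that by auto
    show "u \<in> carrier G" using that d Tc by blast
    show "commutator u q \<in> E" if "q \<in> A \<union> C" for q
      using cm[of B A u q] cm[of B C u q] that \<open>u \<in> B\<close> d(10,12) by blast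
  qed
  show ?thesis
  proof (rule commutator_all_generate[OF d(8)])
    show "A \<union> B \<subseteq> carrier G" using d Tc by blast
    show "normalizes G (generate G (A \<union> B)) E" "x \<in> generate G (A \<union> B)" "y \<in> generate G (A \<union> B)"
      using gen d assms by auto
    fix q r assume q: "q \<in> A \<union> B" and "r \<in> A \<union> B"
    then have "r \<in> T" using d(23,24) by blast
    then show "commutator q r \<in> E" using q 1[of q r] 2[of q r] by blast
  qed
qed

text \<open>\<open>P/E\<close> is the unique Hall \<open>\<sigma> i\<close>-subgroup of the abelian
  group \<open>A/E\<close>. Its two descriptions serve permutability: Hall subgroups for
  \<open>j \<noteq> i\<close> normalize \<open>hall_join i A\<close>, and a Hall
  \<open>\<sigma> i\<close>-subgroup \<open>H\<close> absorbs the factor \<open>H \<inter> A\<close>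
  of \<open>P = (H \<inter> A)E\<close>.\<close>

lemma hall_part:
  assumes "permutable A" "permutable E" "E \<subseteq> A" "\<And>x y. x \<in> A \<Longrightarrow> y \<in> A \<Longrightarrow> commutator x y \<in> E" "i \<in> I"
  defines "P \<equiv> hall_join i A <#> E"
  shows "permutable P" "E \<subseteq> P" "P \<subseteq> A" "pi_index (\<sigma> i) E P" "pi_index (- \<sigma> i) P A"
    "\<And>K. hall_subgroup G (\<sigma> i) K \<Longrightarrow> P = (K \<inter> A) <#> E"
proof -
  have sA: "subgroup A G" and sE: "subgroup E G" using assms permutableD(1) by auto
  have Ac: "A \<subseteq> carrier G" using subgroup.subset[OF sA] .
  note sS = hall_join_subgroup[of i A]
  have le: "hall_join i A \<subseteq> A" using hall_join_subset[OF sA] .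
  have nE: "normalizes G A E" using commutator_normalizes_between[OF sE Ac subset_refl assms(3,4)]
      by blast
  have nES: "normalizes G V E" if "V \<subseteq> A" for V using normalizes_mono[OF nE that] .
  have sP: "subgroup P G" unfolding P_def
      using normalizes_set_mult_subgroup(2)[OF sE sS nES[OF le]] .
  show PA: "P \<subseteq> A" unfolding P_def using set_mult_least[OF sA le assms(3)] .
  have upP: "hall_join i A \<subseteq> P" "E \<subseteq> P" unfolding P_def using set_mult_upper[OF sS sE] by auto
  then show "E \<subseteq> P" by blast
  have nP: "normalizes G A P" using commutator_normalizes_between[OF sP Ac upP(2) PA] assms(4)
      by blast
  show iP: "pi_index (- \<sigma> i) P A"
    using pi_index_split(2)[OF sS sP sA upP(1) PA hall_join_index[OF assms(1,5)]] .
  have K: "P = (K \<inter> A) <#> E \<and> subgroup (K \<inter> A) G" if K: "hall_subgroup G (\<sigma> i) K" for K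
  proof -
    have sK: "subgroup K G" using hallD(1) K .
    have sKA: "subgroup (K \<inter> A) G" using subgroup_Int sK sA by blast
    let ?Q = "(K \<inter> A) <#> E"
    have sQ: "subgroup ?Q G" using normalizes_set_mult_subgroup(2)[OF sE sKA nES] by blast
    have QA: "?Q \<subseteq> A" using set_mult_least[OF sA _ assms(3)] by blast
    have upQ: "K \<inter> A \<subseteq> ?Q" "E \<subseteq> ?Q" using set_mult_upper[OF sKA sE] by auto
    have nQ: "normalizes G A ?Q" using commutator_normalizes_between[OF sQ Ac upQ(2) QA] assms(4)
        by blast
    have "pi_index (- \<sigma> i) (K \<inter> A) A" using permutable_inter_hall[OF assms(1,5) K]
        by (simp add: Int_commute)
    then have iQ: "pi_index (- \<sigma> i) ?Q A" using pi_index_split(2)[OF sKA sQ sA upQ(1) QA] by blast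
    have "K' \<inter> A \<subseteq> ?Q" if K': "hall_subgroup G (\<sigma> i) K'" for K'
    proof (rule pi_subgroup_le[OF sQ _ sA QA _ _ iQ])
      show s': "subgroup (K' \<inter> A) G" using subgroup_Int hallD(1)[OF K'] sA by blast
      show "pi_number (\<sigma> i) (card (K' \<inter> A))"
        using pi_number_card_sub[OF s' hallD(1)[OF K'] _ hallD(2)[OF K']] by blast
      show "K' \<inter> A <#> ?Q = ?Q <#> (K' \<inter> A)"
        using normalizes_set_mult_commute[OF sQ s'] normalizes_mono[OF nQ] by auto
    qed auto
    then have "hall_join i A \<subseteq> ?Q" unfolding hall_join_def hall_parts_def
      by (intro generate_subgroup_incl[OF _ sQ]) blast
    then have "P \<subseteq> ?Q" unfolding P_def using set_mult_least[OF sQ _ upQ(2)] by blast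
    moreover have "?Q \<subseteq> P" using set_mult_least[OF sP _ upP(2)] hall_join_hall[OF K] upP(1) by blast
    ultimately show ?thesis using sKA by blast
  qed
  then show "\<And>K. hall_subgroup G (\<sigma> i) K \<Longrightarrow> P = (K \<inter> A) <#> E" by blast
  obtain K where hK: "hall_subgroup G (\<sigma> i) K" using hall_ex assms(5) by blast
  have sKA: "subgroup (K \<inter> A) G" and PK: "P = (K \<inter> A) <#> E" using K[OF hK] by auto
  have "pi_number (\<sigma> i) (card (K \<inter> A))"
    using pi_number_card_sub[OF sKA hallD(1)[OF hK] _ hallD(2)[OF hK]] by blast
  then have "pi_index (\<sigma> i) (K \<inter> A \<inter> E) (K \<inter> A)"
    using pi_index_card[OF subgroup_Int[OF sKA sE] sKA] by blast
  then show "pi_index (\<sigma> i) E P" using pi_index_set_mult_iff[OF sKA sE] PK by simp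
  show "permutable P"
    unfolding permutable_def
  proof (intro conjI ballI allI impI)
    show "subgroup P G" by (rule sP)
    fix j H assume j: "j \<in> I" "hall_subgroup G (\<sigma> j) H"
    have sH: "subgroup H G" using hallD(1) j by blast
    have c: "H \<subseteq> carrier G" "hall_join i A \<subseteq> carrier G" "E \<subseteq> carrier G" "K \<inter> A \<subseteq> carrier G"
      using subgroup.subset sH sS sE sKA by auto
    have EH: "E <#> H = H <#> E" using permutableD(2)[OF assms(2) j] .
    show "P <#> H = H <#> P"
    proof (cases "j = i")
      case False
      have SH: "hall_join i A <#> H = H <#> hall_join i A"
        using normalizes_set_mult_commute[OF sS sH hall_join_normalizes_hall[OF assms(1) j(1)
            assms(5) False j(2)]] .
      have "P <#> H = hall_join i A <#> (H <#> E)" unfolding P_def using set_mult_assoc c EH by simp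
      also have "\<dots> = H <#> P" unfolding P_def using set_mult_assoc[symmetric] c SH by simp
      finally show ?thesis .
    next
      case True
      have hH: "hall_subgroup G (\<sigma> i) H" using j True by simp
      have sHA: "subgroup (H \<inter> A) G" and PH: "P = (H \<inter> A) <#> E" using K[OF hH] by auto
      have cc: "H \<inter> A \<subseteq> carrier G" using c by blast
      have 1: "(H \<inter> A) <#> H = H" using set_mult_mono_left[OF sHA sH] by blast
      then have 2: "H <#> (H \<inter> A) = H" by (rule set_mult_commute_eq[OF sHA sH _ sH])
      have "P <#> H = (H \<inter> A) <#> (H <#> E)" unfolding PH using set_mult_assoc c cc EH by simp
      also have "\<dots> = H <#> E" using set_mult_assoc[OF cc c(1,3)] 1 by simp
      also have "\<dots> = H <#> P" unfolding PH using set_mult_assoc[OF c(1) cc c(3)] 2 by simp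
      finally show ?thesis .
    qed
  qed
qed

lemma diamond_hall_part:
  assumes "diamond A B C E T" "i \<in> I"
  obtains A' B' C' T' where "diamond A' B' C' E T'" "pi_index (\<sigma> i) E T'" "A' \<subseteq> A"
      "pi_index (- \<sigma> i) A' A"
proof -
  note d = diamondD[OF assms(1)]
  note cm = diamond_commutator[OF assms(1)]
  have Tc: "T \<subseteq> carrier G" using subgroup.subset[OF d(9)] .
  let ?P = "\<lambda>V. hall_join i V <#> E"
  have part: "permutable (?P V) \<and> E \<subseteq> ?P V \<and> ?P V \<subseteq> V \<and> pi_index (\<sigma> i) E (?P V) \<and> pi_index (-
      \<sigma> i) (?P V) V
      \<and> (\<forall>K. hall_subgroup G (\<sigma> i) K \<longrightarrow> ?P V = (K \<inter> V) <#> E)"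
    if "V \<in> {A, B, C, T}" for V
  proof -
    have V: "permutable V" "E \<subseteq> V" "V \<subseteq> T" using that d by auto
    have "commutator x y \<in> E" if "x \<in> V" "y \<in> V" for x y using cm V that by blast
    then show ?thesis using hall_part[OF V(1) d(4) V(2) _ assms(2)] by blast
  qed
  have nT: "normalizes G T (?P V)" if "V \<in> {A, B, C, T}" for V
  proof -
    have "V \<subseteq> T" using that d by auto
    then have "?P V \<subseteq> T" "E \<subseteq> ?P V" "subgroup (?P V) G" using part[OF that] permutableD(1) by auto
    then show ?thesis using commutator_normalizes_between[OF _ Tc _ _ cm] by blast
  qed
  have join: "?P U <#> ?P V = ?P T"
    if UV: "(U, V) \<in> {(A, B), (A, C), (B, C)}" for U V
  proof
    have UVT: "U \<in> {A, B, C, T}" "V \<in> {A, B, C, T}" "U \<inter> V = E" "U <#> V = T" "U \<subseteq> T" "V \<subseteq> T"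
      "subgroup U G" "subgroup V G" using UV d by auto
    obtain K where hK: "hall_subgroup G (\<sigma> i) K" using hall_ex assms(2) by blast
    note pU = part[OF UVT(1)] and pV = part[OF UVT(2)] and pT = part[of T, simplified]
    have sU: "subgroup (?P U) G" and sV: "subgroup (?P V) G" and sT: "subgroup (?P T) G"
      using pU pV pT permutableD(1) by blast+
    have leT: "?P U \<subseteq> ?P T" "?P V \<subseteq> ?P T"
    proof -
      have "(K \<inter> U) <#> E \<subseteq> (K \<inter> T) <#> E" "(K \<inter> V) <#> E \<subseteq> (K \<inter> T) <#> E"
        using UVT by (intro mono_set_mult; blast)+
      then show "?P U \<subseteq> ?P T" "?P V \<subseteq> ?P T" using pU pV pT hK by auto
    qed
    then show "?P U <#> ?P V \<subseteq> ?P T" using set_mult_least[OF sT] by blast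
    have lU: "?P U \<subseteq> U" "E \<subseteq> ?P U" "pi_index (- \<sigma> i) (?P U) U" using pU by simp_all
    have lV: "?P V \<subseteq> V" "E \<subseteq> ?P V" "pi_index (- \<sigma> i) (?P V) V" using pV by simp_all
    have nUV: "normalizes G (?P V) (?P U)"
        using normalizes_mono[OF nT[OF UVT(1)] subset_trans[OF lV(1) UVT(6)]] .
    have sJ: "subgroup (?P U <#> ?P V) G" using normalizes_set_mult_subgroup(1)[OF sU sV nUV] .
    have JT: "?P U <#> ?P V \<subseteq> T" 
      using set_mult_least[OF d(9) subset_trans[OF lU(1) UVT(5)] subset_trans[OF lV(1) UVT(6)]] .
    have upJ: "?P U \<subseteq> ?P U <#> ?P V" "?P V \<subseteq> ?P U <#> ?P V" using set_mult_upper[OF sU sV] by auto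
    have nJ: "normalizes G T (?P U <#> ?P V)"
        using normalizes_set_mult[OF sU sV Tc nT[OF UVT(1)] nT[OF UVT(2)]] .
    \<comment> \<open>The index of \<open>?P U <#> ?P V\<close> in \<open>T\<close> is split at
      \<open>U <#> ?P V\<close>. The two factors divide the index of \<open>?P U\<close> in
      \<open>U\<close> and that of \<open>?P V\<close> in \<open>V\<close>, so both are prime to
      \<open>\<sigma> i\<close>, and the \<open>\<sigma> i\<close>-group \<open>K \<inter> T\<close>
      is contained in the product.\<close>
    have sM: "subgroup (U <#> ?P V) G"
      using normalizes_set_mult_subset(1)[OF UVT(7) sV] normalizes_mono[OF nT[OF UVT(2)] UVT(5)]
          by blast
    have UM: "U <#> (?P U <#> ?P V) = U <#> ?P V"
    proof -
      have cU: "U \<subseteq> carrier G" "?P U \<subseteq> carrier G" "?P V \<subseteq> carrier G"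
        using subgroup.subset UVT(7) sU sV by auto
      have "U <#> ?P U = U"
        using set_mult_commute_eq[OF sU UVT(7) set_mult_mono_left[OF sU UVT(7) lU(1)] UVT(7)] .
      then show ?thesis using set_mult_assoc[OF cU] by simp
    qed
    have "pi_index (- \<sigma> i) (U \<inter> (?P U <#> ?P V)) U"
      by (rule pi_index_split(2)[OF sU subgroup_Int[OF UVT(7) sJ] UVT(7) _ _ lU(3)]) (use lU upJ in
          auto)
    then have 1: "pi_index (- \<sigma> i) (?P U <#> ?P V) (U <#> ?P V)"
      using pi_index_set_mult_iff[OF UVT(7) sJ] UM by simp
    have c1: "U <#> ?P V = ?P V <#> U"
      using normalizes_set_mult_subset(2)[OF UVT(7) sV] normalizes_mono[OF nT[OF UVT(2)] UVT(5)]
          by blast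
    have VM: "V <#> (U <#> ?P V) = T"
    proof -
      have cU: "V \<subseteq> carrier G" "?P V \<subseteq> carrier G" "U \<subseteq> carrier G"
        using subgroup.subset UVT(7,8) sV by auto
      have "V <#> ?P V = V"
        using set_mult_commute_eq[OF sV UVT(8) set_mult_mono_left[OF sV UVT(8) lV(1)] UVT(8)] .
      moreover have "V <#> U = T" by (rule set_mult_commute_eq[OF UVT(7,8,4) d(9)])
      ultimately show ?thesis using set_mult_assoc[OF cU] c1 by simp
    qed
    have "pi_index (- \<sigma> i) (V \<inter> (U <#> ?P V)) V"
      by (rule pi_index_split(2)[OF sV subgroup_Int[OF UVT(8) sM] UVT(8) _ _ lV(3)])
        (use lV set_mult_upper(2)[OF UVT(7) sV] in auto)
    then have 2: "pi_index (- \<sigma> i) (U <#> ?P V) T"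
      using pi_index_set_mult_iff[OF UVT(8) sM] VM by simp
    have iJ: "pi_index (- \<sigma> i) (?P U <#> ?P V) T" using pi_index_trans[OF 1 2] .
    have "K \<inter> T \<subseteq> ?P U <#> ?P V"
    proof (rule pi_subgroup_le[OF sJ _ d(9) JT _ _ iJ])
      show s': "subgroup (K \<inter> T) G" using subgroup_Int hallD(1)[OF hK] d(9) by blast
      show "pi_number (\<sigma> i) (card (K \<inter> T))"
        using pi_number_card_sub[OF s' hallD(1)[OF hK] _ hallD(2)[OF hK]] by blast
      show "K \<inter> T <#> (?P U <#> ?P V) = ?P U <#> ?P V <#> (K \<inter> T)"
        using normalizes_set_mult_commute[OF sJ s'] normalizes_mono[OF nJ] by auto
    qed auto
    then have "(K \<inter> T) <#> E \<subseteq> ?P U <#> ?P V"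
        using set_mult_least[OF sJ _ subset_trans[OF lU(2) upJ(1)]] by blast
    then show "?P T \<subseteq> ?P U <#> ?P V" using pT hK by auto
  qed
  have leT: "?P T \<subseteq> T" using part[of T] by simp
  have inter: "?P U \<inter> ?P V = E" if "(U, V) \<in> {(A, B), (A, C), (B, C)}" for U V
  proof -
    have UVT: "U \<in> {A, B, C, T}" "V \<in> {A, B, C, T}" "U \<inter> V = E" using that d by auto
    then show ?thesis using part[OF UVT(1)] part[OF UVT(2)] by blast
  qed
  have "diamond (?P A) (?P B) (?P C) E (?P T)"
    unfolding diamond_def
    using part[of A] part[of B] part[of C] d(4) join[of A B] join[of A C] join[of B C]
      inter[of A B] inter[of A C] inter[of B C] normalizes_mono[OF nT leT] by simp
  moreover have "pi_index (\<sigma> i) E (?P T)" "?P A \<subseteq> A" "pi_index (- \<sigma> i) (?P A) A"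
    using part[of T] part[of A] by simp_all
  ultimately show ?thesis using that by blast
qed

text \<open>If \<open>r \<otimes> v \<in> T\<close> with \<open>v \<in> V \<subseteq> T\<close>,
  then \<open>r \<in> R \<inter> T \<subseteq> E \<subseteq> V\<close>. Hence \<open>V\<close> is
  recovered from \<open>R <#> V\<close> by intersecting with \<open>T\<close>, and the diamond does
  not collapse.\<close>

lemma diamond_translate:
  assumes "diamond A B C E T" "R \<lhd> G" "R \<inter> T \<subseteq> E"
  shows "diamond (R <#> A) (R <#> B) (R <#> C) (R <#> E) (R <#> T)"
    "(R <#> E) \<inter> T = E" "pi_index \<pi> E T \<Longrightarrow> pi_index \<pi> (R <#> E) (R <#> T)"
proof -
  note d = diamondD[OF assms(1)]
  have sR: "subgroup R G" using assms(2) normal_imp_subgroup by blast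
  have c: "A \<subseteq> carrier G" "B \<subseteq> carrier G" "C \<subseteq> carrier G" "E \<subseteq> carrier G" "T \<subseteq> carrier G"
      "R \<subseteq> carrier G"
    using subgroup.subset d sR by auto
  have RV: "(R <#> V) \<inter> T = V" if "V \<in> {A, B, C, E}" for V
  proof
    have V: "subgroup V G" "V \<subseteq> T" "E \<subseteq> V" using that d by auto
    show "V \<subseteq> (R <#> V) \<inter> T" using V set_mult_upper(2)[OF sR V(1)] by blast
    show "(R <#> V) \<inter> T \<subseteq> V"
    proof
      fix z assume z: "z \<in> (R <#> V) \<inter> T"
      then have "z \<in> R <#> V" by blast
      then obtain r v where rv: "r \<in> R" "v \<in> V" "z = r \<otimes> v" by (rule set_multE)
      have cc: "r \<in> carrier G" "v \<in> carrier G" using rv c V by auto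
      have "r = z \<otimes> inv v" using rv cc by (simp add: m_assoc)
      moreover have "z \<in> T" "inv v \<in> T" using z rv V subgroup.m_inv_closed[OF d(9)] by auto
      ultimately have "r \<in> T" using subgroup.m_closed[OF d(9)] by simp
      then have "r \<in> V" using rv assms(3) V by blast
      then show "z \<in> V" using rv subgroup.m_closed[OF V(1)] by simp
    qed
  qed
  show RE: "(R <#> E) \<inter> T = E" using RV by simp
  have join: "(R <#> U) <#> (R <#> V) = R <#> (U <#> V)" if "subgroup U G" "subgroup V G" for U V
  proof -
    have cc: "U \<subseteq> carrier G" "V \<subseteq> carrier G" using subgroup.subset that by auto
    have "(R <#> U) <#> (R <#> V) = R <#> ((U <#> R) <#> V)"
      using set_mult_assoc c cc set_mult_closed by simp
    also have "\<dots> = R <#> ((R <#> U) <#> V)" using normal_commute(1)[OF assms(2) that(1)] by simp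
    also have "\<dots> = (R <#> R) <#> (U <#> V)" using set_mult_assoc c cc set_mult_closed by simp
    finally show ?thesis using subgroup_mult_id[OF sR] by simp
  qed
  have inter: "(R <#> U) \<inter> (R <#> V) = R <#> E"
    if UV: "(U, V) \<in> {(A, B), (A, C), (B, C)}" for U V
  proof
    have UVT: "U \<in> {A, B, C, E}" "V \<in> {A, B, C, E}" "U \<inter> V = E" "U \<subseteq> T" "V \<subseteq> T" "E \<subseteq> U" "E \<subseteq> V"
      "subgroup U G" "subgroup V G" using UV d by auto
    show "R <#> E \<subseteq> (R <#> U) \<inter> (R <#> V)" using UVT by (auto intro: mono_set_mult[THEN subsetD])
    have sRV: "subgroup (R <#> V) G" "R \<subseteq> R <#> V"
      using normal_commute(2)[OF assms(2) UVT(9)] set_mult_upper(1)[OF sR UVT(9)] by auto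
    have "(R <#> U) \<inter> (R <#> V) = R <#> (U \<inter> (R <#> V))"
      by (rule dedekind[OF sR sRV]) (use UVT subgroup.subset in blast)
    moreover have "U \<inter> (R <#> V) \<subseteq> E" using RV[OF UVT(2)] UVT by blast
    then have "R <#> (U \<inter> (R <#> V)) \<subseteq> R <#> E" by (intro mono_set_mult) auto
    ultimately show "(R <#> U) \<inter> (R <#> V) \<subseteq> R <#> E" by blast
  qed
  have nrmRT: "normalizes G (R <#> T) (R <#> V)" if "V \<in> {A, B, C}" for V
  proof (rule normalizes_set_mult_left[OF sR d(9)])
    have V: "subgroup V G" "normalizes G T V" using that d by auto
    have sRV: "subgroup (R <#> V) G" using normal_commute(2)[OF assms(2) V(1)] .
    then show "R <#> V \<subseteq> carrier G" using subgroup.subset by blast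
    show "normalizes G R (R <#> V)" using normalizes_self[OF sRV set_mult_upper(1)[OF sR V(1)]] .
    show "normalizes G T (R <#> V)"
      using normalizes_set_mult[OF sR V(1) c(5) normal_normalizes[OF assms(2) c(5)] V(2)] .
  qed
  show "diamond (R <#> A) (R <#> B) (R <#> C) (R <#> E) (R <#> T)"
    unfolding diamond_def
    using permutable_normal_mult[OF assms(2)] d inter[of A B] inter[of A C] inter[of B C]
      join[of A B] join[of A C] join[of B C] nrmRT by simp
  assume i: "pi_index \<pi> E T"
  have sRE: "subgroup (R <#> E) G" using normal_commute(2)[OF assms(2) d(8)] .
  have "T \<inter> (R <#> E) = E" using RE by blast
  then have "pi_index \<pi> (R <#> E) (T <#> (R <#> E))" using pi_index_set_mult_iff[OF d(9) sRE] i
      by simp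
  moreover have "T <#> (R <#> E) = R <#> T"
  proof -
    have ET: "E \<subseteq> T" using d by blast
    have "T <#> (R <#> E) = (R <#> T) <#> E"
      using set_mult_assoc[OF c(5,6,4)] normal_commute(1)[OF assms(2) d(9)] by simp
    also have "\<dots> = R <#> (T <#> E)" using set_mult_assoc[OF c(6,5,4)] .
    also have "T <#> E = T"
      by (rule set_mult_commute_eq[OF d(8,9) set_mult_mono_left[OF d(8,9) ET] d(9)])
    finally show ?thesis .
  qed
  ultimately show "pi_index \<pi> (R <#> E) (R <#> T)" by simp
qed

text \<open>Maximality of \<open>R\<close> is used twice. It gives
  \<open>normal_core E \<subseteq> R\<close>, which puts the parts of \<open>hall_join j E\<close>
  for classes other than \<open>j\<close> into \<open>R\<close>, so that this join is a
  \<open>\<sigma> j\<close>-group modulo \<open>R\<close> and lies in \<open>hall_core j R\<close>.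
  For \<open>j \<noteq> i\<close> it also gives \<open>hall_core j R = R\<close>. Thus
  \<open>R\<close> contains \<open>hall_join j E\<close> for all
  \<open>j \<noteq> i\<close>.\<close>

lemma diamond_bottom_index:
  assumes "diamond A B C E T" "i \<in> I" "pi_index (\<sigma> i) E T" "R \<lhd> G" "R \<subseteq> E"
    and max: "\<And>M. M \<lhd> G \<Longrightarrow> R \<subseteq> M \<Longrightarrow> M \<inter> T \<subseteq> E \<Longrightarrow> M = R"
  shows "pi_index (\<sigma> i) R E"
proof -
  note d = diamondD[OF assms(1)]
  have sR: "subgroup R G" using assms(4) normal_imp_subgroup by blast
  have normal_core: "normal_core E \<subseteq> R"
  proof -
    have n: "normal_core E \<lhd> G" using normal_core_normal[OF d(8)] .
    have sc: "subgroup (normal_core E) G" using n normal_imp_subgroup by blast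
    have RC: "(R <#> normal_core E) \<lhd> G" using normal_set_mult_normal[OF assms(4) n] .
    have "R <#> normal_core E \<subseteq> E" using set_mult_least[OF d(8) assms(5) normal_core_subset] .
    then have "R <#> normal_core E = R" using max[OF RC] set_mult_upper(1)[OF sR sc] by blast
    then show ?thesis using set_mult_upper(2)[OF sR sc] by blast
  qed
  have le: "hall_join j E \<subseteq> R" if j: "j \<in> I" "j \<noteq> i" for j
  proof -
    \<comment> \<open>The index of \<open>M \<inter> E\<close> in \<open>M \<inter> T\<close> is a
      number for \<open>\<sigma> j\<close> because of \<open>M/R\<close> and for
      \<open>\<sigma> i\<close> because of \<open>T/E\<close>. So
      \<open>M \<inter> T \<subseteq> E\<close>, and maximality applies to \<open>M\<close>.\<close>
    define M where "M = hall_core j R"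
    have M: "M \<lhd> G" "R \<subseteq> M" "pi_index (\<sigma> j) R M"
      unfolding M_def using hall_core_normal hall_core_index assms(4) j by auto
    have sM: "subgroup M G" using M normal_imp_subgroup by blast
    have sMT: "subgroup (M \<inter> T) G" and sME: "subgroup (M \<inter> E) G" using subgroup_Int sM d by auto
    have ET: "E \<subseteq> T" using d by blast
    have "pi_index (\<sigma> j) R (M \<inter> T)"
      by (rule pi_index_split(1)[OF sR sMT sM _ _ M(3)]) (use M(2) assms(5) ET in auto)
    then have 1: "pi_index (\<sigma> j) (M \<inter> E) (M \<inter> T)"
      by (rule pi_index_split(2)[OF sR sME sMT, rotated 2]) (use M(2) assms(5) ET in auto)
    have eq: "M \<inter> T \<inter> E = M \<inter> E" using ET by blast
    have "pi_index (\<sigma> i) (M \<inter> T \<inter> E) (M \<inter> T)"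
      by (rule pi_index_inter[OF sMT d(8,9) _ ET _ assms(3)])
        (use normalizes_set_mult_commute[OF d(8) sMT] normalizes_mono[OF d(19)] in auto)
    then have "M \<inter> E = M \<inter> T"
      using pi_index_eq[OF sME sMT _ 1] eq sigma_disjoint[OF j(1) assms(2) j(2)] ET by auto
    then have MR: "M = R" using max[OF M(1,2)] by blast
    note sS = hall_join_subgroup[of j E]
    have SE: "hall_join j E \<subseteq> E" using hall_join_subset[OF d(8)] .
    have "pi_index (\<sigma> j) (hall_join j E \<inter> R) (hall_join j E)"
    proof (rule pi_index_sigma[OF subgroup_Int[OF sS sR] sS _ j(1)])
      fix k assume k: "k \<in> I" "k \<noteq> j"
      obtain P where P: "hall_subgroup G (\<sigma> k) P" using hall_ex k by blast
      have sP: "subgroup P G" using hallD(1) P .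
      have "P \<inter> hall_join j E \<subseteq> R"
        using hall_parts_hall_join_normal_core[OF d(4) j(1) k] normal_core P
            unfolding hall_parts_def by blast
      then have le: "hall_join j E \<inter> P \<subseteq> hall_join j E \<inter> R" by blast
      have "hall_join j E <#> P = P <#> hall_join j E"
        using normalizes_set_mult_commute[OF sS sP hall_join_normalizes_hall[OF d(4) k(1) j(1) k(2)
            P]] .
      then have "pi_index (- \<sigma> k) (hall_join j E \<inter> P) (hall_join j E)"
        using pi_index_inter[OF sS sP subgroup_self subgroup.subset[OF sS] subgroup.subset[OF sP] _
            hallD(3)[OF P]]
        by blast
      then show "pi_index (- \<sigma> k) (hall_join j E \<inter> R) (hall_join j E)"
        using pi_index_split(2)[OF subgroup_Int[OF sS sP] subgroup_Int[OF sS sR] sS le] by blast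
    qed auto
    then have SR: "pi_index (\<sigma> j) R (hall_join j E <#> R)" using pi_index_set_mult_iff[OF sS sR]
        by simp
    have sSR: "subgroup (hall_join j E <#> R) G" using normal_commute(3)[OF assms(4) sS] .
    have SRE: "hall_join j E <#> R \<subseteq> E" using set_mult_least[OF d(8) SE assms(5)] .
    \<comment> \<open>In \<open>hall_join j E <#> R\<close> the subgroup \<open>?Q\<close> has
      \<open>\<sigma> j\<close>-index since it contains \<open>R\<close>, and index prime to
      \<open>\<sigma> j\<close> since it contains \<open>K \<inter> E\<close>; so it is
      everything.\<close>
    have "hall_join j E \<subseteq> K <#> R" if K: "hall_subgroup G (\<sigma> j) K" for K
    proof -
      have sK: "subgroup K G" using hallD(1) K .
      have sKE: "subgroup (K \<inter> E) G" using subgroup_Int[OF sK d(8)] .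
      let ?Q = "(K \<inter> E) <#> R"
      have sQ: "subgroup ?Q G" using normal_commute(3)[OF assms(4) sKE] .
      have QS: "?Q \<subseteq> hall_join j E <#> R" by (rule mono_set_mult) (use hall_join_hall[OF K] in auto)
      have up: "K \<inter> E \<subseteq> ?Q" "R \<subseteq> ?Q" using set_mult_upper[OF sKE sR] by auto
      have 1: "pi_index (\<sigma> j) ?Q (hall_join j E <#> R)"
          using pi_index_split(2)[OF sR sQ sSR up(2) QS SR] .
      have "pi_index (- \<sigma> j) (K \<inter> E) E" using permutable_inter_hall[OF d(4) j(1) K]
          by (simp add: Int_commute)
      then have "pi_index (- \<sigma> j) ?Q E" using pi_index_split(2)[OF sKE sQ d(8) up(1)] QS SRE
          by blast
      then have "pi_index (- \<sigma> j) ?Q (hall_join j E <#> R)"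
          using pi_index_split(1)[OF sQ sSR d(8) QS SRE] by blast
      then have "?Q = hall_join j E <#> R" using pi_index_eq[OF sQ sSR QS 1] by blast
      then have "hall_join j E \<subseteq> ?Q" using set_mult_upper(1)[OF sS sR] by blast
      also have "?Q \<subseteq> K <#> R" by (rule mono_set_mult) auto
      finally show ?thesis .
    qed
    then have "hall_join j E \<subseteq> M" unfolding M_def hall_core_def using subgroup.subset[OF sS]
        by blast
    then show ?thesis using MR by simp
  qed
  show ?thesis
  proof (rule pi_index_sigma[OF sR d(8) assms(5,2)])
    fix j assume j: "j \<in> I" "j \<noteq> i"
    show "pi_index (- \<sigma> j) R E"
      using pi_index_split(2)[OF hall_join_subgroup sR d(8) le[OF j] assms(5) hall_join_index[OF
          d(4) j(1)]] .
  qed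
qed

text \<open>\<open>R\<close> has greatest order among the normal subgroups with
  \<open>R \<inter> T \<subseteq> E\<close>. This maximality carries over to the translated diamond:
  \<open>M \<inter> (R <#> T) \<subseteq> R <#> E\<close> implies
  \<open>M \<inter> T \<subseteq> (R <#> E) \<inter> T = E\<close>.\<close>

lemma diamond_reduce:
  assumes "diamond A B C E T" "i \<in> I" "pi_index (\<sigma> i) E T" "A \<noteq> E"
  obtains A' B' C' E' T' R where "diamond A' B' C' E' T'" "R \<lhd> G" "R \<subseteq> E'" "pi_index (\<sigma> i) R T'"
      "A' \<noteq> E'"
proof -
  note d = diamondD[OF assms(1)]
  define F where "F = {R. R \<lhd> G \<and> R \<inter> T \<subseteq> E}"
  have "F \<subseteq> Pow (carrier G)" unfolding F_def using normal_imp_subgroup subgroup.subset by blast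
  then have finF: "finite F" using fin finite_subset by blast
  have "{\<one>} \<in> F" unfolding F_def using one_is_normal subgroup.one_closed[OF d(8)] by auto
  then have "Max (card ` F) \<in> card ` F" using finF by (intro Max_in) auto
  then obtain R where R: "R \<in> F" "Max (card ` F) = card R" by auto
  have Rmax: "M = R" if "M \<in> F" "R \<subseteq> M" for M
  proof -
    have "card M \<le> card R" unfolding R(2)[symmetric] using finF that(1) by (intro Max_ge) auto
    moreover have "finite M" using that finite_subgroup normal_imp_subgroup unfolding F_def by blast
    ultimately show ?thesis using card_seteq[of M R] that by blast
  qed
  have RG: "R \<lhd> G" "R \<inter> T \<subseteq> E" using R F_def by auto
  have sR: "subgroup R G" using RG normal_imp_subgroup by blast
  note t = diamond_translate[OF assms(1) RG]
  note d' = diamondD[OF t(1)]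
  have RE: "R \<subseteq> R <#> E" using set_mult_upper(1)[OF sR d(8)] .
  have iT: "pi_index (\<sigma> i) (R <#> E) (R <#> T)" using t(3) assms(3) by blast
  have "pi_index (\<sigma> i) R (R <#> E)"
  proof (rule diamond_bottom_index[OF t(1) assms(2) iT RG(1) RE])
    fix M assume M: "M \<lhd> G" "R \<subseteq> M" "M \<inter> (R <#> T) \<subseteq> R <#> E"
    have "T \<subseteq> R <#> T" using set_mult_upper(2)[OF sR d(9)] .
    then have "M \<inter> T \<subseteq> (R <#> E) \<inter> T" using M by blast
    then have "M \<in> F" unfolding F_def using M t(2) by blast
    then show "M = R" using Rmax M by blast
  qed
  then have "pi_index (\<sigma> i) R (R <#> T)" using pi_index_trans iT by blast
  moreover have "R <#> A \<noteq> R <#> E"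
  proof
    assume "R <#> A = R <#> E"
    then have "A \<subseteq> (R <#> E) \<inter> T" using set_mult_upper(2)[OF sR d(5)] d(23) by blast
    then show False using t(2) assms(4) d(20) by blast
  qed
  ultimately show ?thesis using that[OF t(1) RG(1) RE] by blast
qed

section \<open>Permutable \<open>\<sigma> i\<close>-subgroups and their images\<close>

lemma hall_le_of_normal_pi:
  assumes "U \<lhd> G" "pi_number \<pi> (card U)" "hall_subgroup G \<pi> K"
  shows "U \<subseteq> K"
proof -
  have s: "subgroup U G" "subgroup K G" using assms normal_imp_subgroup hallD(1) by auto
  have sUK: "subgroup (U <#> K) G" using normal_commute(2)[OF assms(1) s(2)] .
  have "pi_number \<pi> (card (U <#> K) * card (U \<inter> K))"
    unfolding card_set_mult[OF s] using assms hallD(2) pi_number_mult by blast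
  then have "U <#> K = K"
    using hall_maximal[OF assms(3) sUK set_mult_upper(2)[OF s]] pi_number_mult by blast
  then show ?thesis using set_mult_upper(1)[OF s] by blast
qed

text \<open>\<open>O_{\<sigma> i}(G)\<close> for \<open>i \<in> I\<close>, obtained as the case
  \<open>R = {\<one>}\<close> of \<open>hall_core\<close>, which already supplies normality and the
  order.\<close>

definition sigma_core :: "'i \<Rightarrow> 'a set" where "sigma_core i = hall_core i {\<one>}"

lemma sigma_core_eq: assumes "i \<in> I" shows "sigma_core i = \<Inter>{K. hall_subgroup G (\<sigma> i) K}"
proof -
  have "K <#> {\<one>} = K" if "hall_subgroup G (\<sigma> i) K" for K
    using coset_mult_one[OF subgroup.subset[OF hallD(1)[OF that]]] unfolding r_coset_eq_set_mult .
  moreover obtain K0 where K0: "hall_subgroup G (\<sigma> i) K0" using hall_ex[OF assms] by blast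
  moreover have "K0 \<subseteq> carrier G" using subgroup.subset[OF hallD(1)[OF K0]] .
  ultimately show ?thesis unfolding sigma_core_def hall_core_def by auto
qed

lemma sigma_core_normal: "sigma_core i \<lhd> G"
  unfolding sigma_core_def using hall_core_normal one_is_normal by blast

lemma sigma_core_card: "i \<in> I \<Longrightarrow> pi_number (\<sigma> i) (card (sigma_core i))"
  unfolding sigma_core_def using hall_core_index(2)[OF one_is_normal] by (auto simp: pi_index_def)

text \<open>This description of the \<open>\<sigma>\<^sub>i\<close>-permutable subgroups does not mention Hall subgroups; so it
  passes to factor groups, whose Hall subgroups need not be images of Hall subgroups of \<open>G\<close>.\<close>

lemma permutable_pi_iff:
  assumes "i \<in> I"
  shows "permutable A \<and> pi_number (\<sigma> i) (card A) \<longleftrightarrow> subgroup A G \<and> A \<subseteq> sigma_core i \<and> normalizes G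
      (sigma_residual i) A"
proof
  assume A: "permutable A \<and> pi_number (\<sigma> i) (card A)"
  then have s: "subgroup A G" using permutableD(1) by blast
  have "A \<subseteq> K" if K: "hall_subgroup G (\<sigma> i) K" for K
  proof -
    have sK: "subgroup K G" using hallD(1) K .
    have sAK: "subgroup (A <#> K) G" using permutable_hall_mult(1)[OF _ assms K] A by blast
    have "pi_number (\<sigma> i) (card (A <#> K) * card (A \<inter> K))"
      unfolding card_set_mult[OF s sK] using A hallD(2)[OF K] pi_number_mult by blast
    then have "A <#> K = K"
      using hall_maximal[OF K sAK set_mult_upper(2)[OF s sK]] pi_number_mult by blast
    then show ?thesis using set_mult_upper(1)[OF s sK] by blast
  qed
  then have "A \<subseteq> sigma_core i" unfolding sigma_core_eq[OF assms] by blast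
  \<comment> \<open>For a \<open>\<sigma> i\<close>-group the index of \<open>hall_join i A\<close>
    in \<open>A\<close> is a number for \<open>\<sigma> i\<close> and for its complement. So the
    action of the residual on this join is an action on \<open>A\<close>.\<close>
  moreover have "hall_join i A = A"
    using pi_index_eq[OF hall_join_subgroup s hall_join_subset[OF s] hall_join_index[OF _ assms]
        pi_index_card[OF hall_join_subgroup s hall_join_subset[OF s]]] A by blast
  then have "normalizes G (sigma_residual i) A"
      using sigma_residual_normalizes_hall_join[OF _ assms] A by metis
  ultimately show "subgroup A G \<and> A \<subseteq> sigma_core i \<and> normalizes G (sigma_residual i) A" using s
      by blast
next
  assume A: "subgroup A G \<and> A \<subseteq> sigma_core i \<and> normalizes G (sigma_residual i) A"
  then have s: "subgroup A G" by blast
  have "pi_number (\<sigma> i) (card A)"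
    using pi_number_card_sub[OF s normal_imp_subgroup[OF sigma_core_normal] _ sigma_core_card[OF
        assms]] A by blast
  moreover have "permutable A"
    unfolding permutable_def
  proof (intro conjI ballI allI impI)
    fix j K assume K: "j \<in> I" "hall_subgroup G (\<sigma> j) K"
    have sK: "subgroup K G" using hallD(1) K by blast
    show "A <#> K = K <#> A"
    proof (cases "j = i")
      case True
      then have "A \<subseteq> K" using A K unfolding sigma_core_eq[OF assms] by blast
      then have "A <#> K = K" using set_mult_mono_left[OF s sK] by blast
      then show ?thesis using set_mult_commute_eq[OF s sK _ sK] by simp
    next
      case False
      then have "normalizes G K A"
          using A hall_le_sigma_residual[OF K(1) False K(2)] normalizes_mono by blast
      then show ?thesis using normalizes_set_mult_commute[OF s sK] by blast
    qed
  qed (rule s)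
  ultimately show "permutable A \<and> pi_number (\<sigma> i) (card A)" by blast
qed

lemma pi_group_Mod_iff:
  assumes "N \<lhd> G" shows "pi_group \<pi> (G Mod N) \<longleftrightarrow> pi_index \<pi> N (carrier G)"
proof -
  interpret q: fin_quot G N
    using fin_quot.intro[OF fin_group_axioms fin_quot_axioms.intro[OF assms]] .
  have c: "carrier (G Mod N) = q.quot ` carrier G" by (rule q.Q_carrier)
  show ?thesis unfolding pi_group_def order_def c
    using q.pi_number_quot[OF subgroup_self q.R_sub(2)] .
qed

lemma pi_residual_eq: assumes "i \<in> I" shows "pi_residual G (\<sigma> i) = sigma_residual i"
  unfolding pi_residual_def
proof (rule Least_equality)
  show "sigma_residual i \<lhd> G \<and> pi_group (\<sigma> i) (G Mod sigma_residual i)"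
    using sigma_residual_normal sigma_residual_index[OF assms] pi_group_Mod_iff by blast
  fix N assume "N \<lhd> G \<and> pi_group (\<sigma> i) (G Mod N)"
  then show "sigma_residual i \<le> N" using sigma_residual_least[OF _ _ assms] pi_group_Mod_iff
      by blast
qed

lemma sigma_perm_pi_subgroups_iff:
  "A \<in> sigma_perm_pi_subgroups I \<sigma> G i \<longleftrightarrow> permutable A \<and> pi_number (\<sigma> i) (card A)"
  unfolding sigma_perm_pi_subgroups_def sigma_permutable_iff by blast

end

context sigma_quot
begin

text \<open>Verified through \<open>permutable_pi_iff\<close> in \<open>G/R\<close>. For every
  \<open>K\<close> the indices force \<open>A = (K \<inter> A)R\<close>, so
  \<open>A \<subseteq> hall_core i R\<close>. Moreover \<open>A = hall_join i A <#> R\<close> is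
  normalized by \<open>sigma_residual i\<close>, whose image contains the corresponding residual of
  \<open>G/R\<close>.\<close>

lemma quot_permutable_pi:
  assumes "permutable A" "R \<subseteq> A" "i \<in> I" "pi_index (\<sigma> i) R A"
  shows "quot ` A \<in> sigma_perm_pi_subgroups I \<sigma> (G Mod R) i"
  unfolding Qs.sigma_perm_pi_subgroups_iff Qs.permutable_pi_iff[OF assms(3)]
proof (intro conjI)
  have sA: "subgroup A G" using permutableD(1) assms by blast
  show "subgroup (quot ` A) Q" using quot_subgroup sA .
  have KA: "(K \<inter> A) <#> R = A" if K: "hall_subgroup G (\<sigma> i) K" for K
  proof -
    have sK: "subgroup (K \<inter> A) G" using subgroup_Int hallD(1)[OF K] sA by blast
    have sKR: "subgroup ((K \<inter> A) <#> R) G" using normal_commute(3)[OF R sK] .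
    have le: "(K \<inter> A) <#> R \<subseteq> A" using set_mult_least[OF sA _ assms(2)] by blast
    have "pi_index (- \<sigma> i) (K \<inter> A) A" using permutable_inter_hall[OF assms(1,3) K]
        by (simp add: Int_commute)
    then have "pi_index (- \<sigma> i) ((K \<inter> A) <#> R) A"
      using pi_index_split(2)[OF sK sKR sA set_mult_upper(1)[OF sK R_sub(1)] le] by blast
    moreover have "pi_index (\<sigma> i) ((K \<inter> A) <#> R) A"
      using pi_index_split(2)[OF R_sub(1) sKR sA set_mult_upper(2)[OF sK R_sub(1)] le assms(4)] .
    ultimately show ?thesis using pi_index_eq[OF sKR sA le] by blast
  qed
  have AU: "A \<subseteq> hall_core i R"
  proof
    fix a assume a: "a \<in> A"
    have "a \<in> K <#> R" if K: "hall_subgroup G (\<sigma> i) K" for K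
    proof -
      have "a \<in> (K \<inter> A) <#> R" using KA[OF K] a by simp
      then show ?thesis using mono_set_mult[of "K \<inter> A" K R R] by blast
    qed
    then show "a \<in> hall_core i R" unfolding hall_core_def using a subgroup.subset[OF sA] by blast
  qed
  have "quot ` hall_core i R \<subseteq> Qs.sigma_core i"
    unfolding Qs.sigma_core_eq[OF assms(3)]
  proof (rule Inter_greatest)
    fix K assume "K \<in> {K. hall_subgroup Q (\<sigma> i) K}"
    then show "quot ` hall_core i R \<subseteq> K"
      using Qs.hall_le_of_normal_pi[OF quot_normal[OF hall_core_normal[OF R]]]
        pi_number_quot[OF normal_imp_subgroup[OF hall_core_normal[OF R]] hall_core_index(1)[OF R
            assms(3)]]
        hall_core_index(2)[OF R assms(3)] by blast
  qed
  then show "quot ` A \<subseteq> Qs.sigma_core i" using AU by blast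
  have sYR: "subgroup (sigma_residual i <#> R) G"
      using normal_commute(3)[OF R sigma_residual_subgroup(1)] .
  have "pi_index (\<sigma> i) (sigma_residual i <#> R) (carrier G)"
    using pi_index_split(2)[OF sigma_residual_subgroup(1) sYR subgroup_self set_mult_upper(1)[OF
        sigma_residual_subgroup(1) R_sub(1)]
        subgroup.subset[OF sYR] sigma_residual_index[OF assms(3)]] .
  then have "pi_index (\<sigma> i) (quot ` sigma_residual i) (carrier Q)"
    using pi_index_quot[OF sYR set_mult_upper(2)[OF sigma_residual_subgroup(1) R_sub(1)]
        subgroup_self R_sub(2)]
      quot_image_mult_R[OF sigma_residual_subgroup(1)] Q_carrier by simp
  then have YY: "Qs.sigma_residual i \<subseteq> quot ` sigma_residual i"
      using Qs.sigma_residual_least[OF quot_normal[OF sigma_residual_normal] _ assms(3)] by blast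
  obtain K where K: "hall_subgroup G (\<sigma> i) K" using hall_ex assms(3) by blast
  have "hall_join i A <#> R = A"
  proof
    show "hall_join i A <#> R \<subseteq> A" using set_mult_least[OF sA hall_join_subset[OF sA] assms(2)] .
    have "(K \<inter> A) <#> R \<subseteq> hall_join i A <#> R"
        by (rule mono_set_mult) (use hall_join_hall[OF K] in auto)
    then show "A \<subseteq> hall_join i A <#> R" using KA[OF K] by simp
  qed
  moreover have "normalizes G (sigma_residual i) (hall_join i A <#> R)"
    by (rule normalizes_set_mult[OF hall_join_subgroup R_sub(1) sigma_residual_subgroup(2)
        sigma_residual_normalizes_hall_join[OF assms(1,3)]
          normal_normalizes[OF R sigma_residual_subgroup(2)]])
  ultimately have "normalizes G (sigma_residual i) A" by simp
  then have "normalizes Q (quot ` sigma_residual i) (quot ` A)"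
      using quot_normalizes[OF sigma_residual_subgroup(2) subgroup.subset[OF sA]] by blast
  then show "normalizes Q (Qs.sigma_residual i) (quot ` A)" using normalizes_mono YY by blast
qed

end

section \<open>Refutation of diamonds from the condition on sections\<close>

context sigma_group
begin

text \<open>After \<open>diamond_reduce\<close> the sides are \<open>\<sigma> i\<close>-groups
  modulo \<open>R\<close>, so their images are admissible in the condition on sections of
  \<open>G/R\<close>. The third side \<open>C'\<close> provides the isomorphism; the condition gives
  \<open>A' = B'\<close>, hence \<open>A' = E'\<close>.\<close>

lemma diamond_trivial_sigma:
  assumes iv: "\<And>R. R \<lhd> G \<Longrightarrow> isomorphic_sections_coincide I \<sigma> (G Mod R) i"
    and "i \<in> I" "diamond A B C E T" "pi_index (\<sigma> i) E T"
  shows "A = E"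
proof (rule ccontr)
  assume "A \<noteq> E"
  then obtain A' B' C' E' T' R where d': "diamond A' B' C' E' T'" and R: "R \<lhd> G" "R \<subseteq> E'"
    and i: "pi_index (\<sigma> i) R T'" and ne: "A' \<noteq> E'" using diamond_reduce[OF assms(3,2,4)] by metis
  note d = diamondD[OF d']
  have sR: "subgroup R G" using R normal_imp_subgroup by blast
  interpret q: sigma_quot G I \<sigma> R
    using sigma_quot.intro[OF sigma_group_axioms fin_quot.intro[OF fin_group_axioms
        fin_quot_axioms.intro[OF R(1)]]] .
  have V: "q.quot ` V \<in> sigma_perm_pi_subgroups I \<sigma> (G Mod R) i"
    if "V \<in> {A', B', C', E'}" for V
  proof -
    have V: "permutable V" "subgroup V G" "V \<subseteq> T'" "R \<subseteq> V" using that d R by auto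
    have "pi_index (\<sigma> i) R V" using pi_index_split(1)[OF sR V(2) d(9) V(4,3) i] .
    then show ?thesis using q.quot_permutable_pi[OF V(1,4) assms(2)] by blast
  qed
  have le: "R \<subseteq> A'" "R \<subseteq> B'" "R \<subseteq> C'" using d R by auto
  have c: "A' \<subseteq> carrier G" "B' \<subseteq> carrier G" "C' \<subseteq> carrier G" "E' \<subseteq> carrier G" "T' \<subseteq> carrier G"
    using subgroup.subset d by auto
  have nV: "normalizes G V W" if "V \<subseteq> T'" "W \<in> {A', B', C', E'}" for V W
    using normalizes_mono[OF _ that(1)] that(2) d by auto
  have nQ: "normalizes (G Mod R) (q.quot ` V) (q.quot ` W)"
      if "V \<subseteq> T'" "W \<in> {A', B', C', E'}" for V W
    by (rule q.quot_normalizes[OF _ _ nV[OF that]]) (use that c in auto)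
  have nY: "normalizes (G Mod R) (q.Qs.sigma_residual i) (q.quot ` W)"
      if "W \<in> {A', B', C', E'}" for W
    using V[OF that] unfolding q.Qs.sigma_perm_pi_subgroups_iff q.Qs.permutable_pi_iff[OF assms(2)]
        by blast
  have CB: "C' <#> B' = T'" "C' <#> A' = T'"
    using set_mult_commute_eq[OF d(6,7,15,9)] set_mult_commute_eq[OF d(5,7,14,9)] by auto
  have "operator_isomorphic_sections (G Mod R) (q.Qs.sigma_residual i) (q.quot ` A') (q.quot ` E')
      (q.quot ` B') (q.quot ` E')"
  proof (rule q.Qs.diamond_sections_isomorphic[of _ _ "q.quot ` C'"])
    show "q.quot ` A' \<inter> q.quot ` C' = q.quot ` E'" "q.quot ` B' \<inter> q.quot ` C' = q.quot ` E'"
      using q.quot_image_Int[OF d(5) le(1) d(7) le(3)] q.quot_image_Int[OF d(6) le(2) d(7) le(3)]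
          d(11,12) by auto
    show "q.quot ` A' \<subseteq> q.quot ` C' <#>\<^bsub>G Mod R\<^esub> q.quot ` B'"
        "q.quot ` B' \<subseteq> q.quot ` C' <#>\<^bsub>G Mod R\<^esub> q.quot ` A'"
      using q.quot_set_mult[OF c(3,2)] q.quot_set_mult[OF c(3,1)] CB d(23,24) by blast+
    show "q.Qs.sigma_residual i \<subseteq> carrier (G Mod R)" by (rule q.Qs.sigma_residual_subgroup(2))
  qed (use q.quot_subgroup d nQ nY in auto)
  moreover have "q.quot ` E' \<lhd> (G Mod R)\<lparr>carrier := q.quot ` A'\<rparr>"
      "q.quot ` E' \<lhd> (G Mod R)\<lparr>carrier := q.quot ` B'\<rparr>"
    using q.Qs.normal_restrict_iff[OF q.quot_subgroup[OF d(5)] q.quot_subgroup[OF d(8)]]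
      q.Qs.normal_restrict_iff[OF q.quot_subgroup[OF d(6)] q.quot_subgroup[OF d(8)]] d nQ[of A' E']
          nQ[of B' E']
    by (auto simp: image_mono)
  ultimately have "q.quot ` A' = q.quot ` B'"
    using iv[OF R(1), unfolded isomorphic_sections_coincide_def q.Qs.pi_residual_eq[OF assms(2)],
        rule_format, OF V V V, of E' A' B'] by simp
  then have "A' = B'" using q.quot_image_eq_iff[OF d(5) le(1) d(6) le(2)] by blast
  then show False using ne d(10) by blast
qed

lemma diamond_trivial:
  assumes iv: "\<And>R i. R \<lhd> G \<Longrightarrow> i \<in> I \<Longrightarrow> isomorphic_sections_coincide I \<sigma> (G Mod R) i"
    and "diamond A B C E T"
  shows "A = E"
proof -
  note d = diamondD[OF assms(2)]
  have "pi_index (- \<sigma> i) E A" if i: "i \<in> I" for i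
  proof -
    obtain A' B' C' T' where d': "diamond A' B' C' E T'" "pi_index (\<sigma> i) E T'"
        "pi_index (- \<sigma> i) A' A"
      by (rule diamond_hall_part[OF assms(2) i])
    have "A' = E" using diamond_trivial_sigma[OF iv[OF _ i] i d'(1,2)] by blast
    then show ?thesis using d'(3) by simp
  qed
  then show ?thesis using pi_index_sigma_eq[OF d(8,5,20)] by simp
qed

end

section \<open>Operator isomorphic sections\<close>

context group
begin

text \<open>An isomorphism between \<open>H / K0\<close> and \<open>L / K0\<close> commuting with \<open>Y\<close>, as the relation \<open>\<phi> (K0 h) =
  K0 l\<close>; unlike the isomorphism it can be restricted and read modulo a larger \<open>K\<close>.\<close>

definition section_rel ::
  "'a set \<Rightarrow> 'a set \<Rightarrow> 'a set \<Rightarrow> 'a set \<Rightarrow> ('a \<Rightarrow> 'a \<Rightarrow> bool) \<Rightarrow> bool" where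
  "section_rel Y K0 H L \<rho> \<longleftrightarrow>
     (\<forall>h l. \<rho> h l \<longrightarrow> h \<in> H \<and> l \<in> L) \<and>
     (\<forall>h\<in>H. \<exists>l. \<rho> h l) \<and> (\<forall>l\<in>L. \<exists>h. \<rho> h l) \<and>
     (\<forall>h l h' l'. \<rho> h l \<longrightarrow> \<rho> h' l' \<longrightarrow> \<rho> (h \<otimes> h') (l \<otimes> l')) \<and>
     (\<forall>h l. \<rho> h l \<longrightarrow> \<rho> (inv h) (inv l)) \<and>
     (\<forall>h l. \<forall>y\<in>Y. \<rho> h l \<longrightarrow> \<rho> (conjugate G y h) (conjugate G y l)) \<and>
     (\<forall>k\<in>K0. \<forall>k'\<in>K0. \<rho> k k') \<and>
     (\<forall>h l. \<rho> h l \<longrightarrow> (h \<in> K0 \<longleftrightarrow> l \<in> K0))"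

lemma section_relD:
  assumes "section_rel Y K0 H L \<rho>"
  shows "\<rho> h l \<Longrightarrow> h \<in> H" "\<rho> h l \<Longrightarrow> l \<in> L"
    "h \<in> H \<Longrightarrow> \<exists>l. \<rho> h l" "l \<in> L \<Longrightarrow> \<exists>h. \<rho> h l"
    "\<rho> h l \<Longrightarrow> \<rho> h' l' \<Longrightarrow> \<rho> (h \<otimes> h') (l \<otimes> l')"
    "\<rho> h l \<Longrightarrow> \<rho> (inv h) (inv l)"
    "\<rho> h l \<Longrightarrow> y \<in> Y \<Longrightarrow> \<rho> (conjugate G y h) (conjugate G y l)"
    "k \<in> K0 \<Longrightarrow> k' \<in> K0 \<Longrightarrow> \<rho> k k'"
    "\<rho> h l \<Longrightarrow> h \<in> K0 \<longleftrightarrow> l \<in> K0"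
proof -
  have c: "\<forall>h l. \<rho> h l \<longrightarrow> h \<in> H \<and> l \<in> L" "\<forall>h\<in>H. \<exists>l. \<rho> h l" "\<forall>l\<in>L. \<exists>h. \<rho> h l"
    "\<forall>h l h' l'. \<rho> h l \<longrightarrow> \<rho> h' l' \<longrightarrow> \<rho> (h \<otimes> h') (l \<otimes> l')"
    "\<forall>h l. \<rho> h l \<longrightarrow> \<rho> (inv h) (inv l)"
    "\<forall>h l. \<forall>y\<in>Y. \<rho> h l \<longrightarrow> \<rho> (conjugate G y h) (conjugate G y l)"
    "\<forall>k\<in>K0. \<forall>k'\<in>K0. \<rho> k k'" "\<forall>h l. \<rho> h l \<longrightarrow> (h \<in> K0 \<longleftrightarrow> l \<in> K0)"
    using assms unfolding section_rel_def by - (elim conjE, assumption)+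
  show "\<rho> h l \<Longrightarrow> h \<in> H" "\<rho> h l \<Longrightarrow> l \<in> L" using c(1) by blast+
  show "h \<in> H \<Longrightarrow> \<exists>l. \<rho> h l" using c(2) by blast
  show "l \<in> L \<Longrightarrow> \<exists>h. \<rho> h l" using c(3) by blast
  show "\<rho> h l \<Longrightarrow> \<rho> h' l' \<Longrightarrow> \<rho> (h \<otimes> h') (l \<otimes> l')" using c(4) by blast
  show "\<rho> h l \<Longrightarrow> \<rho> (inv h) (inv l)" using c(5) by blast
  show "\<rho> h l \<Longrightarrow> y \<in> Y \<Longrightarrow> \<rho> (conjugate G y h) (conjugate G y l)" using c(6) by blast
  show "k \<in> K0 \<Longrightarrow> k' \<in> K0 \<Longrightarrow> \<rho> k k'" using c(7) by blast
  show "\<rho> h l \<Longrightarrow> h \<in> K0 \<longleftrightarrow> l \<in> K0" using c(8) by blast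
qed

lemma section_rel_converse:
  assumes "section_rel Y K0 H L \<rho>" shows "section_rel Y K0 L H (\<lambda>l h. \<rho> h l)"
  unfolding section_rel_def using section_relD[OF assms] by simp

lemma commutator_mult_left:
  "x \<in> carrier G \<Longrightarrow> y \<in> carrier G \<Longrightarrow> z \<in> carrier G \<Longrightarrow>
    commutator (x \<otimes> y) z = conjugate G y (commutator x z) \<otimes> commutator y z"
  by (simp add: commutator_def conjugate_def m_assoc inv_mult_group)

end

context fin_group
begin

text \<open>Each \<open>h\<close> is related to exactly one coset of \<open>K0\<close>, so the
  relation has \<open>card H * card K0\<close> pairs; by symmetry it has
  \<open>card L * card K0\<close>.\<close>

lemma section_rel_card:
  assumes "section_rel Y K0 H L \<rho>" "subgroup H G" "subgroup L G" "subgroup K0 G"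
  shows "card H = card L"
proof -
  have key: "card (SIGMA h:A. {l. r h l}) = card A * card K0"
    if r: "section_rel Y K0 A B r" and A: "subgroup A G" and B: "subgroup B G" for A B r
  proof -
    note d = section_relD[OF r]
    have fA: "finite A" using finite_subgroup A .
    have "card {l. r h l} = card K0" if h: "h \<in> A" for h
    proof -
      obtain l0 where l0: "r h l0" using d(3) h by blast
      have lc: "l0 \<in> carrier G" "h \<in> carrier G" using d(2)[OF l0] h subgroup.mem_carrier A B
          by metis+
      have K0c: "K0 \<subseteq> carrier G" using subgroup.subset assms(4) .
      have one: "\<one> \<in> K0" using subgroup.one_closed assms(4) .
      have "{l. r h l} = (\<lambda>k. k \<otimes> l0) ` K0"
      proof
        show "(\<lambda>k. k \<otimes> l0) ` K0 \<subseteq> {l. r h l}"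
        proof clarify
          fix k assume "k \<in> K0"
          then have "r (\<one> \<otimes> h) (k \<otimes> l0)" using d(5)[OF d(8)[OF one] l0] by blast
          then show "r h (k \<otimes> l0)" using lc by simp
        qed
        show "{l. r h l} \<subseteq> (\<lambda>k. k \<otimes> l0) ` K0"
        proof clarify
          fix l assume l: "r h l"
          have c: "l \<in> carrier G" using d(2)[OF l] subgroup.mem_carrier[OF B] by blast
          have "r (h \<otimes> inv h) (l \<otimes> inv l0)" using d(5)[OF l d(6)[OF l0]] .
          then have "l \<otimes> inv l0 \<in> K0" using d(9) one lc by fastforce
          moreover have "l = (l \<otimes> inv l0) \<otimes> l0" using c lc by (simp add: m_assoc)
          ultimately show "l \<in> (\<lambda>k. k \<otimes> l0) ` K0" by blast
        qed
      qed
      then show ?thesis using inj_on_g[OF K0c lc(1)] card_image by metis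
    qed
    moreover have "finite {l. r h l}" for h
      by (rule finite_subset[OF _ finite_subgroup[OF B]]) (use d(2) in blast)
    ultimately show ?thesis using fA by (simp add: card_SigmaI)
  qed
  have "card (SIGMA h:H. {l. \<rho> h l}) = card (SIGMA l:L. {h. \<rho> h l})"
  proof (rule bij_betw_same_card[of prod.swap])
    show "bij_betw prod.swap (SIGMA h:H. {l. \<rho> h l}) (SIGMA l:L. {h. \<rho> h l})"
      unfolding bij_betw_def using section_relD(1,2)[OF assms(1)]
      by (auto intro!: inj_onI simp: image_iff)
  qed
  then have "card H * card K0 = card L * card K0"
    using key[OF assms(1-3)] key[OF section_rel_converse[OF assms(1)] assms(3,2)] by simp
  then show ?thesis using card_subgroup_pos[OF assms(4)] by simp
qed

text \<open>For \<open>U = sigma_core i\<close> and \<open>Y = sigma_residual i\<close> these are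
  the permutable \<open>\<sigma> i\<close>-subgroups, by \<open>permutable_pi_iff\<close>.\<close>

definition inv_subgroups :: "'a set \<Rightarrow> 'a set \<Rightarrow> 'a set set" where
  "inv_subgroups U Y = {A. subgroup A G \<and> A \<subseteq> U \<and> normalizes G Y A}"

lemma inv_subgroups_Int:
  "A \<in> inv_subgroups U Y \<Longrightarrow> B \<in> inv_subgroups U Y \<Longrightarrow> A \<inter> B \<in> inv_subgroups U Y"
  unfolding inv_subgroups_def using subgroup_Int normalizes_Int by blast

text \<open>The bottom \<open>K\<close> grows in the induction while \<open>K0\<close> stays fixed.
  The induction leads to \<open>H \<inter> L = K\<close>; there the graph \<open>C\<close> of the
  relation is an invariant subgroup with \<open>H \<inter> C \<subseteq> K\<close> and
  \<open>H \<subseteq> generate G (L \<union> C)\<close>, so distributivity forces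
  \<open>H = K\<close>. The set \<open>T\<close> carries the normalization that makes
  \<open>C\<close> a subgroup.\<close>

lemma section_rel_eq:
  assumes "Y \<subseteq> carrier G" "subgroup U G"
    and dist: "\<And>A B C. A \<in> inv_subgroups U Y \<Longrightarrow> B \<in> inv_subgroups U Y \<Longrightarrow> C \<in> inv_subgroups U Y \<Longrightarrow>
      A \<inter> generate G (B \<union> C) = generate G ((A \<inter> B) \<union> (A \<inter> C))"
    and "subgroup K0 G"
    and "K \<in> inv_subgroups U Y" "H \<in> inv_subgroups U Y" "L \<in> inv_subgroups U Y"
    and "K0 \<subseteq> K" "K \<subseteq> H" "K \<subseteq> L" "H \<subseteq> T" "L \<subseteq> T"
    and nT: "\<And>V. V \<in> inv_subgroups U Y \<Longrightarrow> K \<subseteq> V \<Longrightarrow> V \<subseteq> T \<Longrightarrow> normalizes G T V"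
    and "section_rel Y K0 H L \<rho>" "\<And>h l. \<rho> h l \<Longrightarrow> h \<in> K \<longleftrightarrow> l \<in> K"
  shows "H = L"
  using assms(5-)
proof (induction "card H - card K" arbitrary: H L K \<rho> rule: less_induct)
  case less
  note IH = less.hyps
  note KHL = less.prems(1-3) and K0K = less.prems(4) and KH = less.prems(5) and KL = less.prems(6)
  note HT = less.prems(7) and LT = less.prems(8) and nT = less.prems(9) and rel = less.prems(10)
  note relK = less.prems(11)
  note d = section_relD[OF rel]
  have sK: "subgroup K G" and sH: "subgroup H G" and sL: "subgroup L G"
    using KHL unfolding inv_subgroups_def by auto
  interpret K: subgroup K G by fact
  interpret H: subgroup H G by fact
  interpret L: subgroup L G by fact
  have card: "card H = card L" using section_rel_card[OF rel sH sL assms(4)] .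
  have one: "\<rho> \<one> \<one>" using d(8) subgroup.one_closed[OF assms(4)] by blast
  show ?case
  proof (rule ccontr)
    assume ne: "H \<noteq> L"
    define M where "M = H \<inter> L"
    have M: "M \<in> inv_subgroups U Y" unfolding M_def using inv_subgroups_Int KHL by blast
    have sM: "subgroup M G" using M unfolding inv_subgroups_def by blast
    have KM: "K \<subseteq> M" unfolding M_def using KH KL by blast
    have MT: "M \<subseteq> T" unfolding M_def using HT by blast
    have "M \<noteq> H" using ne card card_subset_eq[OF finite_subgroup[OF sL], of H] unfolding M_def
        by blast
    then have cM: "card M < card H" unfolding M_def using finite_subgroup[OF sH]
        by (intro psubset_card_mono) auto
    \<comment> \<open>\<open>M'\<close> is the part of \<open>H\<close> that is related to
      \<open>M = H \<inter> L\<close>. It has the order of \<open>M\<close>, which is smaller than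
      that of \<open>H\<close>, so by induction \<open>M' = M\<close>, and the relation can be read
      modulo \<open>M\<close>.\<close>
    define M' where "M' = {h. \<exists>l\<in>M. \<rho> h l}"
    have M'H: "M' \<subseteq> H" unfolding M'_def using d(1) by blast
    have sM': "subgroup M' G"
    proof (rule subgroupI)
      show "M' \<subseteq> carrier G" using M'H H.subset by blast
      show "M' \<noteq> {}" unfolding M'_def using one subgroup.one_closed[OF sM] by blast
      fix a assume "a \<in> M'"
      then obtain l where l: "l \<in> M" "\<rho> a l" unfolding M'_def by blast
      then show "inv a \<in> M'" unfolding M'_def using d(6)[OF l(2)] subgroup.m_inv_closed[OF sM l(1)]
          by blast
      fix b assume "b \<in> M'"
      then obtain l' where l': "l' \<in> M" "\<rho> b l'" unfolding M'_def by blast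
      then show "a \<otimes> b \<in> M'"
        unfolding M'_def using d(5)[OF l(2) l'(2)] subgroup.m_closed[OF sM l(1) l'(1)] by blast
    qed
    have nYM: "normalizes G Y M" using M unfolding inv_subgroups_def by blast
    have "normalizes G Y M'"
      unfolding normalizes_def
    proof (intro ballI)
      fix y a assume y: "y \<in> Y" "a \<in> M'"
      then obtain l where l: "l \<in> M" "\<rho> a l" unfolding M'_def by blast
      then show "conjugate G y a \<in> M'" unfolding M'_def
          using d(7)[OF l(2) y(1)] normalizesD[OF nYM y(1) l(1)] by blast
    qed
    then have M': "M' \<in> inv_subgroups U Y"
      using sM' M'H KHL(2) unfolding inv_subgroups_def by blast
    have KM': "K \<subseteq> M'"
    proof
      fix k assume k: "k \<in> K"
      then obtain l where l: "\<rho> k l" using d(3) KH by blast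
      then have "l \<in> M" using relK[OF l] k KM by blast
      then show "k \<in> M'" unfolding M'_def using l by blast
    qed
    define \<rho>' where "\<rho>' h l \<longleftrightarrow> \<rho> h l \<and> l \<in> M" for h l
    have rel': "section_rel Y K0 M' M \<rho>'"
      unfolding section_rel_def
    proof (intro conjI allI ballI impI)
      fix h l assume r: "\<rho>' h l"
      then show "h \<in> M'" "l \<in> M" unfolding \<rho>'_def M'_def by blast+
      show "\<rho>' (inv h) (inv l)" using r d(6) subgroup.m_inv_closed[OF sM] unfolding \<rho>'_def by blast
      show "h \<in> K0 \<longleftrightarrow> l \<in> K0" using r d(9) unfolding \<rho>'_def by blast
      show "\<rho>' (conjugate G y h) (conjugate G y l)" if "y \<in> Y" for y
        using r d(7) normalizesD[OF nYM] that unfolding \<rho>'_def by blast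
      show "\<rho>' (h \<otimes> h') (l \<otimes> l')" if "\<rho>' h' l'" for h' l'
        using r that d(5) subgroup.m_closed[OF sM] unfolding \<rho>'_def by blast
    next
      fix h assume "h \<in> M'" then show "\<exists>l. \<rho>' h l" unfolding \<rho>'_def M'_def by blast
    next
      fix l assume l: "l \<in> M"
      then obtain h where "\<rho> h l" using d(4) unfolding M_def by blast
      then show "\<exists>h. \<rho>' h l" unfolding \<rho>'_def using l by blast
    next
      fix k k' assume "k \<in> K0" "k' \<in> K0"
      then show "\<rho>' k k'" unfolding \<rho>'_def using d(8) K0K KM by blast
    qed
    have cM': "card M' = card M" using section_rel_card[OF rel' sM' sM assms(4)] .
    have cK: "card K \<le> card M'" using card_mono[OF finite_subgroup[OF sM'] KM'] .
    have relK': "h \<in> K \<longleftrightarrow> l \<in> K" if "\<rho>' h l" for h l using relK that unfolding \<rho>'_def by blast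
    have lt: "card M' - card K < card H - card K" using cM cM' cK by linarith
    have MM: "M' = M"
      by (rule IH[OF lt KHL(1) M' M K0K KM' KM _ MT nT rel' relK']) (use M'H HT in blast)
    have relM: "h \<in> M \<longleftrightarrow> l \<in> M" if r: "\<rho> h l" for h l
    proof
      assume "l \<in> M" then show "h \<in> M" using r MM unfolding M'_def by blast
    next
      assume "h \<in> M"
      then obtain l' where l': "l' \<in> M" "\<rho> h l'" using MM unfolding M'_def by blast
      have c: "h \<in> carrier G" "l \<in> carrier G" "l' \<in> carrier G" using d(1,2)[OF r] d(2)[OF l'(2)]
          by auto
      have "\<rho> (inv h \<otimes> h) (inv l' \<otimes> l)" using d(5)[OF d(6)[OF l'(2)] r] .
      then have "inv l' \<otimes> l \<in> K" using relK c by fastforce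
      then have "l' \<otimes> (inv l' \<otimes> l) \<in> M" using KM l'(1) subgroup.m_closed[OF sM] by blast
      then show "l \<in> M" using c by simp
    qed
    show False
    proof (cases "M = K")
      case False
      then have "card K < card M" using KM finite_subgroup[OF sM] by (intro psubset_card_mono) auto
      then have lt2: "card H - card M < card H - card K" using cM by linarith
      have nTM: "normalizes G T V" if "V \<in> inv_subgroups U Y" "M \<subseteq> V" "V \<subseteq> T" for V
        by (rule nT[OF that(1) subset_trans[OF KM that(2)] that(3)])
      have MHL: "M \<subseteq> H" "M \<subseteq> L" unfolding M_def by auto
      have "H = L"
        by (rule IH[OF lt2 M KHL(2,3) subset_trans[OF K0K KM] MHL HT LT nTM rel relM])
      then show False using ne by blast
    next
      case True
      have inter: "H \<inter> L = K" using True M_def by simp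
      have nH: "normalizes G T H" and nL: "normalizes G T L" and nK: "normalizes G T K"
        using nT[OF KHL(2) KH HT] nT[OF KHL(3) KL LT] nT[OF KHL(1) subset_refl] KH HT by auto
      have nHK: "normalizes G H K" and nLK: "normalizes G L K" using normalizes_mono[OF nK] HT LT
          by auto
      have cmtK: "commutator l h \<in> K" if "h \<in> H" "l \<in> L" for h l
        using commutator_normalizes(1)[OF sL H.subset normalizes_mono[OF nL HT] that(2,1)]
          commutator_normalizes(2)[OF sH L.subset normalizes_mono[OF nH LT] that] inter by blast
      \<comment> \<open>\<open>H\<close> and \<open>L\<close> commute modulo \<open>K\<close> and
        meet in \<open>K\<close>, so \<open>C/K\<close> is the graph of the isomorphism inside the
        direct product of \<open>H/K\<close> and \<open>L/K\<close>.\<close>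
      define C where "C = {h \<otimes> l \<otimes> k | h l k. \<rho> h l \<and> k \<in> K}"
      have CI: "h \<otimes> l \<otimes> k \<in> C" if "\<rho> h l" "k \<in> K" for h l k
        unfolding C_def using that by blast
      have sC: "subgroup C G"
      proof (rule subgroupI)
        show "C \<subseteq> carrier G" unfolding C_def using d(1,2) by auto
        show "C \<noteq> {}" using CI[OF one K.one_closed] by blast
        fix a assume "a \<in> C"
        then obtain h l k where a: "a = h \<otimes> l \<otimes> k" "\<rho> h l" "k \<in> K" unfolding C_def by blast
        have hl: "h \<in> H" "l \<in> L" using d(1,2)[OF a(2)] by auto
        have c: "h \<in> carrier G" "l \<in> carrier G" "k \<in> carrier G" using hl a(3) by auto
        have hl': "h \<otimes> l = l \<otimes> h \<otimes> inv (commutator l h)"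
          using mult_commutator[OF c(2,1)] c by (simp add: m_assoc)
        define k1 where "k1 = inv (commutator l h) \<otimes> k"
        have k1: "k1 \<in> K" unfolding k1_def using cmtK[OF hl] a(3) by simp
        have k1c: "k1 \<in> carrier G" using k1 by simp
        have ea: "a = l \<otimes> h \<otimes> k1" unfolding k1_def using a(1) hl' c by (simp add: m_assoc)
        define k2 where "k2 = conjugate G (inv l) (conjugate G (inv h) (inv k1))"
        have k2: "k2 \<in> K" unfolding k2_def
          using normalizesD[OF nLK L.m_inv_closed[OF hl(2)] normalizesD[OF nHK H.m_inv_closed[OF
              hl(1)] K.m_inv_closed[OF k1]]] .
        have "inv a = inv h \<otimes> inv l \<otimes> k2"
          unfolding ea k2_def using c k1c by (simp add: conjugate_def m_assoc inv_mult_group)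
        then show "inv a \<in> C" using CI[OF d(6)[OF a(2)] k2] by simp
        fix b assume "b \<in> C"
        then obtain h' l' k' where b: "b = h' \<otimes> l' \<otimes> k'" "\<rho> h' l'" "k' \<in> K" unfolding C_def by blast
        have hl2: "h' \<in> H" "l' \<in> L" using d(1,2)[OF b(2)] by auto
        have c': "h' \<in> carrier G" "l' \<in> carrier G" "k' \<in> carrier G" using hl2 b(3) by auto
        have "a \<otimes> b = (h \<otimes> h') \<otimes> (l \<otimes> l') \<otimes> (conjugate G l' (commutator l h' \<otimes> conjugate G h' k)
            \<otimes> k')"
          unfolding a(1) b(1) using c c'
              by (simp add: conjugate_def commutator_def m_assoc inv_mult_group)
        moreover have "conjugate G l' (commutator l h' \<otimes> conjugate G h' k) \<otimes> k' \<in> K"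
          using normalizesD[OF nLK hl2(2) K.m_closed[OF cmtK[OF hl2(1) hl(2)] normalizesD[OF nHK
              hl2(1) a(3)]]] b(3) by simp
        ultimately show "a \<otimes> b \<in> C" using CI[OF d(5)[OF a(2) b(2)]] by simp
      qed
      have nYK: "normalizes G Y K" using KHL(1) unfolding inv_subgroups_def by blast
      have "normalizes G Y C"
        unfolding normalizes_def
      proof (intro ballI)
        fix y a assume y: "y \<in> Y" and "a \<in> C"
        then obtain h l k where a: "a = h \<otimes> l \<otimes> k" "\<rho> h l" "k \<in> K" unfolding C_def by blast
        have c: "h \<in> carrier G" "l \<in> carrier G" "k \<in> carrier G" "y \<in> carrier G"
          using d(1,2)[OF a(2)] a(3) y assms(1) by auto
        then have "conjugate G y a = conjugate G y h \<otimes> conjugate G y l \<otimes> conjugate G y k"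
            unfolding a(1) by (simp add: conjugate_mult)
        then show "conjugate G y a \<in> C" using CI[OF d(7)[OF a(2) y] normalizesD[OF nYK y a(3)]]
            by simp
      qed
      moreover have "C \<subseteq> U"
      proof
        fix a assume "a \<in> C"
        then obtain h l k where a: "a = h \<otimes> l \<otimes> k" "\<rho> h l" "k \<in> K" unfolding C_def by blast
        then have "h \<in> U" "l \<in> U" "k \<in> U" using d(1,2)[OF a(2)] KHL unfolding inv_subgroups_def
            by auto
        then show "a \<in> U" unfolding a(1) using subgroup.m_closed[OF assms(2)] by simp
      qed
      ultimately have C: "C \<in> inv_subgroups U Y" using sC unfolding inv_subgroups_def by blast
      have HC: "H \<inter> C \<subseteq> K"
      proof
        fix x assume x: "x \<in> H \<inter> C"
        then obtain h l k where a: "x = h \<otimes> l \<otimes> k" "\<rho> h l" "k \<in> K" unfolding C_def by blast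
        have hl: "h \<in> H" "l \<in> L" using d(1,2)[OF a(2)] by auto
        have c: "h \<in> carrier G" "l \<in> carrier G" "k \<in> carrier G" using hl a(3) by auto
        have "l = inv h \<otimes> x \<otimes> inv k" unfolding a(1) using c by (simp add: m_assoc)
        moreover have "inv k \<in> H" using a(3) KH H.m_inv_closed by blast
        ultimately have "l \<in> H" using x hl(1) by simp
        then have "l \<in> K" using hl inter by blast
        moreover then have "h \<in> K" using relK[OF a(2)] by blast
        ultimately show "x \<in> K" unfolding a(1) using a(3) by simp
      qed
      have "H \<subseteq> generate G (L \<union> C)"
      proof
        fix h assume h: "h \<in> H"
        then obtain l where l: "\<rho> h l" using d(3) by blast
        have lL: "l \<in> L" using d(2)[OF l] .
        have J: "subgroup (generate G (L \<union> C)) G" using generate_Un_subgroup[OF sL sC] .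
        have "h \<otimes> l \<otimes> \<one> \<in> generate G (L \<union> C)" using CI[OF l K.one_closed]
            by (simp add: generate.incl)
        moreover have "inv l \<in> generate G (L \<union> C)" using L.m_inv_closed[OF lL]
            by (simp add: generate.incl)
        ultimately have "h \<otimes> l \<otimes> \<one> \<otimes> inv l \<in> generate G (L \<union> C)" using subgroup.m_closed[OF J]
            by blast
        then show "h \<in> generate G (L \<union> C)" using h lL by (simp add: m_assoc)
      qed
      then have "H = generate G ((H \<inter> L) \<union> (H \<inter> C))" using dist[OF KHL(2,3) C] by blast
      also have "\<dots> \<subseteq> K" using generate_Un_least[OF sK] HC inter by blast
      finally have "H = K" using KH by blast
      then have "K = L" using card_subset_eq[OF finite_subgroup[OF sL] KL] card by simp
      then show False using ne \<open>H = K\<close> by blast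
    qed
  qed
qed

text \<open>\<open>\<rho>\<close> respects products and the action of \<open>Y\<close>, so it
  relates \<open>[h, y]\<close>, the product of \<open>inv h\<close> and the conjugate of
  \<open>h\<close> by \<open>y\<close>, to \<open>[l, y]\<close>.\<close>

lemma section_rel_generate:
  assumes "section_rel Y K0 H L \<rho>" "subgroup H G" "subgroup L G" "subgroup K0 G" "Y \<subseteq> carrier G"
    and "h \<in> generate G (K0 \<union> {commutator h y | h y. h \<in> H \<and> y \<in> Y})"
  shows "\<exists>l\<in>generate G (K0 \<union> {commutator l y | l y. l \<in> L \<and> y \<in> Y}). \<rho> h l"
proof -
  note d = section_relD[OF assms(1)]
  let ?SL = "K0 \<union> {commutator l y | l y. l \<in> L \<and> y \<in> Y}"
  have c: "?SL \<subseteq> carrier G"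
    using subgroup.subset[OF assms(3)] subgroup.subset[OF assms(4)] assms(5)
    by (auto simp: subset_iff intro!: commutator_closed)
  have J: "subgroup (generate G ?SL) G" using generate_is_subgroup[OF c] .
  have one: "\<one> \<in> K0" using subgroup.one_closed[OF assms(4)] .
  have base: "\<exists>l\<in>?SL. \<rho> h l" if hh: "h \<in> K0 \<union> {commutator h y | h y. h \<in> H \<and> y \<in> Y}" for h
  proof (cases "h \<in> K0")
    case True
    then show ?thesis using d(8)[OF True one] one by blast
  next
    case False
    then obtain u y where u: "h = commutator u y" "u \<in> H" "y \<in> Y" using hh by blast
    obtain v where v: "\<rho> u v" using d(3)[OF u(2)] by blast
    have cc: "u \<in> carrier G" "v \<in> carrier G" "y \<in> carrier G"
      using u assms(5) d(2)[OF v] subgroup.mem_carrier[OF assms(2)] subgroup.mem_carrier[OF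
          assms(3)] by blast+
    have "\<rho> (inv u \<otimes> conjugate G y u) (inv v \<otimes> conjugate G y v)"
        using d(5)[OF d(6)[OF v] d(7)[OF v u(3)]] .
    then have "\<rho> h (commutator v y)" using commutator_eq cc u(1) by simp
    then show ?thesis using d(2)[OF v] u(3) by blast
  qed
  from assms(6) show ?thesis
  proof (induction rule: generate.induct)
    case one
    then show ?case using d(8)[OF \<open>\<one> \<in> K0\<close> \<open>\<one> \<in> K0\<close>] subgroup.one_closed[OF J] by blast
  next
    case (incl h)
    then show ?case using base generate.incl[of _ ?SL G] by blast
  next
    case (inv h)
    then obtain l where "l \<in> ?SL" "\<rho> h l" using base by blast
    then show ?case using d(6) generate.inv[of l ?SL G] by blast
  next
    case (eng h1 h2)
    then obtain l1 l2 where "l1 \<in> generate G ?SL" "l2 \<in> generate G ?SL" "\<rho> h1 l1" "\<rho> h2 l2" by blast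
    then show ?case using d(5) subgroup.m_closed[OF J] by blast
  qed
qed

text \<open>Here the normalization demanded by \<open>section_rel_eq\<close> is produced. That lemma
  is applied to the commutator parts \<open>g H\<close> and \<open>g L\<close> over
  \<open>K\<close>, and then to \<open>H\<close> and \<open>L\<close> over the common subgroup
  \<open>g H = g L\<close>.\<close>

lemma section_rel_distributive_eq:
  assumes Y: "Y \<lhd> G" and U: "U \<lhd> G"
    and dist: "\<And>A B C. A \<in> inv_subgroups U Y \<Longrightarrow> B \<in> inv_subgroups U Y \<Longrightarrow> C \<in> inv_subgroups U Y \<Longrightarrow>
      A \<inter> generate G (B \<union> C) = generate G ((A \<inter> B) \<union> (A \<inter> C))"
    and KHL: "K \<in> inv_subgroups U Y" "H \<in> inv_subgroups U Y" "L \<in> inv_subgroups U Y"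
    and KH: "K \<subseteq> H" and KL: "K \<subseteq> L" and nHK: "normalizes G H K" and nLK: "normalizes G L K"
    and rel: "section_rel Y K H L \<rho>"
  shows "H = L"
proof -
  note d = section_relD[OF rel]
  have sY: "subgroup Y G" "Y \<subseteq> carrier G" and sU: "subgroup U G" "U \<subseteq> carrier G"
    using Y U normal_imp_subgroup subgroup.subset by blast+
  have sK: "subgroup K G" and sH: "subgroup H G" and sL: "subgroup L G"
    and nYK: "normalizes G Y K" and nYH: "normalizes G Y H" and nYL: "normalizes G Y L"
    and HU: "H \<subseteq> U" and LU: "L \<subseteq> U"
    using KHL unfolding inv_subgroups_def by auto
  have c: "K \<subseteq> carrier G" "H \<subseteq> carrier G" "L \<subseteq> carrier G" using subgroup.subset sK sH sL by auto
  define W where "W = U \<inter> Y"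
  have W: "W \<lhd> G" unfolding W_def using normal_subgroup_intersect U Y by blast
  have sW: "subgroup W G" "W \<subseteq> carrier G" using W normal_imp_subgroup subgroup.subset by blast+
  have WL: "W \<in> inv_subgroups U Y"
    unfolding inv_subgroups_def using sW W_def normal_normalizes[OF W sY(2)] by blast
  have cmtW: "commutator u y \<in> W" if "u \<in> U" "y \<in> Y" for u y
    unfolding W_def
    using commutator_normalizes(1)[OF sU(1) sY(2) normal_normalizes[OF U sY(2)] that]
      commutator_normalizes(2)[OF sY(1) sU(2) normal_normalizes[OF Y sU(2)] that(2,1)] by blast
  have betw: "V \<in> inv_subgroups U Y"
    if "subgroup V G" "V \<subseteq> U" "\<And>v y. v \<in> V \<Longrightarrow> y \<in> Y \<Longrightarrow> commutator v y \<in> V" for V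
    unfolding inv_subgroups_def normalizes_def
  proof (intro CollectI conjI ballI)
    fix y v assume v: "y \<in> Y" "v \<in> V"
    then have "conjugate G y v = v \<otimes> commutator v y" using that(2) sU(2) sY(2)
        by (intro conjugate_eq_commutator) auto
    then show "conjugate G y v \<in> V" using that v subgroup.m_closed[OF that(1)] by simp
  qed (use that in auto)
  \<comment> \<open>As \<open>[U, Y] \<subseteq> W\<close>, every subgroup between \<open>W\<close>
    and \<open>U\<close> is invariant under \<open>Y\<close>, so the interval is distributive and
    \<open>U/W\<close> abelian. Since \<open>W \<subseteq> Y\<close> normalizes all invariant
    subgroups, this yields \<open>HL = LH\<close>.\<close>
  have UW: "commutator x y \<in> W" if "x \<in> U" "y \<in> U" for x y
  proof (rule distributive_interval_commutator[OF sW(1) sU(1) _ normal_normalizes[OF W sU(2)] _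
      that])
    show "W \<subseteq> U" unfolding W_def by blast
    fix V1 V2 V3 assume V: "subgroup V1 G" "subgroup V2 G" "subgroup V3 G" "W \<subseteq> V1" "W \<subseteq> V2"
        "W \<subseteq> V3"
      "V1 \<subseteq> U" "V2 \<subseteq> U" "V3 \<subseteq> U"
    have "V1 \<in> inv_subgroups U Y" by (rule betw[OF V(1,7)]) (use V(4,7) cmtW in blast)
    moreover have "V2 \<in> inv_subgroups U Y" by (rule betw[OF V(2,8)]) (use V(5,8) cmtW in blast)
    moreover have "V3 \<in> inv_subgroups U Y" by (rule betw[OF V(3,9)]) (use V(6,9) cmtW in blast)
    ultimately show "V1 \<inter> generate G (V2 \<union> V3) = generate G ((V1 \<inter> V2) \<union> (V1 \<inter> V3))" using dist
        by blast
  qed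
  have nW: "normalizes G W V" if "V \<in> inv_subgroups U Y" for V
    using that normalizes_mono[of G Y V W] unfolding inv_subgroups_def W_def by blast
  have HL: "H <#> L = L <#> H"
  proof (rule set_mult_commute_of_distrib[OF sH sL sW(1) nW[OF KHL(3)]])
    show "commutator b a \<in> W" if "a \<in> H" "b \<in> L" for a b using UW that HU LU by blast
    show "W \<inter> generate G (H \<union> L) = generate G ((W \<inter> H) \<union> (W \<inter> L))" using dist[OF WL KHL(2,3)] .
  qed
  text \<open>\<open>H\<close> and \<open>L\<close> have the same commutators with \<open>Y\<close>, and modulo these \<open>Y\<close> acts trivially on
    \<open>HL\<close>.\<close>
  define cs where "cs V = {commutator v y | v y. v \<in> V \<and> y \<in> Y}" for V
  define g where "g V = generate G (K \<union> cs V)" for V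
  have csc: "K \<union> cs V \<subseteq> carrier G" if "V \<subseteq> carrier G" for V
    using that c(1) sY(2) unfolding cs_def by (auto simp: subset_iff intro!: commutator_closed)
  have gprops: "g V \<in> inv_subgroups U Y \<and> K \<subseteq> g V \<and> g V \<subseteq> V \<and> normalizes G V (g V)
      \<and> (\<forall>v\<in>V. \<forall>y\<in>Y. commutator v y \<in> g V)
      \<and> (\<forall>Z. Z \<in> inv_subgroups U Y \<longrightarrow> K \<subseteq> Z \<longrightarrow> normalizes G (g V) Z)"
    if V: "V \<in> {H, L}" for V
  proof -
    have V': "subgroup V G" "V \<subseteq> carrier G" "V \<subseteq> U" "normalizes G Y V" "K \<subseteq> V" "normalizes G V K"
      using V sH sL c HU LU nYH nYL KH KL nHK nLK by auto
    have sg: "subgroup (g V) G" unfolding g_def using generate_is_subgroup[OF csc[OF V'(2)]] .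
    have Kg: "K \<subseteq> g V" and cg: "\<And>v y. v \<in> V \<Longrightarrow> y \<in> Y \<Longrightarrow> commutator v y \<in> g V"
      unfolding g_def cs_def by (blast intro: generate.incl)+
    have csV: "cs V \<subseteq> V" unfolding cs_def using commutator_normalizes(1)[OF V'(1) sY(2) V'(4)]
        by blast
    have gV: "g V \<subseteq> V" unfolding g_def using generate_Un_least[OF V'(1,5) csV] .
    have "g V \<in> inv_subgroups U Y"
      by (rule betw[OF sg]) (use gV V'(3) cg in blast)+
    moreover have "normalizes G V (g V)"
      unfolding g_def
    proof (rule normalizes_generate_right[OF V'(2) csc[OF V'(2)]])
      fix x s assume x: "x \<in> V" and s: "s \<in> K \<union> cs V"
      show "conjugate G x s \<in> generate G (K \<union> cs V)"
      proof (cases "s \<in> K")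
        case True
        then show ?thesis using normalizesD[OF V'(6) x True] Kg unfolding g_def by blast
      next
        case False
        then obtain v y where v: "s = commutator v y" "v \<in> V" "y \<in> Y" using s unfolding cs_def
            by blast
        have cc: "v \<in> carrier G" "x \<in> carrier G" "y \<in> carrier G" using v x V'(2) sY(2) by auto
        \<comment> \<open>The identity \<open>[vx, y] = [v, y]^x [x, y]\<close> is solved for the
          conjugate.\<close>
        have "conjugate G x s = commutator (v \<otimes> x) y \<otimes> inv (commutator x y)"
          unfolding v(1) commutator_mult_left[OF cc] using cc by (simp add: m_assoc)
        moreover have "commutator (v \<otimes> x) y \<in> g V" "inv (commutator x y) \<in> g V"
          using cg[OF subgroup.m_closed[OF V'(1) v(2) x] v(3)] cg[OF x v(3)]
              subgroup.m_inv_closed[OF sg] by auto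
        ultimately show ?thesis using subgroup.m_closed[OF sg] unfolding g_def by simp
      qed
    qed
    moreover have "normalizes G (g V) Z" if Z: "Z \<in> inv_subgroups U Y" "K \<subseteq> Z" for Z
      unfolding g_def
    proof (rule normalizes_generate_left[OF csc[OF V'(2)]])
      have sZ: "subgroup Z G" "normalizes G Y Z" using Z unfolding inv_subgroups_def by auto
      show "Z \<subseteq> carrier G" using subgroup.subset[OF sZ(1)] .
      have "cs V \<subseteq> Y" unfolding cs_def using cmtW V'(3) W_def by blast
      then show "normalizes G (K \<union> cs V) Z"
        using normalizes_self[OF sZ(1) Z(2)] sZ(2) unfolding normalizes_def by blast
    qed
    ultimately show ?thesis using Kg gV cg by blast
  qed
  have gH: "g H \<in> inv_subgroups U Y" "K \<subseteq> g H" "g H \<subseteq> H" "normalizes G H (g H)"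
    "\<And>v y. v \<in> H \<Longrightarrow> y \<in> Y \<Longrightarrow> commutator v y \<in> g H"
    "\<And>Z. Z \<in> inv_subgroups U Y \<Longrightarrow> K \<subseteq> Z \<Longrightarrow> normalizes G (g H) Z" using gprops[of H] by simp_all
  have gL: "g L \<in> inv_subgroups U Y" "K \<subseteq> g L" "g L \<subseteq> L" "normalizes G L (g L)"
    "\<And>v y. v \<in> L \<Longrightarrow> y \<in> Y \<Longrightarrow> commutator v y \<in> g L"
    "\<And>Z. Z \<in> inv_subgroups U Y \<Longrightarrow> K \<subseteq> Z \<Longrightarrow> normalizes G (g L) Z" using gprops[of L] by simp_all
  have sgH: "subgroup (g H) G" and sgL: "subgroup (g L) G"
    using gH(1) gL(1) unfolding inv_subgroups_def by auto
  have toL: "\<exists>l\<in>g L. \<rho> h l" if "h \<in> g H" for h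
    using section_rel_generate[OF rel sH sL sK sY(2)] that unfolding g_def cs_def by blast
  have toH: "\<exists>h\<in>g H. \<rho> h l" if "l \<in> g L" for l
    using section_rel_generate[OF section_rel_converse[OF rel] sL sH sK sY(2)] that
    unfolding g_def cs_def by blast
  define \<rho>1 where "\<rho>1 h l \<longleftrightarrow> \<rho> h l \<and> h \<in> g H \<and> l \<in> g L" for h l
  have rel1: "section_rel Y K (g H) (g L) \<rho>1"
    unfolding section_rel_def
  proof (intro conjI allI ballI impI)
    fix h l assume r: "\<rho>1 h l"
    then show "h \<in> g H" "l \<in> g L" unfolding \<rho>1_def by blast+
    show "\<rho>1 (inv h) (inv l)"
      using r d(6) subgroup.m_inv_closed[OF sgH] subgroup.m_inv_closed[OF sgL] unfolding \<rho>1_def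
          by blast
    show "h \<in> K \<longleftrightarrow> l \<in> K" using r d(9) unfolding \<rho>1_def by blast
    have nY: "normalizes G Y (g H)" "normalizes G Y (g L)" using gH(1) gL(1)
        unfolding inv_subgroups_def by auto
    show "\<rho>1 (conjugate G y h) (conjugate G y l)" if "y \<in> Y" for y
      using r d(7) normalizesD[OF nY(1)] normalizesD[OF nY(2)] that unfolding \<rho>1_def by blast
    show "\<rho>1 (h \<otimes> h') (l \<otimes> l')" if "\<rho>1 h' l'" for h' l'
      using r that d(5) subgroup.m_closed[OF sgH] subgroup.m_closed[OF sgL] unfolding \<rho>1_def
          by blast
  next
    fix h assume "h \<in> g H" then show "\<exists>l. \<rho>1 h l" using toL unfolding \<rho>1_def by blast
  next
    fix l assume "l \<in> g L" then show "\<exists>h. \<rho>1 h l" using toH unfolding \<rho>1_def by blast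
  next
    fix k k' assume "k \<in> K" "k' \<in> K"
    then show "\<rho>1 k k'" unfolding \<rho>1_def using d(8) gH(2) gL(2) by blast
  qed
  \<comment> \<open>\<open>T\<close> becomes the union \<open>g H \<union> g L\<close>. Both parts
    are generated by elements of \<open>K\<close> and of \<open>Y\<close>, so they normalize every
    invariant subgroup above \<open>K\<close>.\<close>
  have eq1: "g H = g L"
  proof (rule section_rel_eq[OF sY(2) sU(1) dist sK KHL(1) gH(1) gL(1) subset_refl gH(2) gL(2) _ _ _
      rel1])
    show "g H \<subseteq> g H \<union> g L" "g L \<subseteq> g H \<union> g L" by auto
    show "normalizes G (g H \<union> g L) V" if "V \<in> inv_subgroups U Y" "K \<subseteq> V" for V
      using gH(6)[OF that] gL(6)[OF that] unfolding normalizes_def by blast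
    show "h \<in> K \<longleftrightarrow> l \<in> K" if "\<rho>1 h l" for h l using d(9) that unfolding \<rho>1_def by blast
  qed
  define T where "T = H <#> L"
  have sT: "subgroup T G" unfolding T_def using set_mult_subgroup[OF sH sL] HL by simp
  have Tc: "T \<subseteq> carrier G" using subgroup.subset[OF sT] .
  have HT: "H \<subseteq> T" and LT: "L \<subseteq> T" unfolding T_def using set_mult_upper[OF sH sL] by auto
  have TU: "T \<subseteq> U" unfolding T_def using set_mult_least[OF sU(1) HU LU] .
  have nT: "normalizes G T (g H)"
    unfolding T_def using normalizes_set_mult_left[OF sH sL subgroup.subset[OF sgH] gH(4)] gL(4) eq1
        by simp
  have Tcm: "commutator t y \<in> g H" if t: "t \<in> T" and y: "y \<in> Y" for t y
  proof -
    obtain h l where hl: "h \<in> H" "l \<in> L" "t = h \<otimes> l" using t unfolding T_def by (rule set_multE)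
    have cc: "h \<in> carrier G" "l \<in> carrier G" "y \<in> carrier G" using hl c y sY(2) by auto
    have "conjugate G l (commutator h y) \<in> g H" using normalizesD[OF nT] LT hl(2) gH(5)[OF hl(1) y]
        by blast
    moreover have "commutator l y \<in> g H" using gL(5)[OF hl(2) y] eq1 by simp
    ultimately show ?thesis unfolding hl(3) commutator_mult_left[OF cc]
        using subgroup.m_closed[OF sgH] by blast
  qed
  \<comment> \<open>\<open>Y\<close> acts trivially on \<open>T\<close> modulo \<open>g H\<close>,
    so all subgroups in between are invariant, the interval is distributive, and \<open>T\<close> is
    abelian modulo \<open>g H\<close>.\<close>
  have TT: "commutator x y \<in> g H" if "x \<in> T" "y \<in> T" for x y
  proof (rule distributive_interval_commutator[OF sgH sT _ nT _ that])
    show "g H \<subseteq> T" using gH(3) HT by blast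
    fix V1 V2 V3 assume V: "subgroup V1 G" "subgroup V2 G" "subgroup V3 G" "g H \<subseteq> V1"
        "g H \<subseteq> V2" "g H \<subseteq> V3"
      "V1 \<subseteq> T" "V2 \<subseteq> T" "V3 \<subseteq> T"
    have "V1 \<in> inv_subgroups U Y" by (rule betw[OF V(1)]) (use V(4,7) TU Tcm in blast)+
    moreover have "V2 \<in> inv_subgroups U Y" by (rule betw[OF V(2)]) (use V(5,8) TU Tcm in blast)+
    moreover have "V3 \<in> inv_subgroups U Y" by (rule betw[OF V(3)]) (use V(6,9) TU Tcm in blast)+
    ultimately show "V1 \<inter> generate G (V2 \<union> V3) = generate G ((V1 \<inter> V2) \<union> (V1 \<inter> V3))" using dist
        by blast
  qed
  have relg: "h \<in> g H \<longleftrightarrow> l \<in> g H" if r: "\<rho> h l" for h l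
  proof
    have cc: "h \<in> carrier G" "l \<in> carrier G" using d(1,2)[OF r] c by auto
    have one: "\<one> \<in> K" using subgroup.one_closed[OF sK] .
    show "l \<in> g H" if h: "h \<in> g H"
    proof -
      obtain l' where l': "l' \<in> g L" "\<rho> h l'" using toL[OF h] by blast
      have c': "l' \<in> carrier G" using l' gL(3) c by blast
      have "\<rho> (inv h \<otimes> h) (inv l' \<otimes> l)" using d(5)[OF d(6)[OF l'(2)] r] .
      then have "inv l' \<otimes> l \<in> K" using d(9) one cc by fastforce
      then have "l' \<otimes> (inv l' \<otimes> l) \<in> g L" using gL(2) l'(1) subgroup.m_closed[OF sgL] by blast
      then show "l \<in> g H" using cc c' eq1 by simp
    qed
    show "h \<in> g H" if l: "l \<in> g H"
    proof -
      obtain h' where h': "h' \<in> g H" "\<rho> h' l" using toH l eq1 by blast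
      have c': "h' \<in> carrier G" using h' gH(3) c by blast
      have "\<rho> (inv h' \<otimes> h) (inv l \<otimes> l)" using d(5)[OF d(6)[OF h'(2)] r] .
      then have "inv h' \<otimes> h \<in> K" using d(9) one cc by fastforce
      then have "h' \<otimes> (inv h' \<otimes> h) \<in> g H" using gH(2) h'(1) subgroup.m_closed[OF sgH] by blast
      then show "h \<in> g H" using cc c' by simp
    qed
  qed
  show ?thesis
  proof (rule section_rel_eq[OF sY(2) sU(1) dist sK gH(1) KHL(2,3) gH(2,3) _ HT LT _ rel relg])
    show "g H \<subseteq> L" using eq1 gL(3) by simp
    show "normalizes G T V" if V: "V \<in> inv_subgroups U Y" "g H \<subseteq> V" "V \<subseteq> T" for V
    proof -
      have "subgroup V G" using V(1) unfolding inv_subgroups_def by blast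
      then show ?thesis using commutator_normalizes_between[OF _ Tc V(2,3) TT] by blast
    qed
  qed
qed

end

context sigma_group
begin

text \<open>The isomorphism of cosets is turned into a relation between elements, to which
  \<open>section_rel_distributive_eq\<close> applies.\<close>

lemma isomorphic_sections_coincide_of_distrib:
  assumes i: "i \<in> I"
    and dist: "\<And>A B C. \<lbrakk>A \<in> sigma_perm_pi_subgroups I \<sigma> G i; B \<in> sigma_perm_pi_subgroups I \<sigma> G i;
        C \<in> sigma_perm_pi_subgroups I \<sigma> G i\<rbrakk> \<Longrightarrow>
      A \<inter> generate G (B \<union> C) = generate G ((A \<inter> B) \<union> (A \<inter> C))"
  shows "isomorphic_sections_coincide I \<sigma> G i"
proof -
  let ?Y = "sigma_residual i" and ?U = "sigma_core i"
  have eq: "sigma_perm_pi_subgroups I \<sigma> G i = inv_subgroups ?U ?Y"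
    by (rule Set.set_eqI) (simp add: sigma_perm_pi_subgroups_iff permutable_pi_iff[OF i]
        inv_subgroups_def)
  show ?thesis
    unfolding isomorphic_sections_coincide_def pi_residual_eq[OF i] eq
  proof (intro ballI impI)
    fix K H L
    assume KHL: "K \<in> inv_subgroups ?U ?Y" "H \<in> inv_subgroups ?U ?Y" "L \<in> inv_subgroups ?U ?Y"
      and a: "K \<lhd> G\<lparr>carrier := H\<rparr> \<and> K \<lhd> G\<lparr>carrier := L\<rparr> \<and> operator_isomorphic_sections G ?Y H K L K"
    have sK: "subgroup K G" and sH: "subgroup H G" and sL: "subgroup L G" and nYK:
        "normalizes G ?Y K"
      and nYH: "normalizes G ?Y H" and nYL: "normalizes G ?Y L"
      using KHL unfolding inv_subgroups_def by auto
    have KH: "K \<subseteq> H" and KL: "K \<subseteq> L"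
      using a normal_imp_subgroup[of K] subgroup.subset[of K] by fastforce+
    have nHK: "normalizes G H K" and nLK: "normalizes G L K"
      using a normal_restrict_iff[OF sH sK KH] normal_restrict_iff[OF sL sK KL] by auto
    obtain \<phi> where \<phi>: "\<phi> \<in> iso (section_group G H K) (section_group G L K)"
      and eqv: "\<And>C y. C \<in> carrier (section_group G H K) \<Longrightarrow> y \<in> ?Y \<Longrightarrow>
        \<phi> (section_conj G K C y) = section_conj G K (\<phi> C) y"
      using a unfolding operator_isomorphic_sections_def by blast
    have cH: "H \<subseteq> carrier G" and cL: "L \<subseteq> carrier G" and cK: "K \<subseteq> carrier G"
      using subgroup.subset sH sL sK by auto
    have bij: "bij_betw \<phi> ((\<lambda>h. K #> h) ` H) ((\<lambda>l. K #> l) ` L)"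
      using \<phi> unfolding iso_def section_carrier by blast
    have hm: "\<phi> (K #> (h \<otimes> h')) = \<phi> (K #> h) \<otimes>\<^bsub>section_group G L K\<^esub> \<phi> (K #> h')"
        if "h \<in> H" "h' \<in> H" for h h'
      using hom_mult[of \<phi> "section_group G H K" "section_group G L K" "K #> h" "K #> h'"] \<phi> that
        section_mult[OF sH sK KH nHK that] unfolding iso_def section_carrier by auto
    define \<rho> where "\<rho> h l \<longleftrightarrow> h \<in> H \<and> l \<in> L \<and> \<phi> (K #> h) = K #> l" for h l
    have mult: "\<rho> (h \<otimes> h') (l \<otimes> l')" if r: "\<rho> h l" "\<rho> h' l'" for h l h' l'
    proof -
      have m: "h \<in> H" "h' \<in> H" "l \<in> L" "l' \<in> L" using r unfolding \<rho>_def by auto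
      then have "\<phi> (K #> (h \<otimes> h')) = K #> (l \<otimes> l')"
        using hm[OF m(1,2)] r section_mult[OF sL sK KL nLK m(3,4)] unfolding \<rho>_def by simp
      then show ?thesis unfolding \<rho>_def using m subgroup.m_closed[OF sH] subgroup.m_closed[OF sL]
          by simp
    qed
    have Kk: "K #> k = K" if "k \<in> K" for k using coset_join2[OF _ sK that] that cK by blast
    \<comment> \<open>If \<open>\<one>\<close> is related to \<open>l\<close>, then it is also
      related to \<open>l \<otimes> l\<close>; so \<open>l\<close> and \<open>l \<otimes> l\<close>
      lie in one coset, and \<open>l \<in> K\<close>.\<close>
    have "\<phi> K = K"
    proof -
      have oneH: "\<one> \<in> H" and oneK: "\<one> \<in> K" using subgroup.one_closed sH sK by auto
      have "\<phi> (K #> \<one>) \<in> (\<lambda>l. K #> l) ` L" using bij oneH unfolding bij_betw_def by blast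
      then obtain l where l: "l \<in> L" "\<phi> (K #> \<one>) = K #> l" by blast
      then have "\<rho> \<one> l" unfolding \<rho>_def using oneH by simp
      then have "\<rho> (\<one> \<otimes> \<one>) (l \<otimes> l)" using mult by blast
      then have "K #> l = K #> (l \<otimes> l)" using l unfolding \<rho>_def by simp
      moreover have lc: "l \<in> carrier G" using l cL by blast
      ultimately have "l \<otimes> inv (l \<otimes> l) \<in> K" using rcos_eq_iff[OF sK, of l "l \<otimes> l"] by simp
      then have "inv l \<in> K" using lc by (simp add: inv_mult_group)
      then have "l \<in> K" using subgroup.m_inv_closed[OF sK] lc by fastforce
      then show ?thesis using l Kk oneK by simp
    qed
    have rK: "h \<in> K \<longleftrightarrow> l \<in> K" if r: "\<rho> h l" for h l
    proof -
      have m: "h \<in> H" "l \<in> L" "\<phi> (K #> h) = K #> l" using r unfolding \<rho>_def by auto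
      have mc: "h \<in> carrier G" "l \<in> carrier G" using m cH cL by auto
      have KK: "K = K #> \<one>" using Kk subgroup.one_closed[OF sK] by simp
      have inj: "inj_on \<phi> ((\<lambda>h. K #> h) ` H)" using bij unfolding bij_betw_def by blast
      have KinH: "K \<in> (\<lambda>h. K #> h) ` H" using KK subgroup.one_closed[OF sH] by blast
      have iff: "K #> x = K \<longleftrightarrow> x \<in> K" if "x \<in> carrier G" for x
        using rcos_eq_iff[OF sK that one_closed] KK that by simp
      have "h \<in> K \<longleftrightarrow> K #> h = K" using iff mc by simp
      also have "\<dots> \<longleftrightarrow> \<phi> (K #> h) = \<phi> K" using inj_on_eq_iff[OF inj _ KinH] m(1) by blast
      also have "\<dots> \<longleftrightarrow> K #> l = K" using m(3) \<open>\<phi> K = K\<close> by simp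
      also have "\<dots> \<longleftrightarrow> l \<in> K" using iff mc by simp
      finally show ?thesis .
    qed
    have exL: "\<exists>l. \<rho> h l" if "h \<in> H" for h
    proof -
      have "\<phi> (K #> h) \<in> (\<lambda>l. K #> l) ` L" using bij that unfolding bij_betw_def by blast
      then show ?thesis unfolding \<rho>_def using that by blast
    qed
    have rel: "section_rel ?Y K H L \<rho>"
      unfolding section_rel_def
    proof (intro conjI allI ballI impI)
      fix h l assume r: "\<rho> h l"
      then show m: "h \<in> H" "l \<in> L" unfolding \<rho>_def by blast+
      have mc: "h \<in> carrier G" "l \<in> carrier G" using m cH cL by auto
      show "\<rho> (inv h) (inv l)"
      proof -
        have ih: "inv h \<in> H" using subgroup.m_inv_closed[OF sH m(1)] .
        obtain l' where l': "\<rho> (inv h) l'" using exL[OF ih] by blast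
        have l'L: "l' \<in> L" using l' unfolding \<rho>_def by blast
        have l'c: "l' \<in> carrier G" using l'L cL by blast
        have "\<rho> (inv h \<otimes> h) (l' \<otimes> l)" using mult[OF l' r] .
        then have "l' \<otimes> l \<in> K" using rK subgroup.one_closed[OF sK] mc by fastforce
        then have "K #> l' = K #> inv l" using rcos_eq_iff[OF sK l'c, of "inv l"] mc by simp
        then show ?thesis using l' subgroup.m_inv_closed[OF sL m(2)] unfolding \<rho>_def by simp
      qed
      show "h \<in> K \<longleftrightarrow> l \<in> K" using rK[OF r] .
      show "\<rho> (conjugate G y h) (conjugate G y l)" if y: "y \<in> ?Y" for y
      proof -
        have yc: "y \<in> carrier G" using y sigma_residual_subgroup(2) by blast
        have ny: "normalizes G {y} K" using normalizes_mono[OF nYK] y by blast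
        have "\<phi> (section_conj G K (K #> h) y) = section_conj G K (\<phi> (K #> h)) y"
          by (rule eqv[OF _ y]) (use m in \<open>simp add: section_carrier\<close>)
        then have "\<phi> (K #> conjugate G y h) = K #> conjugate G y l"
          using section_conj_rcos[OF sK _ yc ny] mc r unfolding \<rho>_def by simp
        then show ?thesis
          unfolding \<rho>_def using normalizesD[OF nYH y m(1)] normalizesD[OF nYL y m(2)] by simp
      qed
      show "\<rho> (h \<otimes> h') (l \<otimes> l')" if "\<rho> h' l'" for h' l' using mult[OF r that] .
    next
      fix h assume "h \<in> H" then show "\<exists>l. \<rho> h l" using exL by blast
    next
      fix l assume l: "l \<in> L"
      then have "K #> l \<in> \<phi> ` ((\<lambda>h. K #> h) ` H)" using bij unfolding bij_betw_def by blast
      then obtain h where "h \<in> H" "K #> l = \<phi> (K #> h)" by blast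
      then show "\<exists>h. \<rho> h l" unfolding \<rho>_def using l by metis
    next
      fix k k' assume k: "k \<in> K" "k' \<in> K"
      then show "\<rho> k k'" unfolding \<rho>_def using Kk \<open>\<phi> K = K\<close> KH KL by auto
    qed
    show "H = L"
      by (rule section_rel_distributive_eq[OF sigma_residual_normal sigma_core_normal _ KHL KH KL
          nHK nLK rel])
        (use dist eq in blast)
  qed
qed

end

section \<open>The nilpotent residual\<close>

context group
begin

lemma cyclic_group_iff_generate: "cyclic_group G \<longleftrightarrow> (\<exists>x\<in>carrier G. generate G {x} = carrier G)"
proof -
  have "generate G {x} = range (\<lambda>n::int. x [^] n)" if "x \<in> carrier G" for x
    using generate_pow[OF that] by (simp add: full_SetCompr_eq)
  then show ?thesis unfolding cyclic_group by (metis (no_types, lifting))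
qed

end

context sigma_group
begin

text \<open>\<open>{carrier G}\<close> is a complete Hall set and a direct decomposition with one
  factor.\<close>

lemma sigma_nilpotent_of_pi_group:
  assumes "i \<in> I" "pi_number (\<sigma> i) (order G)"
  shows "sigma_nilpotent I \<sigma> G"
proof -
  have hall: "hall_subgroup G (\<sigma> i) (carrier G)"
    unfolding hall_subgroup_iff using subgroup_self assms(2) by (simp add: order_def)
  have "complete_hall_set I \<sigma> G {carrier G}"
    unfolding complete_hall_set_def
  proof (intro conjI ballI impI)
    fix j assume j: "j \<in> I" "\<sigma> j \<inter> group_primes G \<noteq> {}"
    then obtain p where p: "p \<in> \<sigma> j" "Factorial_Ring.prime p" "p dvd order G"
      unfolding group_primes_def by blast
    then have "p \<in> \<sigma> i" using assms(2) unfolding pi_number_def by blast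
    then have "j = i" using sigma_disjoint[OF j(1) assms(1)] p by blast
    then show "\<exists>!H. H \<in> {carrier G} \<and> hall_subgroup G (\<sigma> j) H" using hall by auto
  qed (use subgroup_self hall assms(1) in auto)
  moreover have "internal_direct_product G {carrier G}"
    unfolding internal_direct_product_def
    using normal_self generate_subgroup_incl[OF subset_refl subgroup_self]
    by (auto simp: generate_empty intro: generate.incl)
  ultimately show ?thesis unfolding sigma_nilpotent_def by blast
qed

text \<open>Let \<open>K\<close> be the Hall \<open>\<sigma> i\<close>-factor and \<open>N\<close>
  the product of the others. \<open>N\<close> is normal of \<open>\<sigma> i\<close>-index, so it
  contains \<open>sigma_residual i\<close> and with it \<open>nilp_residual\<close>; its order is
  prime to \<open>\<sigma> i\<close>. Over all \<open>i\<close>, no prime can divide the order of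
  \<open>nilp_residual\<close>.\<close>

lemma nilp_residual_of_sigma_nilpotent:
  assumes "sigma_nilpotent I \<sigma> G" shows "nilp_residual = {\<one>}"
proof -
  obtain \<H> where H: "complete_hall_set I \<sigma> G \<H>" "internal_direct_product G \<H>"
    using assms unfolding sigma_nilpotent_def by blast
  have n: "K \<lhd> G" if "K \<in> \<H>" for K using H(2) that unfolding internal_direct_product_def by blast
  have sD: "subgroup nilp_residual G" using nilp_residual_normal normal_imp_subgroup by blast
  have oneD: "{\<one>} \<subseteq> nilp_residual" using subgroup.one_closed[OF sD] by simp
  have "{\<one>} = nilp_residual"
  proof (rule pi_index_sigma_eq[OF triv_subgroup sD oneD])
    fix i assume i: "i \<in> I"
    show "pi_index (- \<sigma> i) {\<one>} nilp_residual"
    proof (cases "\<sigma> i \<inter> group_primes G = {}")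
      case True
      then have "pi_number (- \<sigma> i) (card (carrier G))"
        unfolding group_primes_def pi_number_def order_def by blast
      then have "pi_number (- \<sigma> i) (card nilp_residual)"
        using pi_number_card_sub[OF sD subgroup_self nilp_residual_subset(2)] by blast
      then show ?thesis using pi_index_card[OF triv_subgroup sD oneD] by blast
    next
      case False
      have "\<exists>!K. K \<in> \<H> \<and> hall_subgroup G (\<sigma> i) K"
        using H(1) i False unfolding complete_hall_set_def by simp
      then obtain K where K: "K \<in> \<H>" "hall_subgroup G (\<sigma> i) K" by blast
      have sK: "subgroup K G" using hallD(1) K by blast
      define N where "N = generate G (\<Union>(\<H> - {K}))"
      have c: "\<Union>(\<H> - {K}) \<subseteq> carrier G"
      proof
        fix x assume "x \<in> \<Union>(\<H> - {K})"
        then obtain J where J: "J \<in> \<H>" "x \<in> J" by blast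
        then show "x \<in> carrier G" using subgroup.mem_carrier[OF normal_imp_subgroup[OF n[OF J(1)]]]
            by blast
      qed
      have N: "N \<lhd> G"
        unfolding N_def
      proof (rule normal_generateI[OF c])
        fix h g assume "h \<in> \<Union>(\<H> - {K})" and g: "g \<in> carrier G"
        then obtain J where J: "J \<in> \<H>" "J \<noteq> K" "h \<in> J" by blast
        then have "g \<otimes> h \<otimes> inv g \<in> J" using normal.inv_op_closed2[OF n[OF J(1)] g] by blast
        then show "g \<otimes> h \<otimes> inv g \<in> \<Union>(\<H> - {K})" using J by blast
      qed
      have sN: "subgroup N G" using N normal_imp_subgroup by blast
      have KN1: "K \<inter> N = {\<one>}" using H(2) K(1) unfolding internal_direct_product_def N_def by blast
      have comm: "K <#> N = N <#> K" and sKN: "subgroup (K <#> N) G"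
        using normal_commute[OF n[OF K(1)] sN] by auto
      have "carrier G = generate G (\<Union>\<H>)" using H(2) unfolding internal_direct_product_def by simp
      also have "\<dots> \<subseteq> K <#> N"
      proof (rule generate_subgroup_incl[OF _ sKN])
        have "\<Union>(\<H> - {K}) \<subseteq> N" unfolding N_def by (blast intro: generate.incl)
        then show "\<Union>\<H> \<subseteq> K <#> N" using set_mult_upper[OF sK sN] by blast
      qed
      finally have KN: "K <#> N = carrier G" using subgroup.subset[OF sKN] by blast
      have "pi_index (\<sigma> i) (K \<inter> N) K"
        using pi_index_card[OF subgroup_Int[OF sK sN] sK _ hallD(2)[OF K(2)]] by blast
      then have "pi_index (\<sigma> i) N (carrier G)" using pi_index_set_mult_iff[OF sK sN] KN by simp
      then have "sigma_residual i \<subseteq> N" using sigma_residual_least[OF N _ i] by blast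
      then have DN: "nilp_residual \<subseteq> N" using nilp_residual_subset(1)[OF i] by blast
      have "pi_index (- \<sigma> i) K (N <#> K)" using hallD(3)[OF K(2)] KN comm by simp
      then have "pi_index (- \<sigma> i) {\<one>} N"
        using pi_index_set_mult_iff[OF sN sK] KN1 by (simp add: Int_commute)
      then show ?thesis using pi_index_split(1)[OF triv_subgroup sD sN oneD DN] by blast
    qed
  qed
  then show ?thesis by simp
qed

end

context sigma_quot
begin

lemma preimage_normal: assumes "V \<lhd> Q" shows "preimage V \<lhd> G"
  unfolding normal_iff_normalizes
proof
  have V: "subgroup V Q" "normalizes Q (carrier Q) V" using assms Qs.normal_iff_normalizes by auto
  show "subgroup (preimage V) G" using preimage_subgroup V by blast
  show "normalizes G (carrier G) (preimage V)"
    unfolding normalizes_def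
  proof (intro ballI)
    fix x a assume x: "x \<in> carrier G" and a: "a \<in> preimage V"
    then have ac: "a \<in> carrier G" "quot a \<in> V" unfolding preimage_def by auto
    have "quot x \<in> carrier Q" using x Q_carrier by blast
    then have "conjugate Q (quot x) (quot a) \<in> V" using normalizesD[OF V(2) _ ac(2)] by blast
    then have "quot (conjugate G x a) \<in> V" using quot_conjugate[OF x ac(1)] by simp
    then show "conjugate G x a \<in> preimage V" unfolding preimage_def using x ac by simp
  qed
qed

lemma quot_sigma_residual: assumes "i \<in> I" shows "quot ` sigma_residual i \<subseteq> Qs.sigma_residual i"
proof -
  let ?V = "preimage (Qs.sigma_residual i)"
  have s: "subgroup (Qs.sigma_residual i) Q" "Qs.sigma_residual i \<subseteq> carrier Q"
      using Qs.sigma_residual_subgroup by auto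
  have sV: "subgroup ?V G" "R \<subseteq> ?V" using preimage_subgroup[OF s(1)] R_le_preimage[OF s(1)] by auto
  have "pi_index (\<sigma> i) (quot ` ?V) (quot ` carrier G)"
    using Qs.sigma_residual_index[OF assms] quot_preimage[OF s(2)] Q_carrier by simp
  then have "pi_index (\<sigma> i) ?V (carrier G)"
    using pi_index_quot[OF sV subgroup_self R_sub(2)] by blast
  then have "sigma_residual i \<subseteq> ?V"
      using sigma_residual_least[OF preimage_normal[OF Qs.sigma_residual_normal] _ assms] by blast
  then show ?thesis unfolding preimage_def by blast
qed

lemma nilp_residual_le_of_sigma_nilpotent:
  assumes "sigma_nilpotent I \<sigma> Q" shows "nilp_residual \<subseteq> R"
proof
  fix x assume x: "x \<in> nilp_residual"
  have xc: "x \<in> carrier G" using x nilp_residual_subset(2) by blast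
  have "quot x \<in> Qs.sigma_residual j" if "j \<in> I" for j
      using quot_sigma_residual[OF that] x nilp_residual_subset(1)[OF that] by blast
  moreover have "quot x \<in> carrier Q" using xc Q_carrier by blast
  ultimately have "quot x \<in> Qs.nilp_residual" unfolding Qs.nilp_residual_def by blast
  then have "quot x \<in> quot ` R" using Qs.nilp_residual_of_sigma_nilpotent[OF assms] quot_R by simp
  then show "x \<in> R" using quot_mem_iff[OF R_sub(1) subset_refl xc] by blast
qed

end

context sigma_group
begin

lemma sigma_quotI: "R \<lhd> G \<Longrightarrow> sigma_quot G I \<sigma> R"
  using sigma_quot.intro[OF sigma_group_axioms fin_quot.intro[OF fin_group_axioms
      fin_quot_axioms.intro]] .

text \<open>Each \<open>G / sigma_residual j\<close> is a \<open>\<sigma> j\<close>-group, hence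
  sigma-nilpotent; this gives one inclusion. For the other, the residuals of \<open>G\<close> map
  into those of \<open>G/N\<close>, whose intersection is trivial when \<open>G/N\<close> is
  sigma-nilpotent.\<close>

lemma sigma_nilpotent_residual_eq: "sigma_nilpotent_residual I \<sigma> G = nilp_residual"
  unfolding sigma_nilpotent_residual_def
proof
  show "nilp_residual \<subseteq> \<Inter>{N. N \<lhd> G \<and> sigma_nilpotent I \<sigma> (G Mod N)}"
    using sigma_quot.nilp_residual_le_of_sigma_nilpotent[OF sigma_quotI] by blast
  have mem: "sigma_residual j \<in> {N. N \<lhd> G \<and> sigma_nilpotent I \<sigma> (G Mod N)}" if j: "j \<in> I" for j
  proof -
    interpret q: sigma_quot G I \<sigma> "sigma_residual j" using sigma_quotI[OF sigma_residual_normal] .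
    have "pi_group (\<sigma> j) (G Mod sigma_residual j)"
        using pi_group_Mod_iff[OF sigma_residual_normal] sigma_residual_index[OF j] by blast
    then have "sigma_nilpotent I \<sigma> (G Mod sigma_residual j)"
      using q.Qs.sigma_nilpotent_of_pi_group[OF j] unfolding pi_group_def by blast
    then show ?thesis using sigma_residual_normal by blast
  qed
  obtain i where i: "i \<in> I" using prime_in_sigma[OF two_is_prime_nat] by blast
  show "\<Inter>{N. N \<lhd> G \<and> sigma_nilpotent I \<sigma> (G Mod N)} \<subseteq> nilp_residual"
  proof
    fix x assume x: "x \<in> \<Inter>{N. N \<lhd> G \<and> sigma_nilpotent I \<sigma> (G Mod N)}"
    have xY: "x \<in> sigma_residual j" if "j \<in> I" for j using InterD[OF x mem[OF that]] .
    moreover have "x \<in> carrier G" using xY[OF i] sigma_residual_subgroup(2) by blast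
    ultimately show "x \<in> nilp_residual" unfolding nilp_residual_def by blast
  qed
qed

text \<open>For a Hall subgroup \<open>K\<close> the product of \<open>K\<close> with \<open>nilp_residual\<close> is the intersection of the
  other \<open>sigma_residual j\<close>, hence normal.\<close>

lemma permutable_of_nilp_residual_le:
  assumes V: "subgroup V G" and DV: "nilp_residual \<subseteq> V" shows "permutable V"
  unfolding permutable_def
proof (intro conjI ballI allI impI)
  show "subgroup V G" by fact
  fix i K assume i: "i \<in> I" and K: "hall_subgroup G (\<sigma> i) K"
  have sK: "subgroup K G" using hallD(1) K .
  have sD: "subgroup nilp_residual G" using nilp_residual_normal normal_imp_subgroup by blast
  define Z where "Z = carrier G \<inter> (\<Inter>j\<in>I - {i}. sigma_residual j)"
  have eq: "Z = \<Inter>(insert (carrier G) (sigma_residual ` (I - {i})))" unfolding Z_def by simp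
  have "subgroup J G" if "J \<in> insert (carrier G) (sigma_residual ` (I - {i}))" for J
    using that sigma_residual_subgroup(1) subgroup_self by blast
  then have sZ: "subgroup Z G" unfolding eq by (rule subgroups_Inter) auto
  have nZ: "normalizes G (carrier G) Z"
    unfolding normalizes_def
  proof (intro ballI)
    fix x a assume x: "x \<in> carrier G" and a: "a \<in> Z"
    have "conjugate G x a \<in> sigma_residual j" if "j \<in> I - {i}" for j
      using sigma_residual_normal[of j] that a x
          unfolding Z_def normal_iff_normalizes normalizes_def by blast
    then show "conjugate G x a \<in> Z" using x a unfolding Z_def by simp
  qed
  have ZY: "Z \<inter> sigma_residual i = nilp_residual" unfolding Z_def nilp_residual_def using i by blast
  have "pi_index (\<sigma> i) (Z \<inter> sigma_residual i) Z"
    using pi_index_inter[OF sZ sigma_residual_subgroup(1) subgroup_self subgroup.subset[OF sZ]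
        sigma_residual_subgroup(2) _ sigma_residual_index[OF i]]
      normal_commute(1)[OF sigma_residual_normal sZ] by simp
  then have 1: "pi_index (\<sigma> i) nilp_residual Z" using ZY by simp
  have "K \<subseteq> sigma_residual j" if "j \<in> I - {i}" for j
    by (rule hall_le_sigma_residual[OF i _ K]) (use that in auto)
  then have KZ: "K \<subseteq> Z" unfolding Z_def using subgroup.subset[OF sK] by blast
  have DZ: "nilp_residual \<subseteq> Z" using ZY by blast
  let ?P = "K <#> nilp_residual"
  have sP: "subgroup ?P G" using normal_commute(3)[OF nilp_residual_normal sK] .
  have PZ: "?P \<subseteq> Z" using set_mult_least[OF sZ KZ DZ] .
  have up: "K \<subseteq> ?P" "nilp_residual \<subseteq> ?P" using set_mult_upper[OF sK sD] by auto
  have "pi_index (\<sigma> i) ?P Z" using pi_index_split(2)[OF sD sP sZ up(2) PZ 1] .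
  moreover have "pi_index (- \<sigma> i) ?P Z"
      using pi_index_split(2)[OF sK sP sZ up(1) PZ hall_index[OF K sZ KZ]] .
  ultimately have PeqZ: "?P = Z" using pi_index_eq[OF sP sZ PZ] by blast
  have "V <#> K \<subseteq> K <#> V"
  proof
    fix z assume "z \<in> V <#> K"
    then obtain v k where z: "v \<in> V" "k \<in> K" "z = v \<otimes> k" by (rule set_multE)
    have c: "v \<in> carrier G" "k \<in> carrier G"
        using z subgroup.mem_carrier[OF V] subgroup.mem_carrier[OF sK] by auto
    \<comment> \<open>Moving \<open>k\<close> past \<open>v\<close> conjugates it inside the normal
      subgroup \<open>Z\<close>, which is \<open>K\<close> times the residual; the factor in the
      residual is absorbed by \<open>V\<close>.\<close>
    have "conjugate G (inv v) k \<in> Z" using normalizesD[OF nZ _ subsetD[OF KZ z(2)]] c by simp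
    then have "conjugate G (inv v) k \<in> K <#> nilp_residual" using PeqZ by simp
    then obtain k' d where d: "k' \<in> K" "d \<in> nilp_residual" "conjugate G (inv v) k = k' \<otimes> d"
        by (rule set_multE)
    have cd: "k' \<in> carrier G" "d \<in> carrier G"
        using d subgroup.mem_carrier[OF sK] subgroup.mem_carrier[OF sD] by auto
    have "z = conjugate G (inv v) k \<otimes> v" using z(3) c by (simp add: conjugate_def m_assoc)
    also have "\<dots> = k' \<otimes> (d \<otimes> v)" using d(3) c cd by (simp add: m_assoc)
    finally show "z \<in> K <#> V"
      using set_multI[OF d(1) subgroup.m_closed[OF V subsetD[OF DV d(2)] z(1)]] by simp
  qed
  then show "V <#> K = K <#> V" using set_mult_commuteI[OF sK V] by simp
qed

end

section \<open>Cyclic factor groups\<close>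

context fin_quot
begin

lemma cyclic_Mod_iff: "cyclic_group (G Mod R) \<longleftrightarrow> (\<exists>t\<in>carrier G. generate G (R \<union> {t}) = carrier G)"
proof -
  interpret q: fin_group Q using Q_fin .
  have "generate Q {quot t} = carrier Q \<longleftrightarrow> generate G (R \<union> {t}) = carrier G"
      if t: "t \<in> carrier G" for t
  proof -
    have c: "R \<union> {t} \<subseteq> carrier G" using t R_sub by blast
    have sg: "subgroup (generate G (R \<union> {t})) G" using generate_is_subgroup[OF c] .
    have Rg: "R \<subseteq> generate G (R \<union> {t})" by (rule generate_Un_upper)
    have prt: "{quot t} \<subseteq> carrier Q" using t Q_carrier by blast
    have "quot ` generate G (R \<union> {t}) = generate Q ({\<one>\<^bsub>Q\<^esub>} \<union> {quot t})"
      using quot_generate[OF c] quot_R by (simp add: image_Un)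
    also have "\<dots> = generate Q {quot t}"
    proof
      show "generate Q ({\<one>\<^bsub>Q\<^esub>} \<union> {quot t}) \<subseteq> generate Q {quot t}"
        by (rule q.generate_Un_least[OF q.generate_is_subgroup[OF prt]])
          (auto intro: generate.incl generate.one simp del: one_FactGroup)
      show "generate Q {quot t} \<subseteq> generate Q ({\<one>\<^bsub>Q\<^esub>} \<union> {quot t})" by (rule q.mono_generate) blast
    qed
    finally have "quot ` generate G (R \<union> {t}) = generate Q {quot t}" .
    then show ?thesis
      using quot_image_eq_iff[OF sg Rg subgroup_self R_sub(2)] Q_carrier by simp
  qed
  then have "(\<exists>t\<in>carrier G. generate Q {quot t} = carrier Q) \<longleftrightarrow>
      (\<exists>t\<in>carrier G. generate G (R \<union> {t}) = carrier G)" by simp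
  moreover have "(\<exists>x\<in>quot ` carrier G. P x) \<longleftrightarrow> (\<exists>t\<in>carrier G. P (quot t))" for P by simp
  ultimately show ?thesis unfolding q.cyclic_group_iff_generate using Q_carrier by simp
qed

end

context fin_group
begin

lemma fin_quotI: "R \<lhd> G \<Longrightarrow> fin_quot G R"
  using fin_quot.intro[OF fin_group_axioms fin_quot_axioms.intro] .

text \<open>In a cyclic group a subgroup is determined by its order. With \<open>m = |G : V|\<close>
  the image of \<open>t [^] m\<close> in \<open>G/V\<close> is trivial, so
  \<open>W \<subseteq> V\<close>. Conversely \<open>G/W\<close> is generated by the image of
  \<open>t\<close>, whose order divides \<open>m\<close>; so \<open>W\<close> is not smaller than
  \<open>V\<close>.\<close>

lemma cyclic_quotient_subgroup:
  assumes R: "R \<lhd> G" and t: "t \<in> carrier G" "generate G (R \<union> {t}) = carrier G"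
    and V: "subgroup V G" "R \<subseteq> V"
  shows "V = generate G (R \<union> {t [^] (card (carrier G) div card V)})"
proof -
  define m where "m = card (carrier G) div card V"
  define W where "W = generate G (R \<union> {t [^] m})"
  have sR: "subgroup R G" "R \<subseteq> carrier G" using R normal_imp_subgroup subgroup.subset by blast+
  have nR: "normalizes G (carrier G) R" using R normal_iff_normalizes by blast
  have comm: "commutator x y \<in> R" if "x \<in> carrier G" "y \<in> carrier G" for x y
  proof (rule commutator_all_generate[OF sR(1)])
    show "R \<union> {t} \<subseteq> carrier G" using t sR by blast
    show "normalizes G (generate G (R \<union> {t})) R" using nR t by simp
    show "x \<in> generate G (R \<union> {t})" "y \<in> generate G (R \<union> {t})" using that t by auto
    fix q r assume q: "q \<in> R \<union> {t}" "r \<in> R \<union> {t}"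
    then have qc: "q \<in> carrier G" "r \<in> carrier G" using t sR by auto
    consider "q \<in> R" | "r \<in> R" | "q = t" "r = t" using q by blast
    then show "commutator q r \<in> R"
    proof cases
      case 1 then show ?thesis using commutator_normalizes(1)[OF sR(1) subset_refl nR] qc by blast
    next
      case 2 then show ?thesis using commutator_normalizes(2)[OF sR(1) subset_refl nR] qc by blast
    next
      case 3 then show ?thesis using commutator_one(2)[OF t(1)] subgroup.one_closed[OF sR(1)]
          by simp
    qed
  qed
  have nor: "Z \<lhd> G" if "subgroup Z G" "R \<subseteq> Z" for Z
    using commutator_normalizes_between[OF that(1) subset_refl that(2) subgroup.subset[OF that(1)]
        comm] that normal_iff_normalizes by blast
  interpret v: fin_quot G V using fin_quotI[OF nor[OF V]] .
  interpret vq: fin_group "G Mod V" using v.Q_fin .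
  have cv: "card (carrier (G Mod V)) * card V = card (carrier G)"
    using v.card_quot[OF subgroup_self v.R_sub(2)] v.Q_carrier by simp
  then have m: "order (G Mod V) = m" unfolding m_def order_def
    using card_subgroup_pos[OF V(1)] by (metis div_mult_self_is_m)
  have tm: "t [^] m \<in> carrier G" using t by simp
  have "v.quot t [^]\<^bsub>G Mod V\<^esub> m = \<one>\<^bsub>G Mod V\<^esub>"
    using vq.pow_order_eq_1[of "v.quot t"] v.Q_carrier t(1) m by simp
  then have "v.quot (t [^] m) \<in> v.quot ` V"
    using group_hom.hom_nat_pow[OF v.quot_hom t(1), of m] v.quot_R by simp
  then have tV: "t [^] m \<in> V" using v.quot_mem_iff[OF V(1) subset_refl tm] by blast
  have Wc: "R \<union> {t [^] m} \<subseteq> carrier G" using sR tm by blast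
  have sW: "subgroup W G" unfolding W_def using generate_is_subgroup[OF Wc] .
  have RW: "R \<subseteq> W" unfolding W_def by (rule generate_Un_upper)
  have WV: "W \<subseteq> V" unfolding W_def by (rule generate_Un_least[OF V(1,2)]) (use tV in blast)
  interpret w: fin_quot G W using fin_quotI[OF nor[OF sW RW]] .
  interpret wq: fin_group "G Mod W" using w.Q_fin .
  have cw: "card (carrier (G Mod W)) * card W = card (carrier G)"
    using w.card_quot[OF subgroup_self w.R_sub(2)] w.Q_carrier by simp
  have prt: "w.quot t \<in> carrier (G Mod W)" using t w.Q_carrier by blast
  have "generate G (W \<union> {t}) = carrier G"
  proof
    have c: "W \<union> {t} \<subseteq> carrier G" using subgroup.subset[OF sW] t by blast
    show "generate G (W \<union> {t}) \<subseteq> carrier G" using generate_incl[OF c] .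
    have "generate G (R \<union> {t}) \<subseteq> generate G (W \<union> {t})" by (rule mono_generate) (use RW in blast)
    then show "carrier G \<subseteq> generate G (W \<union> {t})" using t by simp
  qed
  moreover have "w.quot ` generate G (W \<union> {t}) = generate (G Mod W) ({\<one>\<^bsub>G Mod W\<^esub>} \<union> {w.quot t})"
    using w.quot_generate[of "W \<union> {t}"] w.quot_R subgroup.subset[OF sW] t by (simp add: image_Un)
  ultimately have "carrier (G Mod W) = generate (G Mod W) ({\<one>\<^bsub>G Mod W\<^esub>} \<union> {w.quot t})"
    using w.Q_carrier by simp
  also have "\<dots> \<subseteq> generate (G Mod W) {w.quot t}"
    by (rule wq.generate_Un_least[OF wq.generate_is_subgroup])
      (use prt in \<open>auto intro: generate.incl generate.one simp del: one_FactGroup\<close>)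
  finally have "carrier (G Mod W) = generate (G Mod W) {w.quot t}"
    using wq.generate_incl[of "{w.quot t}"] prt by blast
  then have ordc: "card (carrier (G Mod W)) = wq.ord (w.quot t)"
    using wq.generate_pow_card[OF prt] by simp
  have "t [^] m \<in> W" unfolding W_def by (simp add: generate.incl)
  then have "w.quot (t [^] m) \<in> {\<one>\<^bsub>G Mod W\<^esub>}" unfolding w.quot_R[symmetric] by blast
  then have "w.quot t [^]\<^bsub>G Mod W\<^esub> m = \<one>\<^bsub>G Mod W\<^esub>"
    using group_hom.hom_nat_pow[OF w.quot_hom t(1), of m] by simp
  then have dv: "wq.ord (w.quot t) dvd m" using wq.pow_eq_id[OF prt] by blast
  have "m > 0" using m vq.order_gt_0_iff_finite vq.fin by simp
  then have "card (carrier (G Mod W)) \<le> m" using dv ordc dvd_imp_le by simp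
  then have "m * card V \<le> m * card W"
    using cv cw m unfolding order_def by (metis mult_le_mono1)
  then have "card V \<le> card W" using \<open>m > 0\<close> by simp
  then have "W = V" using card_seteq[OF finite_subgroup[OF V(1)] WV] by blast
  then show ?thesis unfolding W_def m_def by simp
qed

end

lemma (in group) set_lattice_generate:
  assumes "\<And>A. A \<in> S \<Longrightarrow> subgroup A G" "\<And>A B. A \<in> S \<Longrightarrow> B \<in> S \<Longrightarrow> A \<inter> B \<in> S"
    and "\<And>A B. A \<in> S \<Longrightarrow> B \<in> S \<Longrightarrow> generate G (A \<union> B) \<in> S"
  shows "set_lattice S (\<lambda>A B. generate G (A \<union> B))"
proof
  fix A B C assume "C \<in> S" "A \<subseteq> C" "B \<subseteq> C"
  then show "generate G (A \<union> B) \<subseteq> C" using generate_Un_least[OF assms(1)] by blast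
qed (use assms(2,3) generate_Un_upper in auto)

section \<open>The two implications\<close>

context sigma_group
begin

lemma permutable_lattice: "set_lattice {A. permutable A} (\<lambda>A B. generate G (A \<union> B))"
  by (rule set_lattice_generate) (use permutableD(1) permutable_Int permutable_generate in auto)

lemma sigma_perm_lattice_eq: "sigma_perm_lattice I \<sigma> G = inclusion_order {A. permutable A}"
  unfolding sigma_perm_lattice_def sigma_permutable_iff ..

lemma nilp_residual_permutable: "permutable nilp_residual"
    using normal_permutable[OF nilp_residual_normal] .

context
  assumes dist: "\<And>A B C. permutable A \<Longrightarrow> permutable B \<Longrightarrow> permutable C \<Longrightarrow>
    A \<inter> generate G (B \<union> C) = generate G ((A \<inter> B) \<union> (A \<inter> C))"
begin

lemma dist_cyclic: "cyclic_group (G Mod nilp_residual)"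
proof -
  have sD: "subgroup nilp_residual G" using nilp_residual_normal normal_imp_subgroup by blast
  have "\<exists>t\<in>carrier G. generate G (nilp_residual \<union> {t}) = carrier G"
    by (rule distributive_interval_cyclic[OF sD subgroup_self nilp_residual_subset(2)])
      (use dist permutable_of_nilp_residual_le in blast)
  then show ?thesis using fin_quot.cyclic_Mod_iff[OF fin_quotI[OF nilp_residual_normal]] by blast
qed

lemma dist_permute:
  assumes "permutable A" "permutable B" shows "A <#> B = B <#> A"
proof -
  have sD: "subgroup nilp_residual G" using nilp_residual_normal normal_imp_subgroup by blast
  have s: "subgroup A G" "subgroup B G" using assms permutableD(1) by auto
  have cm: "commutator x y \<in> nilp_residual" if "x \<in> carrier G" "y \<in> carrier G" for x y
    by (rule distributive_interval_commutator[OF sD subgroup_self nilp_residual_subset(2)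
        normal_normalizes[OF nilp_residual_normal subset_refl] _ that])
      (use dist permutable_of_nilp_residual_le in blast)
  show ?thesis
    by (rule set_mult_commute_of_distrib[OF s sD nilp_residual_normalizes[OF assms(2)] _ dist[OF
        nilp_residual_permutable assms]])
      (use cm s[THEN subgroup.subset] in blast)
qed

lemma dist_normal_lattice: "distributive (normal_lattice G)"
proof -
  interpret N: set_lattice "{N. N \<lhd> G}" "\<lambda>A B. generate G (A \<union> B)"
  proof (rule set_lattice_generate)
    fix A B assume "A \<in> {N. N \<lhd> G}" "B \<in> {N. N \<lhd> G}"
    then have n: "A \<lhd> G" "B \<lhd> G" by auto
    have s: "subgroup A G" "subgroup B G" using n normal_imp_subgroup by auto
    show "generate G (A \<union> B) \<in> {N. N \<lhd> G}"
      using set_mult_eq_generate[OF s normal_commute(1)[OF n(1) s(2)]] normal_set_mult_normal[OF n]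
          by simp
  qed (use normal_imp_subgroup normal_subgroup_intersect in auto)
  show ?thesis
    unfolding normal_lattice_def N.LS_distributive using dist normal_permutable by blast
qed

text \<open>Preimages of permutable subgroups of \<open>G/R\<close> are permutable, and preimages
  respect intersections and joins. So distributivity descends to \<open>G/R\<close>.\<close>

lemma dist_sections:
  assumes "R \<lhd> G" "i \<in> I" shows "isomorphic_sections_coincide I \<sigma> (G Mod R) i"
proof -
  interpret q: sigma_quot G I \<sigma> R using sigma_quotI[OF assms(1)] .
  show ?thesis
  proof (rule q.Qs.isomorphic_sections_coincide_of_distrib[OF assms(2)])
    fix A B C
    assume "A \<in> sigma_perm_pi_subgroups I \<sigma> (G Mod R) i"
        "B \<in> sigma_perm_pi_subgroups I \<sigma> (G Mod R) i"
      "C \<in> sigma_perm_pi_subgroups I \<sigma> (G Mod R) i"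
    then have p: "q.Qs.permutable A" "q.Qs.permutable B" "q.Qs.permutable C"
      unfolding q.Qs.sigma_perm_pi_subgroups_iff by auto
    have s: "subgroup A (G Mod R)" "subgroup B (G Mod R)" "subgroup C (G Mod R)"
        using q.Qs.permutableD(1) p by auto
    have sI: "subgroup (A \<inter> B) (G Mod R)" "subgroup (A \<inter> C) (G Mod R)" using q.Qs.subgroup_Int s
        by auto
    have sl: "subgroup (A \<inter> generate (G Mod R) (B \<union> C)) (G Mod R)"
      "subgroup (generate (G Mod R) ((A \<inter> B) \<union> (A \<inter> C))) (G Mod R)"
      using q.Qs.subgroup_Int[OF s(1) q.Qs.generate_Un_subgroup[OF s(2,3)]]
          q.Qs.generate_Un_subgroup[OF sI] by auto
    have "q.preimage (A \<inter> generate (G Mod R) (B \<union> C)) = q.preimage A \<inter> generate G (q.preimage B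
        \<union> q.preimage C)"
      using q.preimage_Int q.preimage_generate[OF s(2,3)] by simp
    also have "\<dots> = generate G ((q.preimage A \<inter> q.preimage B) \<union> (q.preimage A \<inter> q.preimage C))"
      using dist q.preimage_permutable p by blast
    also have "\<dots> = q.preimage (generate (G Mod R) ((A \<inter> B) \<union> (A \<inter> C)))"
      using q.preimage_Int q.preimage_generate[OF sI] by simp
    finally have "q.quot ` q.preimage (A \<inter> generate (G Mod R) (B \<union> C)) = q.quot ` q.preimage
        (generate (G Mod R) ((A \<inter> B) \<union> (A \<inter> C)))"
      by simp
    then show "A \<inter> generate (G Mod R) (B \<union> C) = generate (G Mod R) ((A \<inter> B) \<union> (A \<inter> C))"
      using q.quot_preimage[OF subgroup.subset[OF sl(1)]] q.quot_preimage[OF subgroup.subset[OF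
          sl(2)]] by simp
  qed
qed

end

text \<open>Refuting the diamonds inside the residual \<open>D\<close> gives
  \<open>D \<inter> A = D \<inter> B = D \<inter> T = D \<inter> E\<close>. By the product formula
  \<open>A\<close> and \<open>B\<close> have equal order, so \<open>DA\<close> and \<open>DB\<close>
  have equal order and coincide, as \<open>G/D\<close> is cyclic. An element of \<open>B\<close>
  then differs from one of \<open>A\<close> by an element of
  \<open>D \<inter> T \<subseteq> A\<close>, whence \<open>B \<subseteq> A\<close>.\<close>

lemma distributive_of_conditions:
  assumes perm: "\<And>A B. permutable A \<Longrightarrow> permutable B \<Longrightarrow> A <#> B = B <#> A"
    and cyc: "cyclic_group (G Mod nilp_residual)"
    and md: "\<And>B C. permutable B \<Longrightarrow> permutable C \<Longrightarrow>
      nilp_residual \<inter> generate G (B \<union> C) = generate G ((nilp_residual \<inter> B) \<union> (nilp_residual \<inter> C))"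
    and iv: "\<And>R i. R \<lhd> G \<Longrightarrow> i \<in> I \<Longrightarrow> isomorphic_sections_coincide I \<sigma> (G Mod R) i"
    and "permutable a" "permutable b" "permutable c"
  shows "a \<inter> generate G (b \<union> c) = generate G ((a \<inter> b) \<union> (a \<inter> c))"
proof (rule ccontr)
  assume neq: "a \<inter> generate G (b \<union> c) \<noteq> generate G ((a \<inter> b) \<union> (a \<inter> c))"
  let ?J = "\<lambda>A B. generate G (A \<union> B)"
  interpret S: set_lattice "{A. permutable A}" ?J using permutable_lattice .
  have J: "?J A B = A <#> B" if "permutable A" "permutable B" for A B
    using set_mult_eq_generate[OF permutableD(1)[OF that(1)] permutableD(1)[OF that(2)] perm[OF
        that]] .
  have mod: "?J A B \<inter> C = ?J A (B \<inter> C)"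
    if "A \<in> {A. permutable A}" "B \<in> {A. permutable A}" "C \<in> {A. permutable A}" "A \<subseteq> C" for A B C
  proof -
    have p: "permutable A" "permutable B" "permutable C" "permutable (B \<inter> C)"
        using that permutable_Int by auto
    have "(A <#> B) \<inter> C = A <#> (B \<inter> C)"
      using dedekind[OF permutableD(1)[OF p(1)] permutableD(1)[OF p(3)] that(4) subgroup.subset[OF
          permutableD(1)[OF p(2)]]] .
    then show ?thesis using J p by simp
  qed
  obtain A B C E where d: "A \<in> {A. permutable A}" "B \<in> {A. permutable A}" "C \<in> {A. permutable A}"
    "A \<inter> B = E" "A \<inter> C = E" "B \<inter> C = E" "?J A B = ?J B C" "?J A C = ?J B C" "A \<noteq> E"
    by (rule S.diamond_exists[OF mod, of a b c]) (use assms(5-7) neq in auto)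
  define T where "T = ?J B C"
  have p: "permutable A" "permutable B" "permutable C" "permutable E" using d permutable_Int by auto
  have T: "A <#> B = T" "A <#> C = T" "B <#> C = T" using d(7,8) J p unfolding T_def by auto
  have s: "subgroup A G" "subgroup B G" "subgroup C G" "subgroup E G" using p permutableD(1) by auto
  have pT: "permutable T" unfolding T_def using permutable_generate p by blast
  have sD: "subgroup nilp_residual G" using permutableD(1) nilp_residual_permutable .
  let ?D = "\<lambda>V. nilp_residual \<inter> V"
  have pD: "permutable (?D V)" if "permutable V" for V
      using permutable_Int[OF nilp_residual_permutable that] .
  have DJ: "?D U <#> ?D V = ?D T" if "permutable U" "permutable V" "?J U V = T" for U V
    using md[OF that(1,2)] J[OF pD pD] that by simp
  have JT: "?J A B = T" "?J A C = T" "?J B C = T" "?J B A = T"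
    using d(7,8) unfolding T_def by (auto simp: Un_commute)
  have nD: "normalizes G (?D T) (?D V)" if "permutable V" for V
    using normalizes_mono[OF nilp_residual_normalizes[OF pD[OF that]]] by blast
  have dia1: "diamond (?D A) (?D B) (?D C) (?D E) (?D T)"
    unfolding diamond_def
        using pD p d(4-6) DJ[OF p(1,2) JT(1)] DJ[OF p(1,3) JT(2)] DJ[OF p(2,3) JT(3)] nD by blast
  \<comment> \<open>\<open>diamond_trivial\<close> concerns the first side, so the diamond is used
    with two orders of its sides.\<close>
  have dia2: "diamond (?D B) (?D A) (?D C) (?D E) (?D T)"
    unfolding diamond_def
        using pD p d(4-6) DJ[OF p(2,1) JT(4)] DJ[OF p(1,3) JT(2)] DJ[OF p(2,3) JT(3)] nD by blast
  have DA: "?D A = ?D E" using diamond_trivial[OF iv dia1] .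
  have DB: "?D B = ?D E" using diamond_trivial[OF iv dia2] .
  have DT: "?D T = ?D E"
    using DJ[OF p(1,2) JT(1)] DA DB subgroup_mult_id[OF permutableD(1)[OF pD[OF p(4)]]] by simp
  have cT: "card T * card E = card A * card B" "card T * card E = card A * card C"
    "card T * card E = card B * card C"
    using card_set_mult[OF s(1,2)] card_set_mult[OF s(1,3)] card_set_mult[OF s(2,3)] T d(4-6)
        by auto
  have pos: "card C > 0" using card_subgroup_pos s by blast
  have "card A * card C = card B * card C" by (rule trans[OF cT(2)[symmetric] cT(3)])
  then have cAB: "card A = card B" using pos by simp
  have cD: "card (nilp_residual <#> V) * card (?D E) = card nilp_residual * card V"
      if "permutable V" "?D V = ?D E" for V
    using card_set_mult[OF sD permutableD(1)[OF that(1)]] that(2) by simp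
  have posE: "card (?D E) > 0" using card_subgroup_pos permutableD(1)[OF pD[OF p(4)]] by blast
  have "card (nilp_residual <#> A) * card (?D E) = card (nilp_residual <#> B) * card (?D E)"
    using cD[OF p(1) DA] cD[OF p(2) DB] cAB by simp
  then have cDD: "card (nilp_residual <#> A) = card (nilp_residual <#> B)" using posE by simp
  obtain t where t: "t \<in> carrier G" "generate G (nilp_residual \<union> {t}) = carrier G"
    using cyc fin_quot.cyclic_Mod_iff[OF fin_quotI[OF nilp_residual_normal]] by blast
  have DAB: "nilp_residual <#> A = nilp_residual <#> B"
    using cyclic_quotient_subgroup[OF nilp_residual_normal t normal_commute(2)[OF
        nilp_residual_normal s(1)] set_mult_upper(1)[OF sD s(1)]]
      cyclic_quotient_subgroup[OF nilp_residual_normal t normal_commute(2)[OF nilp_residual_normal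
          s(2)] set_mult_upper(1)[OF sD s(2)]]
      cDD by simp
  have "B \<subseteq> A"
  proof
    fix z assume z: "z \<in> B"
    have sT: "subgroup T G" using permutableD(1) pT .
    have AT: "A \<subseteq> T" "B \<subseteq> T" using set_mult_upper[OF s(1,2)] T(1) by auto
    have "z \<in> nilp_residual <#> A" using set_mult_upper(2)[OF sD s(2)] DAB z by blast
    then obtain x u where x: "x \<in> nilp_residual" "u \<in> A" "z = x \<otimes> u" by (rule set_multE)
    have c: "x \<in> carrier G" "u \<in> carrier G"
        using x subgroup.mem_carrier[OF sD] subgroup.mem_carrier[OF s(1)] by auto
    have "z \<otimes> inv u \<in> T" using z x AT subgroup.m_closed[OF sT] subgroup.m_inv_closed[OF sT] by blast
    moreover have "z \<otimes> inv u = x" using x(3) c by (simp add: m_assoc)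
    ultimately have "x \<in> ?D T" using x(1) by simp
    then have "x \<in> A" using DT d(4) by blast
    then show "z \<in> A" using x subgroup.m_closed[OF s(1)] by simp
  qed
  then have "B = E" using d(4) by blast
  then have "card A = card E" using cAB by simp
  moreover have "E \<subseteq> A" using d(4) by blast
  ultimately have "E = A" using card_subset_eq[OF finite_subgroup[OF s(1)], of E] by simp
  then show False using d(9) by blast
qed

end

theorem theoremA:
  fixes G :: "('a, 'b) monoid_scheme"
    and I :: "'i set" and \<sigma> :: "'i \<Rightarrow> nat set"
  assumes "prime_partition I \<sigma>"
    and "group G" and "finite (carrier G)"
    and "sigma_full I \<sigma> G"
  defines "D \<equiv> sigma_nilpotent_residual I \<sigma> G"
    and "\<L> \<equiv> sigma_perm_lattice I \<sigma> G"
  shows "distributive \<L> \<longleftrightarrow>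
    (\<forall>A\<in>carrier \<L>. \<forall>B\<in>carrier \<L>. A <#>\<^bsub>G\<^esub> B = B <#>\<^bsub>G\<^esub> A) \<and>
    distributive (normal_lattice G) \<and>
    (cyclic_group (G Mod D) \<and> meet_distributive \<L> D) \<and>
    (\<forall>R. R \<lhd> G \<longrightarrow> (\<forall>i\<in>I. isomorphic_sections_coincide I \<sigma> (G Mod R) i))"
proof -
  interpret fin_group G using assms(2,3) by (simp add: fin_group_def fin_group_axioms_def)
  interpret sigma_group G I \<sigma>
    using assms(1,4) sigma_full_iff[OF assms(1)] by unfold_locales auto
  interpret S: set_lattice "{A. permutable A}" "\<lambda>A B. generate G (A \<union> B)" using permutable_lattice .
  have L: "\<L> = inclusion_order {A. permutable A}" unfolding \<L>_def by (rule sigma_perm_lattice_eq)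
  have D: "D = nilp_residual" unfolding D_def by (rule sigma_nilpotent_residual_eq)
  have car: "carrier \<L> = {A. permutable A}" unfolding L S.LS_simps ..
  have dis: "distributive \<L> \<longleftrightarrow> (\<forall>A B C. permutable A \<longrightarrow> permutable B \<longrightarrow> permutable C \<longrightarrow>
      A \<inter> generate G (B \<union> C) = generate G ((A \<inter> B) \<union> (A \<inter> C)))"
    unfolding L S.LS_distributive by blast
  have md: "meet_distributive \<L> D \<longleftrightarrow> (\<forall>B C. permutable B \<longrightarrow> permutable C \<longrightarrow>
      nilp_residual \<inter> generate G (B \<union> C) = generate G ((nilp_residual \<inter> B) \<union> (nilp_residual \<inter> C)))"
    unfolding L D S.LS_meet_distributive using nilp_residual_permutable by simp
  show ?thesis
    unfolding dis md car unfolding D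
  proof (intro iffI conjI ballI allI impI; (elim conjE)?)
    assume *: "\<forall>A B C. permutable A \<longrightarrow> permutable B \<longrightarrow> permutable C \<longrightarrow>
      A \<inter> generate G (B \<union> C) = generate G ((A \<inter> B) \<union> (A \<inter> C))"
    then have dist: "A \<inter> generate G (B \<union> C) = generate G ((A \<inter> B) \<union> (A \<inter> C))"
      if "permutable A" "permutable B" "permutable C" for A B C using that by blast
    show "A <#>\<^bsub>G\<^esub> B = B <#>\<^bsub>G\<^esub> A" if "A \<in> {A. permutable A}" "B \<in> {A. permutable A}" for A B
      using dist_permute[OF dist] that by blast
    show "distributive (normal_lattice G)" using dist_normal_lattice[OF dist] .
    show "cyclic_group (G Mod nilp_residual)" using dist_cyclic[OF dist] .
    show "nilp_residual \<inter> generate G (B \<union> C) = generate G ((nilp_residual \<inter> B) \<union> (nilp_residual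
        \<inter> C))" if "permutable B" "permutable C" for B C
      using dist[OF nilp_residual_permutable that] .
    show "isomorphic_sections_coincide I \<sigma> (G Mod R) i" if "R \<lhd> G" "i \<in> I" for R i
      using dist_sections[OF dist that] .
  next
    fix A B C
    assume perm: "\<forall>A\<in>{A. permutable A}. \<forall>B\<in>{A. permutable A}. A <#>\<^bsub>G\<^esub> B = B <#>\<^bsub>G\<^esub> A"
      and cyc: "cyclic_group (G Mod nilp_residual)"
      and meet: "\<forall>B C. permutable B \<longrightarrow> permutable C \<longrightarrow>
        nilp_residual \<inter> generate G (B \<union> C) = generate G ((nilp_residual \<inter> B) \<union> (nilp_residual \<inter> C))"
      and iv: "\<forall>R. R \<lhd> G \<longrightarrow> (\<forall>i\<in>I. isomorphic_sections_coincide I \<sigma> (G Mod R) i)"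
      and ABC: "permutable A" "permutable B" "permutable C"
    show "A \<inter> generate G (B \<union> C) = generate G ((A \<inter> B) \<union> (A \<inter> C))"
    proof (rule distributive_of_conditions[OF _ cyc _ _ ABC])
      show "U <#>\<^bsub>G\<^esub> V = V <#>\<^bsub>G\<^esub> U" if "permutable U" "permutable V" for U V using perm that
          by simp
      show "nilp_residual \<inter> generate G (U \<union> V) = generate G ((nilp_residual \<inter> U) \<union> (nilp_residual
          \<inter> V))"
        if "permutable U" "permutable V" for U V using meet that by simp
      show "isomorphic_sections_coincide I \<sigma> (G Mod R) i" if "R \<lhd> G" "i \<in> I" for R i
        using iv that by simp
    qed
  qed
qed

end
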